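(* Let $X$ be a compact Hausdorff space, $\Delta_1\subset X$ clopen, $\alpha:\Delta_1\to X$ continuous with open image $\Delta_{-1}$, $\mathcal{A}=C(X)$, and let $\delta:\mathcal{A}\to\mathcal{A}$ be the endomorphism $\delta(a)=a\circ\alpha$ on $\Delta_1$, $\delta(a)=0$ off $\Delta_1$. Let $(\pi,U,H)\in\mathrm{CovFaithRep}(\mathcal{A},\delta)$. Then there exists an extension $\overline\pi$ of $\pi$ to the coefficient algebra $\mathcal{B}=C(\widetilde X)$ such that $\overline\pi:\mathcal{B}\to C^*\big(\bigcup_{n=0}^\infty U^{*n}\pi(\mathcal{A})U^n\big)$ is an isomorphism defined by $$[a_0,\dots,a_N,0,\dots]\longmapsto\pi(a_0)+U^*\pi(a_1)U+\dots+U^{*N}\pi(a_N)U^N.$$ Moreover, $(\overline\pi,U,H)\in\mathrm{CovFaithRep}(\mathcal{B},\widetilde\delta)$, that is, $$\overline\pi(\widetilde\delta(a))=U\overline\pi(a)U^*,\qquad\overline\pi(\widetilde\delta_*(a))=U^*\overline\pi(a)U,\qquad a\in\mathcal{B}.$$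
   Context: $\mathbb{N}=\{0,1,2,\dots\}$. For $n\ge1$, $\Delta_n$ is the domain of $\alpha^n$; $\Delta_0=X$. For a subset $K$ of a space $Y$, $C_K(Y)$ denotes the continuous functions on $Y$ vanishing outside $K$. Covariant faithful representation of $(\mathcal{A},\delta)$: a triple $(\pi,U,H)$ where $\pi:\mathcal{A}\to L(H)$ is a faithful representation on a Hilbert space $H$ and $U\in L(H)$ is a partial isometry with initial space $\pi(C_{\Delta_{-1}}(X))H$ and final space $\pi(C_{\Delta_1}(X))H$, such that $U\pi(a)U^*=\pi(\delta(a))$ for $a\in\mathcal{A}$. $\mathrm{CovFaithRep}(\mathcal{A},\delta)$ is the set of these. Reversible extension: adjoin to $X$ an isolated point, denoted $0$. $\widetilde X=\bigcup_{N\ge0}X_N\cup X_\infty\subset\prod_{n=0}^\infty(X\cup\{0\})$ with the topology induced from the product topology, where $X_N=\{(x_0,\dots,x_N,0,0,\dots):x_n\in\Delta_n,\ x_N\notin\Delta_{-1},\ \alpha(x_n)=x_{n-1}\text{ for }1\le n\le N\}$ and $X_\infty=\{(x_0,x_1,\dots):x_n\in\Delta_n,\ \alpha(x_n)=x_{n-1}\text{ for }n\ge1\}$. Let $\Phi(x_0,x_1,\dots)=x_0$, $\widetilde\Delta_{\pm1}=\Phi^{-1}(\Delta_{\pm1})$ (clopen), and let $\widetilde\alpha:\widetilde\Delta_1\to\widetilde\Delta_{-1}$ be the homeomorphism $\widetilde\alpha(x_0,x_1,\dots)=(\alpha(x_0),x_0,x_1,\dots)$. Coefficient algebra: $\mathcal{B}=C(\widetilde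 X)$, containing $\mathcal{A}$ via $a\mapsto a\circ\Phi$. For $a_n\in C_{\Delta_n}(X)$, $0\le n\le N$, $[a_0,\dots,a_N,0,\dots]\in\mathcal{B}$ is the function $\widetilde x=(x_0,x_1,\dots)\mapsto\sum_{n=0}^N a_n(x_n)$, with $a_n(x_n):=0$ if $x_n=0$; such functions form a dense $^*$-subalgebra of $\mathcal{B}$. $\widetilde\delta,\widetilde\delta_*:\mathcal{B}\to\mathcal{B}$ are the endomorphisms with $\widetilde\delta(b)=b\circ\widetilde\alpha$ on $\widetilde\Delta_1$, $0$ off $\widetilde\Delta_1$, and $\widetilde\delta_*(b)=b\circ\widetilde\alpha^{-1}$ on $\widetilde\Delta_{-1}$, $0$ off $\widetilde\Delta_{-1}$. $\mathrm{CovFaithRep}(\mathcal{B},\widetilde\delta)$ is the set of triples $(\rho,U,H)$ where $\rho:\mathcal{B}\to L(H)$ is a faithful representation on a Hilbert space $H$ and $U\in L(H)$ is a partial isometry with initial space $\rho(C_{\widetilde\Delta_{-1}}(\widetilde X))H$ and final space $\rho(C_{\widetilde\Delta_1}(\widetilde X))H$, such that $U\rho(b)U^*=\rho(\widetilde\delta(b))$ for $b\in\mathcal{B}$. *)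

theory Defs
  imports "HOL-Analysis.Analysis"
begin

text \<open>The distribution only has real inner product spaces. The inner product below is linear in the
  first argument; completeness comes from the class \<^class>\<open>banach\<close>.\<close>

class chilbert_space = banach +
  fixes scaleC :: "complex \<Rightarrow> 'a \<Rightarrow> 'a"  (infixr "*\<^sub>C" 75)
    and cinner :: "'a \<Rightarrow> 'a \<Rightarrow> complex"
  assumes scaleC_add_right: "c *\<^sub>C (x + y) = c *\<^sub>C x + c *\<^sub>C y"
    and scaleC_add_left: "(c + d) *\<^sub>C x = c *\<^sub>C x + d *\<^sub>C x"
    and scaleC_scaleC: "c *\<^sub>C (d *\<^sub>C x) = (c * d) *\<^sub>C x"
    and scaleR_scaleC: "r *\<^sub>R x = complex_of_real r *\<^sub>C x"
    and cinner_add_left: "cinner (x + y) z = cinner x z + cinner y z"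
    and cinner_scaleC_left: "cinner (c *\<^sub>C x) y = c * cinner x y"
    and cinner_commute: "cinner x y = cnj (cinner y x)"
    and cinner_self: "cinner x x = complex_of_real ((norm x)\<^sup>2)"

instantiation complex :: chilbert_space
begin

definition scaleC_complex :: "complex \<Rightarrow> complex \<Rightarrow> complex" where
  "scaleC_complex c x = c * x"

definition cinner_complex :: "complex \<Rightarrow> complex \<Rightarrow> complex" where
  "cinner_complex x y = x * cnj y"

instance
proof
  show "cinner x x = complex_of_real ((norm x)\<^sup>2)" for x :: complex
    by (simp only: cinner_complex_def complex_norm_square)
qed (simp_all add: scaleC_complex_def cinner_complex_def algebra_simps scaleR_conv_of_real)

end

lemma (in chilbert_space) norm_scaleC: "norm (c *\<^sub>C x) = cmod c * norm x"
proof -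
  have "complex_of_real ((norm (c *\<^sub>C x))\<^sup>2) = cinner (c *\<^sub>C x) (c *\<^sub>C x)"
    by (simp add: cinner_self)
  also have "\<dots> = c * cnj (cinner (c *\<^sub>C x) x)"
    by (simp only: cinner_scaleC_left cinner_commute[of x "c *\<^sub>C x"])
  also have "\<dots> = c * cnj (c * cinner x x)"
    by (simp only: cinner_scaleC_left)
  also have "\<dots> = complex_of_real ((cmod c * norm x)\<^sup>2)"
    by (simp only: cinner_self power_mult_distrib of_real_mult complex_norm_square[of c]
        complex_cnj_mult complex_cnj_complex_of_real mult.assoc)
  finally have "(norm (c *\<^sub>C x))\<^sup>2 = (cmod c * norm x)\<^sup>2"
    by (simp only: of_real_eq_iff)
  then show ?thesis
    by (simp add: power2_eq_iff_nonneg)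
qed

text \<open>The type of bounded operators of the library consists of the real-linear ones;
  \<open>L(H)\<close> is the set of those that are complex linear.\<close>

definition bounded_ops :: "('h::chilbert_space \<Rightarrow>\<^sub>L 'h) set" where
  "bounded_ops = {T :: 'h \<Rightarrow>\<^sub>L 'h. \<forall>c x. T (c *\<^sub>C x) = c *\<^sub>C T x}"

definition cscale_op :: "complex \<Rightarrow> ('h::chilbert_space \<Rightarrow>\<^sub>L 'h) \<Rightarrow> 'h \<Rightarrow>\<^sub>L 'h" where
  "cscale_op c T = Blinfun (\<lambda>x. c *\<^sub>C T x)"

lemma cscale_op_apply: "cscale_op c T x = c *\<^sub>C T x"
proof -
  have "c *\<^sub>C (r *\<^sub>R y) = r *\<^sub>R (c *\<^sub>C y)" for r and y :: 'a
    by (simp add: scaleR_scaleC scaleC_scaleC mult.commute)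
  then have "bounded_linear (\<lambda>y::'a. c *\<^sub>C y)"
    by (intro bounded_linear_intro[where K = "cmod c"])
      (simp_all add: scaleC_add_right norm_scaleC mult.commute)
  then have "bounded_linear (\<lambda>x. c *\<^sub>C T x)"
    by (rule bounded_linear_compose[OF _ blinfun.bounded_linear_right])
  then show ?thesis
    by (simp add: cscale_op_def bounded_linear_Blinfun_apply)
qed

definition adj :: "('h::chilbert_space \<Rightarrow>\<^sub>L 'h) \<Rightarrow> 'h \<Rightarrow>\<^sub>L 'h" where
  "adj T = (THE S :: 'h \<Rightarrow>\<^sub>L 'h. \<forall>x y. cinner (T x) y = cinner x (S y))"

definition op_pow :: "('h::chilbert_space \<Rightarrow>\<^sub>L 'h) \<Rightarrow> nat \<Rightarrow> 'h \<Rightarrow>\<^sub>L 'h" where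
  "op_pow T n = ((\<lambda>S. T o\<^sub>L S) ^^ n) id_blinfun"

definition initial_space :: "('h::chilbert_space \<Rightarrow>\<^sub>L 'h) \<Rightarrow> 'h set" where
  "initial_space U = {x. \<forall>y. U y = 0 \<longrightarrow> cinner x y = 0}"

definition final_space :: "('h::chilbert_space \<Rightarrow>\<^sub>L 'h) \<Rightarrow> 'h set" where
  "final_space U = range U"

definition partial_isometry :: "('h::chilbert_space \<Rightarrow>\<^sub>L 'h) \<Rightarrow> bool" where
  "partial_isometry U \<longleftrightarrow> U \<in> bounded_ops \<and> (\<forall>x\<in>initial_space U. norm (U x) = norm x)"

definition cstar_subalgebra :: "('h::chilbert_space \<Rightarrow>\<^sub>L 'h) set \<Rightarrow> bool" where
  "cstar_subalgebra B \<longleftrightarrow> B \<subseteq> bounded_ops \<and> closed B \<and> 0 \<in> B \<and>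
     (\<forall>S\<in>B. \<forall>T\<in>B. S + T \<in> B \<and> S o\<^sub>L T \<in> B) \<and>
     (\<forall>T\<in>B. adj T \<in> B \<and> (\<forall>c. cscale_op c T \<in> B))"

definition cstar_generated :: "('h::chilbert_space \<Rightarrow>\<^sub>L 'h) set \<Rightarrow> ('h \<Rightarrow>\<^sub>L 'h) set" where
  "cstar_generated G = \<Inter>{B. cstar_subalgebra B \<and> G \<subseteq> B}"

text \<open>An element of \<open>C(Y)\<close> is represented by its extension by zero to the whole underlying type, so
  that the pointwise operations of the function type restrict to those of \<open>C(Y)\<close>.\<close>

definition cfun :: "'b topology \<Rightarrow> ('b \<Rightarrow> complex) set" where
  "cfun Y = {f. continuous_map Y euclidean f \<and> (\<forall>x. x \<notin> topspace Y \<longrightarrow> f x = 0)}"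

definition cfun_on :: "'b set \<Rightarrow> 'b topology \<Rightarrow> ('b \<Rightarrow> complex) set" where
  "cfun_on K Y = {f \<in> cfun Y. \<forall>x. x \<notin> K \<longrightarrow> f x = 0}"

text \<open>Representations are \<open>*\<close>-homomorphisms into \<open>L(H)\<close>; they are not required to be unital.\<close>

definition star_rep :: "'b topology \<Rightarrow> (('b \<Rightarrow> complex) \<Rightarrow> 'h::chilbert_space \<Rightarrow>\<^sub>L 'h) \<Rightarrow> bool" where
  "star_rep Y \<pi> \<longleftrightarrow>
     (\<forall>f\<in>cfun Y. \<pi> f \<in> bounded_ops) \<and>
     (\<forall>f\<in>cfun Y. \<forall>g\<in>cfun Y. \<pi> (\<lambda>x. f x + g x) = \<pi> f + \<pi> g) \<and>
     (\<forall>f\<in>cfun Y. \<forall>g\<in>cfun Y. \<pi> (\<lambda>x. f x * g x) = \<pi> f o\<^sub>L \<pi> g) \<and>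
     (\<forall>f\<in>cfun Y. \<forall>c. \<pi> (\<lambda>x. c * f x) = cscale_op c (\<pi> f)) \<and>
     (\<forall>f\<in>cfun Y. \<pi> (\<lambda>x. cnj (f x)) = adj (\<pi> f))"

definition faithful_rep :: "'b topology \<Rightarrow> (('b \<Rightarrow> complex) \<Rightarrow> 'h::chilbert_space \<Rightarrow>\<^sub>L 'h) \<Rightarrow> bool" where
  "faithful_rep Y \<pi> \<longleftrightarrow> star_rep Y \<pi> \<and> inj_on \<pi> (cfun Y)"

definition comp_endo :: "'b set \<Rightarrow> ('b \<Rightarrow> 'b) \<Rightarrow> ('b \<Rightarrow> complex) \<Rightarrow> 'b \<Rightarrow> complex" where
  "comp_endo D \<phi> f = (\<lambda>x. if x \<in> D then f (\<phi> x) else 0)"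

text \<open>In the following definition \<open>D\<close> and \<open>E\<close> play the roles of \<open>\<Delta>\<^sub>1\<close> and \<open>\<Delta>\<^sub>-\<^sub>1\<close>.
  Both are clopen in the intended use, so that the set of all \<open>\<pi> f h\<close> with \<open>f\<close> vanishing off \<open>E\<close> is
  the range of the projection \<open>\<pi> (indicator E)\<close> and no closed linear span is needed.\<close>

definition cov_faith_rep ::
  "'b topology \<Rightarrow> 'b set \<Rightarrow> 'b set \<Rightarrow> (('b \<Rightarrow> complex) \<Rightarrow> 'b \<Rightarrow> complex) \<Rightarrow>
   (('b \<Rightarrow> complex) \<Rightarrow> 'h::chilbert_space \<Rightarrow>\<^sub>L 'h) \<Rightarrow> ('h \<Rightarrow>\<^sub>L 'h) \<Rightarrow> bool" where
  "cov_faith_rep Y D E \<delta> \<pi> U \<longleftrightarrow>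
     faithful_rep Y \<pi> \<and> partial_isometry U \<and>
     initial_space U = {\<pi> f h |f h. f \<in> cfun_on E Y} \<and>
     final_space U = {\<pi> f h |f h. f \<in> cfun_on D Y} \<and>
     (\<forall>f\<in>cfun Y. U o\<^sub>L \<pi> f o\<^sub>L adj U = \<pi> (\<delta> f))"

text \<open>The partial map is given by its domain \<open>D\<close> and a total function \<open>\<alpha>\<close>, whose values outside \<open>D\<close>
  are irrelevant.\<close>

primrec dom_iter :: "'a topology \<Rightarrow> 'a set \<Rightarrow> ('a \<Rightarrow> 'a) \<Rightarrow> nat \<Rightarrow> 'a set" where
  "dom_iter X D \<alpha> 0 = topspace X"
| "dom_iter X D \<alpha> (Suc n) = {x \<in> D. \<alpha> x \<in> dom_iter X D \<alpha> n}"

text \<open>\<open>None\<close> is the isolated point \<open>0\<close>.\<close>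

definition adjoin_zero :: "'a topology \<Rightarrow> 'a option topology" where
  "adjoin_zero X =
     topology (\<lambda>W. W \<subseteq> insert None (Some ` topspace X) \<and> openin X {x. Some x \<in> W})"

lemma openin_adjoin_zero:
  "openin (adjoin_zero X) W \<longleftrightarrow>
     W \<subseteq> insert None (Some ` topspace X) \<and> openin X {x. Some x \<in> W}"
proof -
  have inter: "openin X {x. Some x \<in> V \<inter> W}"
    if "openin X {x. Some x \<in> V}" "openin X {x. Some x \<in> W}" for V W
    using openin_Int[OF that] by (simp add: Collect_conj_eq)
  have union: "openin X {x. Some x \<in> \<Union>K}" if "\<forall>W\<in>K. openin X {x. Some x \<in> W}" for K
  proof -
    have "{x. Some x \<in> \<Union>K} = (\<Union>W\<in>K. {x. Some x \<in> W})"
      by auto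
    then show ?thesis
      using that by (auto intro: openin_Union)
  qed
  have "istopology (\<lambda>W. W \<subseteq> insert None (Some ` topspace X) \<and> openin X {x. Some x \<in> W})"
    unfolding istopology_def using inter union by blast
  then show ?thesis
    by (simp add: adjoin_zero_def topology_inverse')
qed

definition ext_fin :: "'a topology \<Rightarrow> 'a set \<Rightarrow> ('a \<Rightarrow> 'a) \<Rightarrow> nat \<Rightarrow> (nat \<Rightarrow> 'a option) set" where
  "ext_fin X D \<alpha> N =
     {(\<lambda>n. if n \<le> N then Some (p n) else None) |p.
        (\<forall>n\<le>N. p n \<in> dom_iter X D \<alpha> n) \<and> p N \<notin> \<alpha> ` D \<and>
        (\<forall>n. 1 \<le> n \<and> n \<le> N \<longrightarrow> \<alpha> (p n) = p (n - 1))}"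

definition ext_inf :: "'a topology \<Rightarrow> 'a set \<Rightarrow> ('a \<Rightarrow> 'a) \<Rightarrow> (nat \<Rightarrow> 'a option) set" where
  "ext_inf X D \<alpha> =
     {(\<lambda>n. Some (p n)) |p.
        (\<forall>n. p n \<in> dom_iter X D \<alpha> n) \<and> (\<forall>n\<ge>1. \<alpha> (p n) = p (n - 1))}"

definition ext_space :: "'a topology \<Rightarrow> 'a set \<Rightarrow> ('a \<Rightarrow> 'a) \<Rightarrow> (nat \<Rightarrow> 'a option) topology" where
  "ext_space X D \<alpha> =
     subtopology (product_topology (\<lambda>_. adjoin_zero X) UNIV)
       ((\<Union>N. ext_fin X D \<alpha> N) \<union> ext_inf X D \<alpha>)"

text \<open>The first coordinate of a point of the extension is never \<open>None\<close>.\<close>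

definition ext_proj :: "(nat \<Rightarrow> 'a option) \<Rightarrow> 'a" where
  "ext_proj x = the (x 0)"

definition ext_preimage :: "'a topology \<Rightarrow> 'a set \<Rightarrow> ('a \<Rightarrow> 'a) \<Rightarrow> 'a set \<Rightarrow> (nat \<Rightarrow> 'a option) set" where
  "ext_preimage X D \<alpha> S = {x \<in> topspace (ext_space X D \<alpha>). ext_proj x \<in> S}"

definition ext_map :: "('a \<Rightarrow> 'a) \<Rightarrow> (nat \<Rightarrow> 'a option) \<Rightarrow> nat \<Rightarrow> 'a option" where
  "ext_map \<alpha> x = case_nat (Some (\<alpha> (ext_proj x))) x"

definition ext_embed ::
  "'a topology \<Rightarrow> 'a set \<Rightarrow> ('a \<Rightarrow> 'a) \<Rightarrow> ('a \<Rightarrow> complex) \<Rightarrow> (nat \<Rightarrow> 'a option) \<Rightarrow> complex" where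
  "ext_embed X D \<alpha> a = (\<lambda>x. if x \<in> topspace (ext_space X D \<alpha>) then a (ext_proj x) else 0)"

definition ext_bracket ::
  "'a topology \<Rightarrow> 'a set \<Rightarrow> ('a \<Rightarrow> 'a) \<Rightarrow> nat \<Rightarrow> (nat \<Rightarrow> 'a \<Rightarrow> complex) \<Rightarrow>
   (nat \<Rightarrow> 'a option) \<Rightarrow> complex" where
  "ext_bracket X D \<alpha> N a =
     (\<lambda>x. if x \<in> topspace (ext_space X D \<alpha>)
          then \<Sum>n\<le>N. (case x n of None \<Rightarrow> 0 | Some y \<Rightarrow> a n y) else 0)"

definition ext_endo ::
  "'a topology \<Rightarrow> 'a set \<Rightarrow> ('a \<Rightarrow> 'a) \<Rightarrow>
   ((nat \<Rightarrow> 'a option) \<Rightarrow> complex) \<Rightarrow> (nat \<Rightarrow> 'a option) \<Rightarrow> complex" where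
  "ext_endo X D \<alpha> = comp_endo (ext_preimage X D \<alpha> D) (ext_map \<alpha>)"

definition ext_endo_inv ::
  "'a topology \<Rightarrow> 'a set \<Rightarrow> ('a \<Rightarrow> 'a) \<Rightarrow>
   ((nat \<Rightarrow> 'a option) \<Rightarrow> complex) \<Rightarrow> (nat \<Rightarrow> 'a option) \<Rightarrow> complex" where
  "ext_endo_inv X D \<alpha> =
     comp_endo (ext_preimage X D \<alpha> (\<alpha> ` D)) (inv_into (ext_preimage X D \<alpha> D) (ext_map \<alpha>))"

end

(* A representation of C(X~) is built from the algebraic bracket formula by density.  Splitting
   a_N into its parts off and on the range of alpha and moving the latter one level up, every bracket
   is a bracket whose coefficients a_n with n < N vanish on the range.  For such reduced brackets at
   most one term is nonzero at each point, and the operators U*^n pi(a_n) U^n are mutually orthogonal,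
   so that the bracket formula is multiplicative, injective and compatible with continuous functional
   calculus; functional calculus makes it isometric.  The brackets separate the points of the compact
   space X~, hence are uniformly dense, and the isometry extends to C(X~) with image the closed span
   of the operators U*^n pi(a) U^n.  The covariance relations are checked on single terms. *)

theory Submission
  imports Defs
begin

subsection \<open>Adjoints on complex Hilbert spaces\<close>

text \<open>Reduced brackets of length N form the direct sum of the functions on
  \<open>\<Delta> n\<close> minus the range, for n < N, and of those on \<open>\<Delta> N\<close>:
  at a point of the extension only its last nonzero coordinate up to N contributes. The coefficient
  of index N must remain free, since an orbit may have infinitely many nonzero coordinates;
  therefore brackets are compared only after being brought to a common length. On the operator side
  the disjointness of the summands is the relation \<open>\<pi> a\<close> U* = U*
  \<open>\<pi> (\<delta> a)\<close>, whose right side is 0 when a vanishes on the range. The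
  brackets of all lengths need not form a complete algebra, so the isometry cannot be taken from the
  theorem on injective homomorphisms of C*-algebras. Square roots replace it: a continuous function
  vanishing at 0 acts coefficientwise on a reduced bracket, which keeps moduli and roots inside the
  algebra, and both norm estimates follow by writing a positive function as |h|^2. The condition at
  0 keeps supports and the range condition intact; constants are handled through the unit of C(X~),
  whose operator may be a proper projection.\<close>

lemma cinner_add_right: "cinner x (y + z) = cinner x y + cinner x z"
  for x y z :: "'h::chilbert_space"
  by (metis cinner_add_left cinner_commute complex_cnj_add)

lemma cinner_scaleC_right: "cinner x (c *\<^sub>C y) = cnj c * cinner x y"
  for x y :: "'h::chilbert_space"
  by (metis cinner_scaleC_left cinner_commute complex_cnj_mult)

lemma cinner_scaleR_left: "cinner (r *\<^sub>R x) y = complex_of_real r * cinner x y"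
  for x y :: "'h::chilbert_space"
  by (simp add: scaleR_scaleC cinner_scaleC_left)

lemma cinner_scaleR_right: "cinner x (r *\<^sub>R y) = complex_of_real r * cinner x y"
  for x y :: "'h::chilbert_space"
  by (simp add: scaleR_scaleC cinner_scaleC_right)

lemma cinner_zero_left [simp]: "cinner 0 y = 0" for y :: "'h::chilbert_space"
  using cinner_scaleR_left[of 0 0 y] by simp

lemma cinner_zero_right [simp]: "cinner x 0 = 0" for x :: "'h::chilbert_space"
  using cinner_scaleR_right[of x 0 0] by simp

lemma cinner_diff_left: "cinner (x - y) z = cinner x z - cinner y z"
  for x y z :: "'h::chilbert_space"
  using cinner_add_left[of "x - y" y z] by simp

lemma cinner_diff_right: "cinner x (y - z) = cinner x y - cinner x z"
  for x y z :: "'h::chilbert_space"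
  using cinner_add_right[of x "y - z" z] by simp

lemma Re_cinner_commute: "Re (cinner x y) = Re (cinner y x)"
  for x y :: "'h::chilbert_space"
  by (metis cinner_commute cnj.sel(1))

lemma Re_cinner_self: "Re (cinner x x) = (norm x)\<^sup>2" for x :: "'h::chilbert_space"
  by (simp add: cinner_self)

lemma norm_add_sq: "(norm (x + y))\<^sup>2 = (norm x)\<^sup>2 + 2 * Re (cinner x y) + (norm y)\<^sup>2"
  for x y :: "'h::chilbert_space"
  using Re_cinner_commute[of y x]
  by (simp flip: Re_cinner_self add: cinner_add_left cinner_add_right)

lemma norm_diff_sq: "(norm (x - y))\<^sup>2 = (norm x)\<^sup>2 - 2 * Re (cinner x y) + (norm y)\<^sup>2"
  for x y :: "'h::chilbert_space"
  using Re_cinner_commute[of y x]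
  by (simp flip: Re_cinner_self add: cinner_diff_left cinner_diff_right)

text \<open>The norm satisfies the triangle inequality by the type class, so the Cauchy-Schwarz
  inequality is read off from it.\<close>

lemma Re_cinner_le: "Re (cinner x y) \<le> norm x * norm y" for x y :: "'h::chilbert_space"
proof -
  have "(norm (x + y))\<^sup>2 \<le> (norm x + norm y)\<^sup>2"
    by (simp add: norm_triangle_ineq)
  then show ?thesis
    unfolding norm_add_sq by (simp add: power2_sum)
qed

lemma cmod_cinner_le: "cmod (cinner x y) \<le> norm x * norm y" for x y :: "'h::chilbert_space"
proof -
  \<comment> \<open>The phase \<open>u\<close> rotates the inner product onto the positive real
    axis, where the bound for real parts applies.\<close>
  define u where "u = cnj (sgn (cinner x y))"
  have "complex_of_real (cmod (cinner x y)) = u * cinner x y"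
    unfolding u_def sgn_eq
    by (simp add: complex_norm_square[symmetric] power2_eq_square mult.commute)
  then have "cmod (cinner x y) = Re (cinner (u *\<^sub>C x) y)"
    by (metis Re_complex_of_real cinner_scaleC_left)
  also have "\<dots> \<le> cmod u * norm x * norm y"
    using Re_cinner_le[of "u *\<^sub>C x" y] by (simp add: norm_scaleC)
  also have "\<dots> \<le> norm x * norm y"
    by (simp add: u_def norm_sgn)
  finally show ?thesis .
qed

lemma cinner_eq_all_imp_eq:
  fixes y z :: "'h::chilbert_space"
  assumes "\<And>x. cinner x y = cinner x z"
  shows "y = z"
proof -
  have "cinner (y - z) (y - z) = 0"
    using assms[of "y - z"] by (simp only: cinner_diff_right) simp
  then show ?thesis
    by (simp add: cinner_self)
qed

lemma scaleC_minus: "c *\<^sub>C (x - y) = c *\<^sub>C x - c *\<^sub>C y" for x y :: "'h::chilbert_space"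
  using scaleC_add_right[of c "x - y" y] by simp

text \<open>The representing vector minimises \<open>\<parallel>x\<parallel>\<^sup>2 - 2 Re (\<phi> x)\<close>.\<close>

lemma riesz_representation:
  fixes \<phi> :: "'h::chilbert_space \<Rightarrow> complex"
  assumes add: "\<And>x y. \<phi> (x + y) = \<phi> x + \<phi> y"
    and scale: "\<And>c x. \<phi> (c *\<^sub>C x) = c * \<phi> x"
    and bound: "\<And>x. cmod (\<phi> x) \<le> K * norm x"
  shows "\<exists>z. \<forall>x. \<phi> x = cinner x z"
proof -
  define Q where "Q x = (norm x)\<^sup>2 - 2 * Re (\<phi> x)" for x
  have scaleR: "\<phi> (r *\<^sub>R x) = complex_of_real r * \<phi> x" for r x
    by (simp add: scale scaleR_scaleC)
  have Re_add: "Re (\<phi> (x + y)) = Re (\<phi> x) + Re (\<phi> y)" for x y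
    by (simp add: add)
  have lower: "Q x \<ge> - K\<^sup>2" for x
  proof -
    have "Re (\<phi> x) \<le> K * norm x"
      using bound[of x] complex_Re_le_cmod order_trans by blast
    moreover have "0 \<le> (norm x - K)\<^sup>2" by simp
    ultimately show ?thesis
      unfolding Q_def power2_diff by (simp add: algebra_simps)
  qed
  define m where "m = (INF x. Q x)"
  have bdd: "bdd_below (range Q)"
    using lower by (intro bdd_belowI2)
  have mQ: "m \<le> Q x" for x
    unfolding m_def using bdd by (intro cINF_lower) auto
  have "\<exists>x. Q x < m + inverse (real (Suc n))" for n
  proof -
    have "Inf (range Q) < m + inverse (real (Suc n))"
      by (simp add: m_def del: of_nat_Suc)
    then show ?thesis
      using cInf_lessD[of "range Q"] by blast
  qed
  then obtain s where s: "\<And>n. Q (s n) < m + inverse (real (Suc n))"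
    by metis
  \<comment> \<open>Parallelogram law: since Q is at least m at the midpoint of x and y, almost
    minimal vectors are close together.\<close>
  have par: "(norm (x - y))\<^sup>2 \<le> 2 * (Q x + Q y - 2 * m)" for x y
  proof -
    have "Q ((1/2) *\<^sub>R (x + y)) = (norm (x + y))\<^sup>2 / 4 - Re (\<phi> x) - Re (\<phi> y)"
    proof -
      have "norm ((1/2) *\<^sub>R (x + y)) = norm (x + y) / 2"
        by (simp only: norm_scaleR)
      moreover have "Re (\<phi> ((1/2) *\<^sub>R (x + y))) = (Re (\<phi> x) + Re (\<phi> y)) / 2"
        by (simp only: scaleR add) simp
      ultimately show ?thesis
        unfolding Q_def by (simp add: power_divide)
    qed
    then show ?thesis
      using mQ[of "(1/2) *\<^sub>R (x + y)"] norm_add_sq[of x y] norm_diff_sq[of x y]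
        Q_def[of x] Q_def[of y] by argo
  qed
  have "Cauchy s"
  proof (rule CauchyI)
    fix e :: real assume "e > 0"
    then obtain M where M: "inverse (real (Suc M)) < e\<^sup>2 / 4"
      using reals_Archimedean[of "e\<^sup>2 / 4"] by auto
    have "norm (s i - s j) < e" if "i \<ge> M" "j \<ge> M" for i j
    proof -
      have "inverse (real (Suc i)) \<le> inverse (real (Suc M))"
        "inverse (real (Suc j)) \<le> inverse (real (Suc M))"
        using that by (simp_all add: le_imp_inverse_le)
      then have "(norm (s i - s j))\<^sup>2 < e\<^sup>2"
        using par[of "s i" "s j"] s[of i] s[of j] M by argo
      then show ?thesis
        using \<open>e > 0\<close> by (simp add: power_less_imp_less_base)
    qed
    then show "\<exists>M. \<forall>i\<ge>M. \<forall>j\<ge>M. norm (s i - s j) < e" by blast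
  qed
  then obtain z where z: "s \<longlonglongrightarrow> z"
    using Cauchy_convergent_iff convergent_def by blast
  have "bounded_linear \<phi>"
    by (intro bounded_linear_intro[where K = K])
      (simp_all add: add scaleR bound mult.commute[of _ K] scaleR_conv_of_real)
  then have "(\<lambda>n. \<phi> (s n)) \<longlonglongrightarrow> \<phi> z"
    using bounded_linear.tendsto z by blast
  then have "(\<lambda>n. Q (s n)) \<longlonglongrightarrow> Q z"
    unfolding Q_def by (intro tendsto_intros z)
  moreover have "(\<lambda>n. m + inverse (real (Suc n))) \<longlonglongrightarrow> m + 0"
    by (intro tendsto_intros LIMSEQ_inverse_real_of_nat)
  ultimately have "Q z \<le> m + 0"
    by (rule LIMSEQ_le) (use s less_imp_le in blast)
  then have min: "Q z \<le> Q x" for x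
    using mQ[of x] by simp
  have Re_eq: "Re (\<phi> x) = Re (cinner x z)" for x
  proof (rule ccontr)
    assume neq: "Re (\<phi> x) \<noteq> Re (cinner x z)"
    define d where "d = Re (\<phi> x) - Re (cinner x z)"
    have "0 \<le> t\<^sup>2 * (norm x)\<^sup>2 - 2 * t * d" for t
      using min[of "z + t *\<^sub>R x"] Re_cinner_commute[of z x] unfolding Q_def norm_add_sq d_def
      by (simp add: add scaleR cinner_scaleR_right power_mult_distrib algebra_simps)
    \<comment> \<open>The minimum point d / |x|^2 of the quadratic, with 1 added to keep the
      denominator positive for x = 0.\<close>
    moreover define t where "t = d / ((norm x)\<^sup>2 + 1)"
    moreover have d: "d = t * ((norm x)\<^sup>2 + 1)"
      using zero_le_power2[of "norm x"] by (simp add: t_def add_nonneg_eq_0_iff)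
    ultimately have "0 \<le> t\<^sup>2 * (norm x)\<^sup>2 - 2 * t * (t * ((norm x)\<^sup>2 + 1))"
      by metis
    then have "t\<^sup>2 * ((norm x)\<^sup>2 + 2) \<le> 0"
      by (simp add: power2_eq_square algebra_simps)
    moreover have "t\<^sup>2 * ((norm x)\<^sup>2 + 2) > 0"
      using neq d by (intro mult_pos_pos add_nonneg_pos) (auto simp: d_def)
    ultimately show False by simp
  qed
  have "\<phi> x = cinner x z" for x
    using Re_eq[of x] Re_eq[of "\<i> *\<^sub>C x"] by (simp add: complex_eq_iff scale cinner_scaleC_left)
  then show ?thesis by blast
qed

lemma bounded_ops_scaleC: "T \<in> bounded_ops \<Longrightarrow> T (c *\<^sub>C x) = c *\<^sub>C T x"
  by (simp add: bounded_ops_def)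

lemma adj_eqI:
  fixes S T :: "'h::chilbert_space \<Rightarrow>\<^sub>L 'h"
  assumes "\<And>x y. cinner (T x) y = cinner x (S y)"
  shows "adj T = S"
  unfolding adj_def
proof (rule the_equality)
  show "\<forall>x y. cinner (T x) y = cinner x (S y)" using assms by blast
next
  fix S' :: "'h \<Rightarrow>\<^sub>L 'h" assume S': "\<forall>x y. cinner (T x) y = cinner x (S' y)"
  have *: "cinner x (S' y) = cinner x (S y)" for x y
    using S' assms[of x y] by simp
  show "S' = S"
    by (rule blinfun_eqI, rule cinner_eq_all_imp_eq, rule *)
qed

text \<open>Riesz for x \<mapsto> <T x, y> gives S y for each y; uniqueness of the representing
  vector makes S linear, and |S y|^2 = Re <T (S y), y> bounds it.\<close>

lemma adj_exists:
  fixes T :: "'h::chilbert_space \<Rightarrow>\<^sub>L 'h"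
  assumes T: "T \<in> bounded_ops"
  shows "\<exists>S :: 'h \<Rightarrow>\<^sub>L 'h. S \<in> bounded_ops \<and> norm S \<le> norm T \<and> (\<forall>x y. cinner (T x) y = cinner x (S y))"
proof -
  have "\<exists>z. \<forall>x. cinner (T x) y = cinner x z" for y
  proof (rule riesz_representation[where K = "norm T * norm y"])
    fix x
    have "cmod (cinner (T x) y) \<le> norm (T x) * norm y"
      by (rule cmod_cinner_le)
    also have "\<dots> \<le> norm T * norm x * norm y"
      by (intro mult_right_mono norm_blinfun) simp
    finally show "cmod (cinner (T x) y) \<le> norm T * norm y * norm x"
      by (simp add: mult_ac)
  qed (simp_all add: blinfun.add_right cinner_add_left bounded_ops_scaleC[OF T] cinner_scaleC_left)
  then obtain S where S: "\<And>x y. cinner (T x) y = cinner x (S y)"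
    by metis
  have add: "S (x + y) = S x + S y" for x y
    by (rule cinner_eq_all_imp_eq) (simp add: cinner_add_right flip: S)
  have scale: "S (c *\<^sub>C x) = c *\<^sub>C S x" for c x
    by (rule cinner_eq_all_imp_eq) (simp add: cinner_scaleC_right flip: S)
  have bound: "norm (S y) \<le> norm T * norm y" for y
  proof (cases "S y = 0")
    case False
    have "(norm (S y))\<^sup>2 = Re (cinner (T (S y)) y)"
      by (simp add: S Re_cinner_self)
    also have "\<dots> \<le> norm (T (S y)) * norm y"
      by (rule Re_cinner_le)
    also have "\<dots> \<le> norm T * norm (S y) * norm y"
      by (intro mult_right_mono norm_blinfun) simp
    finally show ?thesis
      using False by (simp add: power2_eq_square)
  qed simp
  have "bounded_linear S"
    by (intro bounded_linear_intro[where K = "norm T"])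
      (simp_all add: add scale scaleR_scaleC bound mult.commute[of _ "norm T"])
  then have *: "Blinfun S y = S y" for y
    by (simp add: bounded_linear_Blinfun_apply)
  show ?thesis
    by (rule exI[where x = "Blinfun S"])
      (auto simp: * S bounded_ops_def scale bound intro: norm_blinfun_bound)
qed

lemma
  fixes T :: "'h::chilbert_space \<Rightarrow>\<^sub>L 'h"
  assumes "T \<in> bounded_ops"
  shows cinner_adj_right: "cinner (T x) y = cinner x (adj T y)"
    and adj_bounded_ops: "adj T \<in> bounded_ops"
    and norm_adj_le: "norm (adj T) \<le> norm T"
  using adj_exists[OF assms] adj_eqI[of T] by metis+

lemma cinner_adj_left: "T \<in> bounded_ops \<Longrightarrow> cinner (adj T x) y = cinner x (T y)"
  by (metis cinner_adj_right cinner_commute)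

lemma adj_adj: "T \<in> bounded_ops \<Longrightarrow> adj (adj T) = T"
  by (intro adj_eqI) (simp add: cinner_adj_left)

section \<open>The star-algebra L(H) and its norm limits\<close>

lemma bounded_ops_zero [simp]: "0 \<in> bounded_ops"
  by (simp add: bounded_ops_def) (metis scaleC_minus diff_self)

lemma bounded_ops_add: "S \<in> bounded_ops \<Longrightarrow> T \<in> bounded_ops \<Longrightarrow> S + T \<in> bounded_ops"
  by (simp add: bounded_ops_def blinfun.add_left scaleC_add_right)

lemma bounded_ops_diff: "S \<in> bounded_ops \<Longrightarrow> T \<in> bounded_ops \<Longrightarrow> S - T \<in> bounded_ops"
  by (simp add: bounded_ops_def blinfun.diff_left scaleC_minus)

lemma bounded_ops_compose: "S \<in> bounded_ops \<Longrightarrow> T \<in> bounded_ops \<Longrightarrow> S o\<^sub>L T \<in> bounded_ops"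
  by (simp add: bounded_ops_def)

lemma bounded_ops_sum: "(\<And>i. i \<in> I \<Longrightarrow> T i \<in> bounded_ops) \<Longrightarrow> sum T I \<in> bounded_ops"
  by (induction I rule: infinite_finite_induct) (auto intro: bounded_ops_add)

lemma adj_zero [simp]: "adj (0 :: 'h::chilbert_space \<Rightarrow>\<^sub>L 'h) = 0"
  by (rule adj_eqI) simp

lemma adj_add: "S \<in> bounded_ops \<Longrightarrow> T \<in> bounded_ops \<Longrightarrow> adj (S + T) = adj S + adj T"
  by (rule adj_eqI) (simp add: blinfun.add_left cinner_add_left cinner_add_right cinner_adj_right)

lemma adj_diff: "S \<in> bounded_ops \<Longrightarrow> T \<in> bounded_ops \<Longrightarrow> adj (S - T) = adj S - adj T"
  by (rule adj_eqI) (simp add: blinfun.diff_left cinner_diff_left cinner_diff_right cinner_adj_right)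

lemma adj_compose: "S \<in> bounded_ops \<Longrightarrow> T \<in> bounded_ops \<Longrightarrow> adj (S o\<^sub>L T) = adj T o\<^sub>L adj S"
  by (rule adj_eqI) (simp add: cinner_adj_right)

lemma adj_sum: "(\<And>i. i \<in> I \<Longrightarrow> T i \<in> bounded_ops) \<Longrightarrow> adj (sum T I) = (\<Sum>i\<in>I. adj (T i))"
  by (induction I rule: infinite_finite_induct) (auto simp: adj_add bounded_ops_sum)

lemma scaleC_zero_right [simp]: "c *\<^sub>C 0 = (0 :: 'h::chilbert_space)"
  by (metis scaleC_minus diff_self)

lemma cscale_op_diff: "cscale_op c (S - T) = cscale_op c S - cscale_op c T"
  by (rule blinfun_eqI) (simp add: cscale_op_apply blinfun.diff_left scaleC_minus)

lemma cscale_op_add: "cscale_op c (S + T) = cscale_op c S + cscale_op c T"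
  by (rule blinfun_eqI) (simp add: cscale_op_apply blinfun.add_left scaleC_add_right)

lemma cscale_op_sum: "cscale_op c (sum T I) = (\<Sum>i\<in>I. cscale_op c (T i))"
proof (induction I rule: infinite_finite_induct)
  case (insert i I)
  then show ?case by (simp add: cscale_op_add)
qed (auto intro: blinfun_eqI simp: cscale_op_apply)

lemma norm_cscale_op_le: "norm (cscale_op c T) \<le> cmod c * norm T"
  by (rule norm_blinfun_bound)
    (auto simp: cscale_op_apply norm_scaleC mult.assoc intro!: mult_left_mono norm_blinfun)

lemma tendsto_cscale_op:
  assumes "(S \<longlongrightarrow> T) F"
  shows "((\<lambda>n. cscale_op c (S n)) \<longlongrightarrow> cscale_op c T) F"
proof -
  have "((\<lambda>n. cscale_op c (S n) - cscale_op c T) \<longlongrightarrow> 0) F"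
    by (rule Lim_null_comparison[where g = "\<lambda>n. cmod c * norm (S n - T)"])
      (auto intro!: always_eventually tendsto_mult_right_zero tendsto_norm_zero LIM_zero assms
        simp: norm_cscale_op_le simp flip: cscale_op_diff)
  then show ?thesis by (rule LIM_zero_cancel)
qed

text \<open>Complex linearity is a family of equations that are continuous in the operator. It keeps
  norm limits, formed in the type of real-linear operators, inside L(H).\<close>

lemma closed_bounded_ops: "closed (bounded_ops :: ('h::chilbert_space \<Rightarrow>\<^sub>L 'h) set)"
proof -
  have "closed {T :: 'h \<Rightarrow>\<^sub>L 'h. blinfun_apply T (c *\<^sub>C x) = cscale_op c T x}" for c :: complex and x :: 'h
    unfolding closed_sequential_limits
  proof safe
    fix S :: "nat \<Rightarrow> 'h \<Rightarrow>\<^sub>L 'h" and T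
    assume S: "\<forall>n. S n \<in> {T. blinfun_apply T (c *\<^sub>C x) = cscale_op c T x}" and lim: "S \<longlonglongrightarrow> T"
    have "(\<lambda>n. S n (c *\<^sub>C x)) \<longlonglongrightarrow> T (c *\<^sub>C x)" "(\<lambda>n. cscale_op c (S n) x) \<longlonglongrightarrow> cscale_op c T x"
      by (intro blinfun.tendsto tendsto_const lim tendsto_cscale_op)+
    then show "blinfun_apply T (c *\<^sub>C x) = cscale_op c T x"
      using S LIMSEQ_unique by auto
  qed
  then have "closed (\<Inter>c. \<Inter>x. {T :: 'h \<Rightarrow>\<^sub>L 'h. blinfun_apply T (c *\<^sub>C x) = cscale_op c T x})"
    by blast
  moreover have "(\<Inter>c. \<Inter>x. {T :: 'h \<Rightarrow>\<^sub>L 'h. blinfun_apply T (c *\<^sub>C x) = cscale_op c T x}) = bounded_ops"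
    by (auto simp: bounded_ops_def cscale_op_apply)
  ultimately show ?thesis by simp
qed

lemma tendsto_adj:
  assumes "\<And>n. S n \<in> bounded_ops" and "T \<in> bounded_ops" and "(S \<longlongrightarrow> T) F"
  shows "((\<lambda>n. adj (S n)) \<longlongrightarrow> adj T) F"
proof -
  have "((\<lambda>n. adj (S n) - adj T) \<longlongrightarrow> 0) F"
    by (rule Lim_null_comparison[where g = "\<lambda>n. norm (S n - T)"])
      (auto intro!: always_eventually tendsto_norm_zero LIM_zero assms norm_adj_le bounded_ops_diff
        simp: assms simp flip: adj_diff)
  then show ?thesis by (rule LIM_zero_cancel)
qed

lemma norm_sq_eq_cinner_adj:
  fixes T :: "'h::chilbert_space \<Rightarrow>\<^sub>L 'h"
  shows
  "T \<in> bounded_ops \<Longrightarrow> (norm (T x))\<^sup>2 = Re (cinner ((adj T o\<^sub>L T) x) x)"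
  by (simp add: cinner_adj_left Re_cinner_self)

text \<open>Polarisation reduces \<open>U\<^sup>*U = P\<close> to \<open>\<parallel>U x\<parallel> = \<parallel>P x\<parallel>\<close>.\<close>

lemma partial_isometry_adj_compose:
  fixes U P :: "'h::chilbert_space \<Rightarrow>\<^sub>L 'h"
  assumes U: "partial_isometry U"
    and P: "P \<in> bounded_ops" "adj P = P" "P o\<^sub>L P = P"
    and range: "initial_space U = range P"
  shows "adj U o\<^sub>L U = P" and "U o\<^sub>L P = U"
proof -
  have Ub: "U \<in> bounded_ops"
    using U by (simp add: partial_isometry_def)
  have PP: "P (P x) = P x" for x
    using P(3) by (metis blinfun_apply_blinfun_compose)
  \<comment> \<open>U*U y is orthogonal to the kernel of U, hence fixed by P, so |U y|^2 = <U*U y,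
    y> sees only P y.\<close>
  have U0: "U y = 0" if "P y = 0" for y
  proof -
    have "adj U (U y) \<in> initial_space U"
      unfolding initial_space_def by (auto simp: cinner_adj_left[OF Ub])
    then have "P (adj U (U y)) = adj U (U y)"
      using range PP by auto
    then have "cinner (adj U (U y)) y = cinner (adj U (U y)) (P y)"
      by (metis P(1,2) cinner_adj_right)
    then show ?thesis
      using that by (simp add: cinner_adj_left[OF Ub] cinner_self)
  qed
  have UP: "U x = U (P x)" for x
    using U0[of "x - P x"] by (simp add: blinfun.diff_right PP)
  have norm: "norm (U x) = norm (P x)" for x
    using U range UP[of x] by (simp add: partial_isometry_def)
  \<comment> \<open>D is self-adjoint and Re <D x, x> = 0 for every x; expanded at x + D x, this
    form equals 2 |D x|^2.\<close>
  define D where "D = (adj U o\<^sub>L U) - P"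
  have Db: "D \<in> bounded_ops"
    unfolding D_def by (intro bounded_ops_diff bounded_ops_compose adj_bounded_ops Ub P)
  have Dsa: "adj D = D"
    unfolding D_def by (simp add: adj_diff adj_compose adj_adj adj_bounded_ops bounded_ops_compose Ub P)
  have D0: "Re (cinner (D x) x) = 0" for x
  proof -
    have "cinner (P x) x = cinner (P x) (P x)"
      by (metis P(1,2) PP cinner_adj_right)
    then show ?thesis
      using norm[of x]
      by (simp add: D_def blinfun.diff_left cinner_diff_left cinner_adj_left[OF Ub] Re_cinner_self)
  qed
  have "D x = 0" for x
  proof -
    have "Re (cinner (D (x + D x)) (x + D x)) = Re (cinner (D x) (D x)) + Re (cinner (D (D x)) x)"
      using D0[of x] D0[of "D x"] by (simp add: blinfun.add_right cinner_add_left cinner_add_right)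
    also have "cinner (D (D x)) x = cinner (D x) (D x)"
      by (metis Db Dsa cinner_adj_right)
    finally show ?thesis
      using D0[of "x + D x"] by (simp add: Re_cinner_self)
  qed
  then have "D = 0"
    by (intro blinfun_eqI) simp
  then show "adj U o\<^sub>L U = P"
    by (simp add: D_def)
  show "U o\<^sub>L P = U"
    by (rule blinfun_eqI) (simp flip: UP)
qed

subsection \<open>Continuous functions on compact spaces\<close>

lemma compact_space_pointwise_cover:
  assumes "compact_space Y"
    and "\<And>y. y \<in> topspace Y \<Longrightarrow> openin Y (W y)"
    and "\<And>y. y \<in> topspace Y \<Longrightarrow> y \<in> W y"
  obtains F where "finite F" "F \<subseteq> topspace Y" "topspace Y \<subseteq> (\<Union>y\<in>F. W y)"
proof -
  have "\<forall>V\<in>W ` topspace Y. openin Y V" "topspace Y \<subseteq> \<Union>(W ` topspace Y)"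
    using assms(2,3) by auto
  then obtain \<F> where \<F>: "finite \<F>" "\<F> \<subseteq> W ` topspace Y" "topspace Y \<subseteq> \<Union>\<F>"
    using assms(1)[unfolded compact_space_alt, rule_format, of "W ` topspace Y"] by auto
  obtain F where "F \<subseteq> topspace Y" "finite F" "\<F> = W ` F"
    using finite_subset_image[OF \<F>(1,2)] by auto
  then show thesis
    using that \<F>(3) by simp
qed

text \<open>For fixed x, compactness gives a finite maximum of interpolants that exceeds f - e
  everywhere and still equals f at x. A finite minimum of such functions for varying x then stays
  between f - e and f + e.\<close>

lemma stone_weierstrass_lattice:
  fixes Y :: "'b topology" and A :: "('b \<Rightarrow> real) set"
  assumes compact: "compact_space Y"
    and cont: "\<And>g. g \<in> A \<Longrightarrow> continuous_map Y euclideanreal g"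
    and max: "\<And>g h. g \<in> A \<Longrightarrow> h \<in> A \<Longrightarrow> (\<lambda>x. max (g x) (h x)) \<in> A"
    and min: "\<And>g h. g \<in> A \<Longrightarrow> h \<in> A \<Longrightarrow> (\<lambda>x. min (g x) (h x)) \<in> A"
    and f: "continuous_map Y euclideanreal f"
    and interp: "\<And>x y. x \<in> topspace Y \<Longrightarrow> y \<in> topspace Y \<Longrightarrow> \<exists>g\<in>A. g x = f x \<and> g y = f y"
    and "A \<noteq> {}" and e: "e > 0"
  shows "\<exists>g\<in>A. \<forall>x\<in>topspace Y. \<bar>g x - f x\<bar> < e"
proof -
  have open_gt: "openin Y {z \<in> topspace Y. f z - e < g z}"
    and open_lt: "openin Y {z \<in> topspace Y. g z < f z + e}" if "g \<in> A" for g
  proof -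
    have diff: "continuous_map Y euclideanreal (\<lambda>z. g z - f z)"
      by (intro continuous_map_diff cont that f)
    have pre: "openin Y {z \<in> topspace Y. g z - f z \<in> S}" if "open S" for S
      by (rule openin_continuous_map_preimage[OF diff]) (use that open_openin in blast)
    show "openin Y {z \<in> topspace Y. f z - e < g z}" "openin Y {z \<in> topspace Y. g z < f z + e}"
      using pre[of "{-e<..}"] pre[of "{..<e}"] by (simp_all add: algebra_simps)
  qed
  \<comment> \<open>That each value of the maximum is a value of some \<open>G y\<close> preserves
    the common value at x; for the minimum below it preserves the common lower bound.\<close>
  have fin_max: "\<exists>h\<in>A. (\<forall>y\<in>F. \<forall>z. G y z \<le> h z) \<and> (\<forall>z. \<exists>y\<in>F. h z = G y z)"
    if "finite F" "F \<noteq> {}" "\<forall>y\<in>F. G y \<in> A" for F and G :: "'b \<Rightarrow> 'b \<Rightarrow> real"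
    using that
  proof (induction F rule: finite_ne_induct)
    case (insert y F)
    then obtain h where h: "h \<in> A" "\<forall>y\<in>F. \<forall>z. G y z \<le> h z" "\<forall>z. \<exists>y\<in>F. h z = G y z"
      by auto
    have "(\<lambda>z. max (G y z) (h z)) \<in> A"
      using max insert.prems h(1) by blast
    moreover have "\<forall>y'\<in>insert y F. \<forall>z. G y' z \<le> max (G y z) (h z)"
      using h(2) by (auto simp: le_max_iff_disj)
    moreover have "\<exists>y'\<in>insert y F. max (G y z) (h z) = G y' z" for z
      using h(3)[rule_format, of z] by (cases "G y z \<le> h z") (auto simp: max_def)
    ultimately show ?case
      by (intro bexI[where x = "\<lambda>z. max (G y z) (h z)"] conjI allI)
  qed auto
  have fin_min: "\<exists>h\<in>A. (\<forall>y\<in>F. \<forall>z. h z \<le> G y z) \<and> (\<forall>z. \<exists>y\<in>F. h z = G y z)"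
    if "finite F" "F \<noteq> {}" "\<forall>y\<in>F. G y \<in> A" for F and G :: "'b \<Rightarrow> 'b \<Rightarrow> real"
    using that
  proof (induction F rule: finite_ne_induct)
    case (insert y F)
    then obtain h where h: "h \<in> A" "\<forall>y\<in>F. \<forall>z. h z \<le> G y z" "\<forall>z. \<exists>y\<in>F. h z = G y z"
      by auto
    have "(\<lambda>z. min (G y z) (h z)) \<in> A"
      using min insert.prems h(1) by blast
    moreover have "\<forall>y'\<in>insert y F. \<forall>z. min (G y z) (h z) \<le> G y' z"
      using h(2) by (auto simp: min_le_iff_disj)
    moreover have "\<exists>y'\<in>insert y F. min (G y z) (h z) = G y' z" for z
      using h(3)[rule_format, of z] by (cases "G y z \<le> h z") (auto simp: min_def)
    ultimately show ?case
      by (intro bexI[where x = "\<lambda>z. min (G y z) (h z)"] conjI allI)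
  qed auto
  have lower: "\<exists>h\<in>A. h x = f x \<and> (\<forall>z\<in>topspace Y. f z - e < h z)" if x: "x \<in> topspace Y" for x
  proof -
    obtain G where G: "\<And>y. y \<in> topspace Y \<Longrightarrow> G y \<in> A \<and> G y x = f x \<and> G y y = f y"
      using interp[OF x] by metis
    obtain F where F: "finite F" "F \<subseteq> topspace Y"
      "topspace Y \<subseteq> (\<Union>y\<in>F. {z \<in> topspace Y. f z - e < G y z})"
      using compact_space_pointwise_cover[OF compact, of "\<lambda>y. {z \<in> topspace Y. f z - e < G y z}"]
        open_gt G e by auto
    obtain h where h: "h \<in> A" "\<forall>y\<in>F. \<forall>z. G y z \<le> h z" "\<forall>z. \<exists>y\<in>F. h z = G y z"
      using fin_max[of F G] F x G by blast
    have "f z - e < h z" if z: "z \<in> topspace Y" for z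
    proof -
      obtain y where "y \<in> F" "f z - e < G y z"
        using F(3) z by auto
      then show ?thesis
        using h(2) by (meson less_le_trans)
    qed
    moreover have "h x = f x"
      using h(3) G F(2) by (metis subsetD)
    ultimately show ?thesis
      using h(1) by blast
  qed
  show ?thesis
  proof (cases "topspace Y = {}")
    case True
    then show ?thesis using \<open>A \<noteq> {}\<close> by auto
  next
    case False
    obtain H where H: "\<And>x. x \<in> topspace Y \<Longrightarrow> H x \<in> A \<and> H x x = f x \<and> (\<forall>z\<in>topspace Y. f z - e < H x z)"
      using lower by metis
    obtain F where F: "finite F" "F \<subseteq> topspace Y"
      "topspace Y \<subseteq> (\<Union>y\<in>F. {z \<in> topspace Y. H y z < f z + e})"
      using compact_space_pointwise_cover[OF compact, of "\<lambda>y. {z \<in> topspace Y. H y z < f z + e}"]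
        open_lt H e by auto
    obtain h where h: "h \<in> A" "\<forall>y\<in>F. \<forall>z. h z \<le> H y z" "\<forall>z. \<exists>y\<in>F. h z = H y z"
      using fin_min[of F H] F False H by blast
    have "\<bar>h z - f z\<bar> < e" if z: "z \<in> topspace Y" for z
    proof -
      obtain y where "y \<in> F" "H y z < f z + e"
        using F(3) z by auto
      then have "h z < f z + e"
        using h(2) by (meson le_less_trans)
      moreover obtain y' where "y' \<in> F" "h z = H y' z"
        using h(3) by blast
      then have "f z - e < h z"
        using H F(2) z by auto
      ultimately show ?thesis by linarith
    qed
    then show ?thesis using h(1) by blast
  qed
qed

section \<open>The algebra C(Y)\<close>

lemma cfunI:
  "continuous_map Y euclidean f \<Longrightarrow> (\<And>x. x \<notin> topspace Y \<Longrightarrow> f x = 0) \<Longrightarrow> f \<in> cfun Y"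
  by (simp add: cfun_def)

lemma
  assumes "f \<in> cfun Y"
  shows cfun_continuous_map: "continuous_map Y euclidean f"
    and cfun_eq_0: "x \<notin> topspace Y \<Longrightarrow> f x = 0"
  using assms by (auto simp: cfun_def)

lemma continuous_map_compose_euclidean:
  fixes f :: "'b \<Rightarrow> 'c::topological_space" and g :: "'c \<Rightarrow> 'd::topological_space"
  assumes "continuous_map Y euclidean f" and "continuous_on UNIV g"
  shows "continuous_map Y euclidean (\<lambda>x. g (f x))"
  using continuous_map_compose[OF assms(1), of euclidean g] assms(2) by (simp add: o_def)

lemma cfun_compose:
  assumes "f \<in> cfun Y" and "continuous_on UNIV \<phi>" and "\<phi> 0 = 0"
  shows "(\<lambda>x. \<phi> (f x)) \<in> cfun Y"
  using assms(3) continuous_map_compose_euclidean[OF cfun_continuous_map[OF assms(1)] assms(2)]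
  by (intro cfunI) (simp_all add: cfun_eq_0[OF assms(1)])

lemma cfun_add: "f \<in> cfun Y \<Longrightarrow> g \<in> cfun Y \<Longrightarrow> (\<lambda>x. f x + g x) \<in> cfun Y"
  by (auto simp: cfun_def intro: continuous_map_add)

lemma continuous_map_mult_complex:
  fixes f g :: "'b \<Rightarrow> complex"
  assumes "continuous_map Y euclidean f" and "continuous_map Y euclidean g"
  shows "continuous_map Y euclidean (\<lambda>x. f x * g x)"
  using assms by (simp add: continuous_map_atin tendsto_mult)

lemma cfun_mult: "f \<in> cfun Y \<Longrightarrow> g \<in> cfun Y \<Longrightarrow> (\<lambda>x. f x * g x) \<in> cfun Y"
  by (auto simp: cfun_def intro: continuous_map_mult_complex)

lemma cfun_scale: "f \<in> cfun Y \<Longrightarrow> (\<lambda>x. c * f x) \<in> cfun Y"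
  by (rule cfun_compose[where \<phi> = "\<lambda>z. c * z"]) (auto intro: continuous_intros)

lemma cfun_cnj: "f \<in> cfun Y \<Longrightarrow> (\<lambda>x. cnj (f x)) \<in> cfun Y"
  by (rule cfun_compose[where \<phi> = cnj]) (auto intro: continuous_intros)

lemma cfun_zero: "(\<lambda>_. 0) \<in> cfun Y"
  by (simp add: cfun_def)

lemma cfun_uniform_limit:
  assumes F: "\<And>n. F n \<in> cfun Y" and lim: "uniform_limit UNIV F f sequentially"
  shows "f \<in> cfun Y"
proof (rule cfunI)
  have "continuous_map Y Met_TC.mtopology f"
  proof (rule Met_TC.continuous_map_uniform_limit[where F = sequentially and f = F])
    show "\<forall>\<^sub>F n in sequentially. continuous_map Y Met_TC.mtopology (F n)"
      using F by (simp add: cfun_def)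
    fix e :: real assume "e > 0"
    show "\<forall>\<^sub>F n in sequentially. \<forall>x\<in>topspace Y. f x \<in> UNIV \<and> dist (F n x) (f x) < e"
      using uniform_limitD[OF lim \<open>e > 0\<close>] by (rule eventually_mono) simp
  qed simp
  then show "continuous_map Y euclidean f" by simp
next
  fix x assume "x \<notin> topspace Y"
  then have "(\<lambda>n. F n x) = (\<lambda>_. 0)"
    using F by (auto simp: cfun_def)
  then show "f x = 0"
    using tendsto_uniform_limitI[OF lim, of x] by (simp add: LIMSEQ_const_iff)
qed

subsection \<open>Extension of a faithful representation of a dense subalgebra\<close>

text \<open>\<open>R\<close> is the graph of an injective \<open>*\<close>-homomorphism on a subalgebra. A relation is used because
  a function may have several descriptions as a bracket: that the operator does not depend on the
  description is the assumption \<open>graph_unique\<close>.\<close>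

locale star_hom_graph =
  fixes Y :: "'b topology"
    and R :: "('b \<Rightarrow> complex) \<Rightarrow> ('h::chilbert_space \<Rightarrow>\<^sub>L 'h) \<Rightarrow> bool"
  assumes compact: "compact_space Y"
    and graph_cfun: "R f T \<Longrightarrow> f \<in> cfun Y"
    and graph_ops: "R f T \<Longrightarrow> T \<in> bounded_ops"
    and graph_one: "\<exists>P. R (\<lambda>x. if x \<in> topspace Y then 1 else 0) P"
    and graph_add: "R f S \<Longrightarrow> R g T \<Longrightarrow> R (\<lambda>x. f x + g x) (S + T)"
    and graph_mult: "R f S \<Longrightarrow> R g T \<Longrightarrow> R (\<lambda>x. f x * g x) (S o\<^sub>L T)"
    and graph_scale: "R f T \<Longrightarrow> R (\<lambda>x. c * f x) (cscale_op c T)"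
    and graph_cnj: "R f T \<Longrightarrow> R (\<lambda>x. cnj (f x)) (adj T)"
    and graph_calculus: "R f T \<Longrightarrow> continuous_on UNIV \<phi> \<Longrightarrow> \<phi> 0 = 0 \<Longrightarrow> \<exists>S. R (\<lambda>x. \<phi> (f x)) S"
    and graph_unique: "R f S \<Longrightarrow> R f T \<Longrightarrow> S = T"
    and graph_faithful: "R f 0 \<Longrightarrow> f x = 0"
    and graph_separating: "x \<in> topspace Y \<Longrightarrow> y \<in> topspace Y \<Longrightarrow> x \<noteq> y \<Longrightarrow> \<exists>f T. R f T \<and> f x \<noteq> f y"
begin

section \<open>Isometry and density for the graph\<close>

lemma graph_diff:
  assumes "R f S" and "R g T"
  shows "R (\<lambda>x. f x - g x) (S - T)"
proof -
  have "cscale_op (-1) T x = - T x" for x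
    using scaleR_scaleC[of "-1" "T x"] by (simp add: cscale_op_apply)
  then have "cscale_op (-1) T = - T"
    by (intro blinfun_eqI) (simp add: blinfun.minus_left)
  then show ?thesis
    using graph_add[OF assms(1) graph_scale[OF assms(2), of "-1"]] by simp
qed

lemma graph_zero: "R (\<lambda>_. 0) 0"
  using graph_one graph_diff by fastforce

text \<open>If \<open>\<parallel>T\<parallel> = r\<close>, then \<open>\<bar>\<psi> f\<bar>\<^sup>2 = \<bar>f \<cdot> \<phi> f\<bar>\<^sup>2 - r\<^sup>2 \<bar>\<phi> f\<bar>\<^sup>2\<close> shows that \<open>\<psi> f\<close> is represented by \<open>0\<close>; but
  \<open>\<psi> f\<close> is nonzero wherever \<open>\<bar>f\<bar> > r\<close>.\<close>

lemma graph_norm_ge: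
  assumes f: "R f T"
  shows "cmod (f x) \<le> norm T"
proof (rule ccontr)
  assume *: "\<not> cmod (f x) \<le> norm T"
  define r where "r = norm T"
  define \<phi> where "\<phi> z = complex_of_real (max 0 (cmod z - r))" for z
  define \<psi> where "\<psi> z = complex_of_real (sqrt (max 0 ((cmod z)\<^sup>2 - r\<^sup>2)) * max 0 (cmod z - r))" for z
  have r: "r \<ge> 0" by (simp add: r_def)
  have "continuous_on UNIV \<phi>" "continuous_on UNIV \<psi>"
    unfolding \<phi>_def \<psi>_def by (intro continuous_intros)+
  moreover have "\<phi> 0 = 0" "\<psi> 0 = 0"
    using r by (simp_all add: \<phi>_def \<psi>_def)
  ultimately obtain G H where G: "R (\<lambda>x. \<phi> (f x)) G" and H: "R (\<lambda>x. \<psi> (f x)) H"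
    using graph_calculus[OF f] by meson
  have TG: "R (\<lambda>x. f x * \<phi> (f x)) (T o\<^sub>L G)"
    by (rule graph_mult[OF f G])
  have "cnj (\<psi> z) * \<psi> z = cnj (z * \<phi> z) * (z * \<phi> z) - complex_of_real (r\<^sup>2) * (cnj (\<phi> z) * \<phi> z)" for z
  proof (cases "cmod z \<le> r")
    case False
    have "r\<^sup>2 \<le> (cmod z)\<^sup>2"
      using False r by (intro power_mono) auto
    then have "cnj (\<psi> z) * \<psi> z = complex_of_real ((cmod z)\<^sup>2 - r\<^sup>2) * (\<phi> z)\<^sup>2"
      using False unfolding \<psi>_def \<phi>_def
      by (simp add: power2_eq_square max_def flip: of_real_mult of_real_diff)
    also have "\<dots> = z * cnj z * (\<phi> z)\<^sup>2 - complex_of_real (r\<^sup>2) * (\<phi> z)\<^sup>2"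
      by (simp add: left_diff_distrib flip: complex_norm_square)
    also have "\<dots> = cnj (z * \<phi> z) * (z * \<phi> z) - complex_of_real (r\<^sup>2) * (cnj (\<phi> z) * \<phi> z)"
      by (simp add: \<phi>_def power2_eq_square mult_ac)
    finally show ?thesis .
  qed (simp add: \<phi>_def \<psi>_def)
  \<comment> \<open>Equal functions have equal operators, so the pointwise identity passes to
    operators. In the resulting formula for |H y|^2 the right side is at most 0, because r is the
    norm of T, whence H = 0.\<close>
  then have "adj H o\<^sub>L H = (adj (T o\<^sub>L G) o\<^sub>L (T o\<^sub>L G)) - cscale_op (complex_of_real (r\<^sup>2)) (adj G o\<^sub>L G)"
    using graph_mult[OF graph_cnj[OF H] H]
      graph_diff[OF graph_mult[OF graph_cnj[OF TG] TG]
        graph_scale[OF graph_mult[OF graph_cnj[OF G] G], of "complex_of_real (r\<^sup>2)"]]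
    by (intro graph_unique) simp_all
  then have "(norm (H y))\<^sup>2 = (norm (T (G y)))\<^sup>2 - r\<^sup>2 * (norm (G y))\<^sup>2" for y
    using norm_sq_eq_cinner_adj[OF graph_ops[OF H], of y]
      norm_sq_eq_cinner_adj[OF graph_ops[OF TG], of y] norm_sq_eq_cinner_adj[OF graph_ops[OF G], of y]
    by (simp add: blinfun.diff_left cinner_diff_left cscale_op_apply cinner_scaleC_left)
  moreover have "(norm (T (G y)))\<^sup>2 \<le> r\<^sup>2 * (norm (G y))\<^sup>2" for y
    using power_mono[OF norm_blinfun[of T "G y"], of 2] by (simp add: r_def power_mult_distrib)
  ultimately have "(norm (H y))\<^sup>2 \<le> 0" for y
    by simp
  then have "H = 0"
    by (intro blinfun_eqI) simp
  then have "\<psi> (f x) = 0"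
    using graph_faithful[of "\<lambda>x. \<psi> (f x)" x] H by simp
  moreover have "r\<^sup>2 < (cmod (f x))\<^sup>2"
    using * r by (simp add: r_def power_strict_mono)
  ultimately show False
    using * by (simp add: \<psi>_def r_def max_def split: if_splits)
qed

text \<open>The function \<open>h\<close> below satisfies \<open>\<bar>h\<bar>\<^sup>2 = r\<^sup>2 - \<bar>f\<bar>\<^sup>2\<close>.\<close>

lemma graph_norm_le:
  assumes f: "R f T" and bound: "\<And>x. cmod (f x) \<le> r"
  shows "norm T \<le> r"
proof -
  have r: "0 \<le> r"
    using bound[of undefined] norm_ge_zero order_trans by blast
  obtain P where P: "R (\<lambda>x. if x \<in> topspace Y then 1 else 0) P"
    using graph_one by blast
  \<comment> \<open>The unit may go to a proper projection P; P* P = P is what makes P a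
    contraction.\<close>
  have PP: "adj P o\<^sub>L P = P"
  proof (rule graph_unique[OF _ P])
    have "(\<lambda>x. cnj (if x \<in> topspace Y then 1 else 0) * (if x \<in> topspace Y then 1 else 0))
      = (\<lambda>x. if x \<in> topspace Y then 1 else 0)"
      by auto
    then show "R (\<lambda>x. if x \<in> topspace Y then 1 else 0) (adj P o\<^sub>L P)"
      using graph_mult[OF graph_cnj[OF P] P] by (simp only:)
  qed
  have P_le: "(norm (P x))\<^sup>2 \<le> (norm x)\<^sup>2" for x
  proof -
    have "norm (P x) * norm (P x) \<le> norm (P x) * norm x"
      using norm_sq_eq_cinner_adj[OF graph_ops[OF P], of x] Re_cinner_le[of "P x" x]
      by (simp add: PP power2_eq_square)
    then have "norm (P x) \<le> norm x"
      by (metis mult_le_cancel_left_pos norm_ge_zero order_le_less)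
    then show ?thesis by (simp add: power_mono)
  qed
  \<comment> \<open>The square root of r^2 - |z|^2 has the value r at 0. Subtracting r makes it
    admissible for \<open>graph_calculus\<close>, and \<open>h\<close> adds r times the unit
    back.\<close>
  define \<phi> where "\<phi> z = complex_of_real (sqrt (max 0 (r\<^sup>2 - (cmod z)\<^sup>2)) - r)" for z
  have "continuous_on UNIV \<phi>"
    unfolding \<phi>_def by (intro continuous_intros)
  moreover have "\<phi> 0 = 0"
    using r by (simp add: \<phi>_def)
  ultimately obtain G where G: "R (\<lambda>x. \<phi> (f x)) G"
    using graph_calculus[OF f] by meson
  define H where "H = G + cscale_op (complex_of_real r) P"
  define h where "h x = \<phi> (f x) + complex_of_real r * (if x \<in> topspace Y then 1 else 0)" for x
  have H: "R h H"
    unfolding h_def H_def by (rule graph_add[OF G graph_scale[OF P]])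
  have "cnj (h x) * h x = complex_of_real (r\<^sup>2) * (if x \<in> topspace Y then 1 else 0) - cnj (f x) * f x" for x
  proof (cases "x \<in> topspace Y")
    case True
    have "h x = complex_of_real (sqrt (r\<^sup>2 - (cmod (f x))\<^sup>2))"
      using True power_mono[OF bound, of x 2] by (simp add: h_def \<phi>_def)
    then have "cnj (h x) * h x = complex_of_real (r\<^sup>2 - (cmod (f x))\<^sup>2)"
      using power_mono[OF bound, of x 2] by (simp flip: of_real_mult)
    then show ?thesis
      using True by (simp only: of_real_diff complex_norm_square) (simp add: mult.commute)
  next
    case False
    then show ?thesis
      using cfun_eq_0[OF graph_cfun[OF f]] r by (simp add: h_def \<phi>_def)
  qed
  then have "adj H o\<^sub>L H = cscale_op (complex_of_real (r\<^sup>2)) P - (adj T o\<^sub>L T)"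
    using graph_mult[OF graph_cnj[OF H] H]
      graph_diff[OF graph_scale[OF P, of "complex_of_real (r\<^sup>2)"] graph_mult[OF graph_cnj[OF f] f]]
    by (intro graph_unique) simp_all
  then have "(norm (H x))\<^sup>2 = r\<^sup>2 * (norm (P x))\<^sup>2 - (norm (T x))\<^sup>2" for x
    using norm_sq_eq_cinner_adj[OF graph_ops[OF H], of x]
      norm_sq_eq_cinner_adj[OF graph_ops[OF P], of x] norm_sq_eq_cinner_adj[OF graph_ops[OF f], of x]
    by (simp add: blinfun.diff_left cinner_diff_left cscale_op_apply cinner_scaleC_left PP)
  then have "(norm (T x))\<^sup>2 \<le> (r * norm x)\<^sup>2" for x
    using mult_left_mono[OF P_le[of x], of "r\<^sup>2"] zero_le_power2[of "norm (H x)"]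
    by (simp add: power_mult_distrib)
  then have "norm (T x) \<le> r * norm x" for x
    using r by (meson mult_nonneg_nonneg norm_ge_zero power2_le_imp_le)
  then show ?thesis
    using r by (intro norm_blinfun_bound)
qed

text \<open>The modulus is continuous and vanishes at 0, so \<open>graph_calculus\<close> makes the
  real functions of the graph a vector lattice at once, without approximating the absolute value by
  polynomials.\<close>

lemma graph_dense_real:
  fixes f :: "'b \<Rightarrow> real"
  assumes f: "continuous_map Y euclideanreal f" and e: "e > 0"
  shows "\<exists>g T. R (\<lambda>x. complex_of_real (g x)) T \<and> (\<forall>x\<in>topspace Y. \<bar>g x - f x\<bar> < e)"
proof -
  define A where "A = {g. \<exists>T. R (\<lambda>x. complex_of_real (g x)) T}"
  have A_add: "(\<lambda>x. g x + h x) \<in> A" if "g \<in> A" "h \<in> A" for g h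
    using that unfolding A_def by (auto dest: graph_add)
  have A_scale: "(\<lambda>x. c * g x) \<in> A" if "g \<in> A" for c g
    using that unfolding A_def by (auto dest: graph_scale[of _ _ "complex_of_real c"])
  have A_diff: "(\<lambda>x. g x - h x) \<in> A" if "g \<in> A" "h \<in> A" for g h
    using A_add[OF that(1) A_scale[OF that(2), of "-1"]] by simp
  have A_norm: "(\<lambda>x. cmod (g x)) \<in> A" if "R g T" for g T
    unfolding A_def
    using graph_calculus[OF that, of "\<lambda>z. complex_of_real (cmod z)"]
    by (auto intro: continuous_intros)
  have A_abs: "(\<lambda>x. \<bar>g x\<bar>) \<in> A" if "g \<in> A" for g
    using that A_norm[of "\<lambda>x. complex_of_real (g x)"] by (auto simp: A_def)
  have "\<exists>g\<in>A. \<forall>x\<in>topspace Y. \<bar>g x - f x\<bar> < e"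
  proof (rule stone_weierstrass_lattice[OF compact _ _ _ f])
    fix g assume "g \<in> A"
    then obtain T where "R (\<lambda>x. complex_of_real (g x)) T"
      by (auto simp: A_def)
    then have "continuous_map Y euclideanreal (\<lambda>x. Re (complex_of_real (g x)))"
      by (intro continuous_map_compose_euclidean[OF cfun_continuous_map[OF graph_cfun]])
        (auto intro: continuous_intros)
    then show "continuous_map Y euclideanreal g" by simp
  next
    fix g h assume gh: "g \<in> A" "h \<in> A"
    have "(\<lambda>x. max (g x) (h x)) = (\<lambda>x. 1/2 * ((g x + h x) + \<bar>g x - h x\<bar>))"
      "(\<lambda>x. min (g x) (h x)) = (\<lambda>x. 1/2 * ((g x + h x) - \<bar>g x - h x\<bar>))"
      by (auto simp: max_def min_def)
    then show "(\<lambda>x. max (g x) (h x)) \<in> A" "(\<lambda>x. min (g x) (h x)) \<in> A"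
      using A_scale[OF A_add[OF A_add[OF gh] A_abs[OF A_diff[OF gh]]], of "1/2"]
        A_scale[OF A_diff[OF A_add[OF gh] A_abs[OF A_diff[OF gh]]], of "1/2"] by (simp_all only:)
  next
    fix x y assume xy: "x \<in> topspace Y" "y \<in> topspace Y"
    obtain P where P: "R (\<lambda>x. if x \<in> topspace Y then 1 else 0) P"
      using graph_one by blast
    have one: "(\<lambda>x. cmod (if x \<in> topspace Y then 1 else 0)) \<in> A"
      by (rule A_norm[OF P])
    show "\<exists>g\<in>A. g x = f x \<and> g y = f y"
    proof (cases "x = y")
      case True
      then show ?thesis
        using A_scale[OF one, of "f x"] xy by (intro bexI) auto
    next
      case False
      then obtain k T where k: "R k T" "k x \<noteq> k y"
        using graph_separating xy by blast
      \<comment> \<open>A real function of the graph that vanishes at x but not at y; together with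
        the unit it interpolates any two values. The constant \<open>k x\<close> is multiplied by
        the unit because functions of the graph vanish off the space.\<close>
      define u where "u z = cmod (k z - k x * (if z \<in> topspace Y then 1 else 0))" for z
      have u: "u \<in> A"
        unfolding u_def by (rule A_norm[OF graph_diff[OF k(1) graph_scale[OF P]]])
      have "u x = 0" "u y \<noteq> 0"
        using xy k(2) by (auto simp: u_def)
      then show ?thesis
        using A_add[OF A_scale[OF one, of "f x"] A_scale[OF u, of "(f y - f x) / u y"]] xy
        by (intro bexI) auto
    qed
  next
    have "(\<lambda>_. 0) \<in> A"
      unfolding A_def using graph_zero by auto
    then show "A \<noteq> {}" by blast
  qed (rule e)
  then show ?thesis
    by (auto simp: A_def)
qed

lemma graph_dense:
  assumes f: "f \<in> cfun Y" and e: "e > 0"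
  shows "\<exists>g T. R g T \<and> (\<forall>x. cmod (g x - f x) < e)"
proof -
  have "continuous_map Y euclideanreal (\<lambda>x. Re (f x))" "continuous_map Y euclideanreal (\<lambda>x. Im (f x))"
    by (intro continuous_map_compose_euclidean[OF cfun_continuous_map[OF f]] continuous_intros)+
  then obtain u S v T where u: "R (\<lambda>x. complex_of_real (u x)) S" "\<And>x. x \<in> topspace Y \<Longrightarrow> \<bar>u x - Re (f x)\<bar> < e/2"
    and v: "R (\<lambda>x. complex_of_real (v x)) T" "\<And>x. x \<in> topspace Y \<Longrightarrow> \<bar>v x - Im (f x)\<bar> < e/2"
    using graph_dense_real[of "\<lambda>x. Re (f x)" "e/2"] graph_dense_real[of "\<lambda>x. Im (f x)" "e/2"] e
    by auto
  define g where "g x = complex_of_real (u x) + \<i> * complex_of_real (v x)" for x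
  have g: "R g (S + cscale_op \<i> T)"
    unfolding g_def by (rule graph_add[OF u(1) graph_scale[OF v(1)]])
  have "cmod (g x - f x) < e" for x
  proof (cases "x \<in> topspace Y")
    case True
    have "cmod (g x - f x) \<le> \<bar>Re (g x - f x)\<bar> + \<bar>Im (g x - f x)\<bar>"
      by (rule cmod_le)
    then show ?thesis
      using u(2)[OF True] v(2)[OF True] by (simp add: g_def)
  next
    case False
    then show ?thesis
      using cfun_eq_0[OF f] cfun_eq_0[OF graph_cfun[OF g]] e by simp
  qed
  then show ?thesis
    using g by blast
qed

text \<open>The closure of the graph in the product of the uniform and the operator norm. It is kept
  as a relation until the two norm bounds show it single-valued and defined on all of
  \<open>cfun Y\<close>. Uniformity over the whole type is no loss, as functions of the graph vanish
  off the space.\<close>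

definition closure_graph :: "('b \<Rightarrow> complex) \<Rightarrow> ('h \<Rightarrow>\<^sub>L 'h) \<Rightarrow> bool" where
  "closure_graph f T \<longleftrightarrow>
    (\<exists>F S. (\<forall>n. R (F n) (S n)) \<and> uniform_limit UNIV F f sequentially \<and> S \<longlonglongrightarrow> T)"

lemma closure_graph_of_graph: "R f T \<Longrightarrow> closure_graph f T"
  unfolding closure_graph_def by (intro exI[of _ "\<lambda>_. f"] exI[of _ "\<lambda>_. T"]) (auto intro: uniform_limitI)

text \<open>Transports an operation that is continuous on functions and on operators; the two
  endomorphisms of the extension are handled by it as well. The approximating operators are known to
  lie in \<open>bounded_ops\<close>, where adjoints are controlled.\<close>

lemma closure_graph_map:
  assumes "closure_graph f T"
    and "\<And>g S. R g S \<Longrightarrow> R (\<Lambda> g) (\<Theta> S)"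
    and "\<And>F. uniform_limit UNIV F f sequentially \<Longrightarrow> uniform_limit UNIV (\<lambda>n. \<Lambda> (F n)) (\<Lambda> f) sequentially"
    and "\<And>S. S \<longlonglongrightarrow> T \<Longrightarrow> (\<And>n. S n \<in> bounded_ops) \<Longrightarrow> (\<lambda>n. \<Theta> (S n)) \<longlonglongrightarrow> \<Theta> T"
  shows "closure_graph (\<Lambda> f) (\<Theta> T)"
proof -
  obtain F S where "\<And>n. R (F n) (S n)" "uniform_limit UNIV F f sequentially" "S \<longlonglongrightarrow> T"
    using assms(1) unfolding closure_graph_def by blast
  then show ?thesis
    unfolding closure_graph_def using assms(2-4) graph_ops
    by (intro exI[of _ "\<lambda>n. \<Lambda> (F n)"] exI[of _ "\<lambda>n. \<Theta> (S n)"]) blast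
qed

lemma closure_graph_map2:
  assumes "closure_graph f T" and "closure_graph f' T'"
    and "\<And>g S g' S'. R g S \<Longrightarrow> R g' S' \<Longrightarrow> R (\<Lambda> g g') (\<Theta> S S')"
    and "\<And>F F'. uniform_limit UNIV F f sequentially \<Longrightarrow> uniform_limit UNIV F' f' sequentially \<Longrightarrow>
      uniform_limit UNIV (\<lambda>n. \<Lambda> (F n) (F' n)) (\<Lambda> f f') sequentially"
    and "\<And>S S'. S \<longlonglongrightarrow> T \<Longrightarrow> S' \<longlonglongrightarrow> T' \<Longrightarrow> (\<lambda>n. \<Theta> (S n) (S' n)) \<longlonglongrightarrow> \<Theta> T T'"
  shows "closure_graph (\<Lambda> f f') (\<Theta> T T')"
proof -
  obtain F S F' S' where "\<And>n. R (F n) (S n)" "uniform_limit UNIV F f sequentially" "S \<longlonglongrightarrow> T"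
    "\<And>n. R (F' n) (S' n)" "uniform_limit UNIV F' f' sequentially" "S' \<longlonglongrightarrow> T'"
    using assms(1,2) unfolding closure_graph_def by blast
  then show ?thesis
    unfolding closure_graph_def using assms(3-5)
    by (intro exI[of _ "\<lambda>n. \<Lambda> (F n) (F' n)"] exI[of _ "\<lambda>n. \<Theta> (S n) (S' n)"]) blast
qed

lemma closure_graph_cfun: "closure_graph f T \<Longrightarrow> f \<in> cfun Y"
  unfolding closure_graph_def using cfun_uniform_limit graph_cfun by blast

lemma closure_graph_ops: "closure_graph f T \<Longrightarrow> T \<in> bounded_ops"
  unfolding closure_graph_def
  using closed_bounded_ops graph_ops by (metis closed_sequentially)

lemma closure_graph_norm_ge:
  assumes "closure_graph f T"
  shows "cmod (f x) \<le> norm T"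
proof -
  obtain F S where F: "\<And>n. R (F n) (S n)" "uniform_limit UNIV F f sequentially" "S \<longlonglongrightarrow> T"
    using assms unfolding closure_graph_def by blast
  have "(\<lambda>n. F n x) \<longlonglongrightarrow> f x"
    using tendsto_uniform_limitI[OF F(2)] by simp
  then show ?thesis
    by (rule LIMSEQ_le[OF tendsto_norm tendsto_norm[OF F(3)]]) (use F(1) graph_norm_ge in blast)
qed

lemma closure_graph_add:
  assumes "closure_graph f S" and "closure_graph g T"
  shows "closure_graph (\<lambda>x. f x + g x) (S + T)"
  by (rule closure_graph_map2[OF assms, of "\<lambda>f g x. f x + g x"])
    (auto intro: graph_add uniform_limit_add tendsto_add)

lemma closure_graph_diff:
  assumes "closure_graph f S" and "closure_graph g T"
  shows "closure_graph (\<lambda>x. f x - g x) (S - T)"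
  by (rule closure_graph_map2[OF assms, of "\<lambda>f g x. f x - g x"])
    (auto intro: graph_diff uniform_limit_minus tendsto_diff)

lemma closure_graph_mult:
  assumes "closure_graph f S" and "closure_graph g T"
  shows "closure_graph (\<lambda>x. f x * g x) (S o\<^sub>L T)"
proof (rule closure_graph_map2[OF assms, of "\<lambda>f g x. f x * g x"])
  \<comment> \<open>Uniform limits can be multiplied when the limit functions are bounded; the
    operator norms bound them.\<close>
  have "bounded (range f)" "bounded (range g)"
    using closure_graph_norm_ge[OF assms(1)] closure_graph_norm_ge[OF assms(2)]
    by (auto simp: bounded_iff)
  then show "uniform_limit UNIV (\<lambda>n x. F n x * G n x) (\<lambda>x. f x * g x) sequentially"
    if "uniform_limit UNIV F f sequentially" "uniform_limit UNIV G g sequentially" for F G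
    using that by (intro uniform_lim_mult)
qed (auto intro: graph_mult tendsto_intros)

lemma closure_graph_scale:
  assumes "closure_graph f T"
  shows "closure_graph (\<lambda>x. c * f x) (cscale_op c T)"
  by (rule closure_graph_map[OF assms, of "\<lambda>f x. c * f x"])
    (auto intro: graph_scale tendsto_cscale_op bounded_linear.uniform_limit[OF bounded_linear_mult_right])

lemma closure_graph_cnj:
  assumes "closure_graph f T"
  shows "closure_graph (\<lambda>x. cnj (f x)) (adj T)"
  by (rule closure_graph_map[OF assms, of "\<lambda>f x. cnj (f x)"])
    (auto intro: graph_cnj tendsto_adj closure_graph_ops[OF assms]
      bounded_linear.uniform_limit[OF bounded_linear_cnj])

lemma closure_graph_zero:
  assumes "closure_graph (\<lambda>_. 0) T"
  shows "T = 0"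
proof -
  obtain F S where F: "\<And>n. R (F n) (S n)" "uniform_limit UNIV F (\<lambda>_. 0) sequentially" "S \<longlonglongrightarrow> T"
    using assms unfolding closure_graph_def by blast
  have "S \<longlonglongrightarrow> 0"
  proof (rule tendstoI)
    fix e :: real assume e: "e > 0"
    show "\<forall>\<^sub>F n in sequentially. dist (S n) 0 < e"
      using uniform_limitD[OF F(2) half_gt_zero[OF e]]
    proof eventually_elim
      case (elim n)
      then have "norm (S n) \<le> e / 2"
        by (intro graph_norm_le[OF F(1)]) (simp add: less_imp_le)
      then show ?case using e by simp
    qed
  qed
  then show ?thesis
    using F(3) LIMSEQ_unique by blast
qed

lemma closure_graph_unique:
  assumes "closure_graph f S" and "closure_graph f T"
  shows "S = T"
  using closure_graph_zero[of "S - T"] closure_graph_diff[OF assms] by simp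

lemma closure_graph_inject:
  assumes "closure_graph f T" and "closure_graph g T"
  shows "f = g"
  using closure_graph_norm_ge[OF closure_graph_diff[OF assms]] by fastforce

text \<open>The isometry in the form in which it is used. One direction applies
  \<open>graph_norm_le\<close> and lets approximations of a function yield an operator; the other
  applies \<open>graph_norm_ge\<close> and makes the image closed.\<close>

lemma uniformly_Cauchy_graph_iff:
  assumes "\<And>n. R (F n) (S n)"
  shows "uniformly_Cauchy_on UNIV F \<longleftrightarrow> Cauchy S"
proof
  assume F: "uniformly_Cauchy_on UNIV F"
  show "Cauchy S"
  proof (rule CauchyI)
    fix e :: real assume e: "e > 0"
    then obtain M where M: "\<And>x m n. m \<ge> M \<Longrightarrow> n \<ge> M \<Longrightarrow> dist (F m x) (F n x) < e/2"
      using F half_gt_zero unfolding uniformly_Cauchy_on_def by (metis UNIV_I)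
    have "norm (S m - S n) < e" if "m \<ge> M" "n \<ge> M" for m n
    proof -
      have "norm (S m - S n) \<le> e/2"
        using M[OF that] by (intro graph_norm_le[OF graph_diff[OF assms assms]])
          (simp add: dist_norm less_imp_le)
      then show ?thesis using e by simp
    qed
    then show "\<exists>M. \<forall>m\<ge>M. \<forall>n\<ge>M. norm (S m - S n) < e" by blast
  qed
next
  assume S: "Cauchy S"
  show "uniformly_Cauchy_on UNIV F"
  proof (rule uniformly_Cauchy_onI)
    fix e :: real assume "e > 0"
    then obtain M where "\<And>m n. m \<ge> M \<Longrightarrow> n \<ge> M \<Longrightarrow> norm (S m - S n) < e"
      using CauchyD[OF S] by blast
    then show "\<exists>M. \<forall>x\<in>UNIV. \<forall>m\<ge>M. \<forall>n\<ge>M. dist (F m x) (F n x) < e"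
      using graph_norm_ge[OF graph_diff[OF assms assms]] unfolding dist_norm
      by (meson le_less_trans)
  qed
qed

lemma closure_graph_exists:
  assumes f: "f \<in> cfun Y"
  shows "\<exists>T. closure_graph f T"
proof -
  have "\<exists>g T. R g T \<and> (\<forall>x. cmod (g x - f x) < inverse (real (Suc n)))" for n
    by (rule graph_dense[OF f]) simp
  then obtain F S where F: "\<And>n. R (F n) (S n)" "\<And>n x. cmod (F n x - f x) < inverse (real (Suc n))"
    by metis
  have lim: "uniform_limit UNIV F f sequentially"
  proof (rule uniform_limitI)
    fix e :: real assume "e > 0"
    then have "\<forall>\<^sub>F n in sequentially. inverse (real (Suc n)) < e"
      using order_tendstoD(2)[OF LIMSEQ_inverse_real_of_nat] by blast
    then show "\<forall>\<^sub>F n in sequentially. \<forall>x\<in>UNIV. dist (F n x) (f x) < e"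
      by (rule eventually_mono) (metis F(2) dist_norm less_trans)
  qed
  then have "Cauchy S"
    using uniformly_Cauchy_graph_iff[of F S] F(1) uniformly_convergent_Cauchy
    unfolding uniformly_convergent_on_def by blast
  then obtain T where "S \<longlonglongrightarrow> T"
    using Cauchy_convergent_iff convergent_def by blast
  then show ?thesis
    unfolding closure_graph_def using F(1) lim by blast
qed

definition closure_rep :: "('b \<Rightarrow> complex) \<Rightarrow> 'h \<Rightarrow>\<^sub>L 'h" where
  "closure_rep f = (THE T. closure_graph f T)"

lemma closure_rep_eq: "closure_graph f T \<Longrightarrow> closure_rep f = T"
  unfolding closure_rep_def using closure_graph_unique by blast

lemma closure_graph_rep: "f \<in> cfun Y \<Longrightarrow> closure_graph f (closure_rep f)"
  using closure_graph_exists closure_rep_eq by metis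

lemma closure_rep_of_graph: "R f T \<Longrightarrow> closure_rep f = T"
  by (intro closure_rep_eq closure_graph_of_graph)

lemma faithful_rep_closure_rep: "faithful_rep Y closure_rep"
proof -
  have "inj_on closure_rep (cfun Y)"
  proof (rule inj_onI)
    fix f g assume "f \<in> cfun Y" "g \<in> cfun Y" "closure_rep f = closure_rep g"
    then show "f = g"
      using closure_graph_rep[of f] closure_graph_rep[of g] closure_graph_inject by simp
  qed
  then show ?thesis
    unfolding faithful_rep_def star_rep_def using closure_graph_rep
    by (auto intro: closure_graph_ops closure_rep_eq closure_graph_add closure_graph_mult
        closure_graph_scale closure_graph_cnj)
qed

lemma closure_rep_image: "closure_rep ` cfun Y = closure {T. \<exists>f. R f T}"
proof (intro equalityI subsetI)
  fix T assume "T \<in> closure_rep ` cfun Y"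
  then obtain f where "closure_graph f T"
    using closure_graph_rep by blast
  then show "T \<in> closure {T. \<exists>f. R f T}"
    unfolding closure_graph_def closure_sequential by blast
next
  fix T assume "T \<in> closure {T. \<exists>f. R f T}"
  then obtain S where "\<forall>n. \<exists>f. R f (S n)" and S: "S \<longlonglongrightarrow> T"
    unfolding closure_sequential by blast
  then obtain F where F: "\<And>n. R (F n) (S n)" by metis
  have "uniformly_Cauchy_on UNIV F"
    using uniformly_Cauchy_graph_iff[of F S] F LIMSEQ_imp_Cauchy[OF S] by blast
  then obtain f where "uniform_limit UNIV F f sequentially"
    using Cauchy_uniformly_convergent unfolding uniformly_convergent_on_def by blast
  then have "closure_graph f T"
    unfolding closure_graph_def using F S by blast
  then show "T \<in> closure_rep ` cfun Y"
    using closure_graph_cfun closure_rep_eq by blast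
qed

end

subsection \<open>Compressions by the powers of the partial isometry\<close>

lemma op_pow_0 [simp]: "op_pow T 0 = id_blinfun"
  by (simp add: op_pow_def)

lemma op_pow_Suc_apply: "op_pow T (Suc n) x = T (op_pow T n x)"
  by (simp add: op_pow_def)

lemma op_pow_Suc_apply': "op_pow T (Suc n) x = op_pow T n (T x)"
  by (induction n) (simp_all add: op_pow_Suc_apply)

lemma cscale_op_zero_left [simp]: "cscale_op 0 T = 0"
proof (rule blinfun_eqI)
  show "cscale_op 0 T x = blinfun_apply 0 x" for x
    using scaleR_scaleC[of 0 "T x"] by (simp add: cscale_op_apply)
qed

section \<open>Functions supported on clopen sets\<close>

lemma cfun_piecewise:
  assumes S: "openin X S" "closedin X S"
    and g: "continuous_map (subtopology X S) euclidean g"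
  shows "(\<lambda>x. if x \<in> S then g x else 0) \<in> cfun X"
proof (rule cfunI)
  have SX: "S \<subseteq> topspace X"
    using openin_subset S(1) by blast
  show "continuous_map X euclidean (\<lambda>x. if x \<in> S then g x else 0)"
    unfolding continuous_map_def
  proof (intro conjI allI impI)
    fix V :: "complex set" assume V: "openin euclidean V"
    have "openin (subtopology X S) {x \<in> topspace (subtopology X S). g x \<in> V}"
      using g V by (rule openin_continuous_map_preimage)
    then have *: "openin X {x \<in> S. g x \<in> V}"
      using SX openin_open_subtopology[OF S(1)] by (simp add: topspace_subtopology Int_absorb1)
    have "openin X (topspace X - S)"
      using S(2) by (rule openin_diff[OF openin_topspace])
    then have "openin X ({x \<in> S. g x \<in> V} \<union> (if 0 \<in> V then topspace X - S else {}))"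
      using * by auto
    moreover have "{x \<in> topspace X. (if x \<in> S then g x else 0) \<in> V}
      = {x \<in> S. g x \<in> V} \<union> (if 0 \<in> V then topspace X - S else {})"
      using SX by auto
    ultimately show "openin X {x \<in> topspace X. (if x \<in> S then g x else 0) \<in> V}"
      by (simp only:)
  qed simp
  show "(if x \<in> S then g x else 0) = 0" if "x \<notin> topspace X" for x
    using that SX by auto
qed

lemma cfun_restrict:
  assumes "f \<in> cfun X" and "openin X S" and "closedin X S"
  shows "(\<lambda>x. if x \<in> S then f x else 0) \<in> cfun X"
  using assms by (intro cfun_piecewise) (auto simp: cfun_def intro: continuous_map_from_subtopology)

lemma cfun_of_bool:
  assumes "openin X S" and "closedin X S"
  shows "(\<lambda>x. of_bool (x \<in> S)) \<in> cfun X"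
  using cfun_piecewise[OF assms, of "\<lambda>_. 1"] by (simp add: of_bool_def)

lemma cfun_onD1: "f \<in> cfun_on K Y \<Longrightarrow> f \<in> cfun Y"
  by (simp add: cfun_on_def)

lemma cfun_onD2: "f \<in> cfun_on K Y \<Longrightarrow> x \<notin> K \<Longrightarrow> f x = 0"
  by (simp add: cfun_on_def)

lemma cfun_on_mono: "K \<subseteq> L \<Longrightarrow> cfun_on K Y \<subseteq> cfun_on L Y"
  by (auto simp: cfun_on_def)

lemma cfun_on_compose:
  "f \<in> cfun_on K Y \<Longrightarrow> continuous_on UNIV \<phi> \<Longrightarrow> \<phi> 0 = 0 \<Longrightarrow> (\<lambda>x. \<phi> (f x)) \<in> cfun_on K Y"
  by (simp add: cfun_on_def cfun_compose)

text \<open>A function supported in S equals its product with the indicator of S. This turns the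
  initial and final spaces of a covariant representation into ranges of projections.\<close>

lemma star_rep_range_cfun_on:
  assumes \<pi>: "star_rep Y \<pi>" and S: "(\<lambda>x. of_bool (x \<in> S)) \<in> cfun Y"
  shows "{\<pi> f h |f h. f \<in> cfun_on S Y} = range (\<pi> (\<lambda>x. of_bool (x \<in> S)))"
proof -
  have "\<pi> f h = \<pi> (\<lambda>x. of_bool (x \<in> S)) (\<pi> f h)" if "f \<in> cfun_on S Y" for f h
  proof -
    have "(\<lambda>x. of_bool (x \<in> S) * f x) = f"
      using that by (auto simp: cfun_on_def fun_eq_iff)
    moreover have "\<pi> (\<lambda>x. of_bool (x \<in> S) * f x) = \<pi> (\<lambda>x. of_bool (x \<in> S)) o\<^sub>L \<pi> f"
      using \<pi> S cfun_onD1[OF that] by (simp add: star_rep_def)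
    ultimately have "\<pi> f h = (\<pi> (\<lambda>x. of_bool (x \<in> S)) o\<^sub>L \<pi> f) h"
      by simp
    then show ?thesis
      by (simp only: blinfun_apply_blinfun_compose)
  qed
  moreover have "(\<lambda>x. of_bool (x \<in> S)) \<in> cfun_on S Y"
    using S by (simp add: cfun_on_def)
  ultimately show ?thesis by blast
qed

section \<open>Partial maps with clopen domain and range\<close>

locale clopen_partial_map =
  fixes X :: "'a topology" and D :: "'a set" and \<alpha> :: "'a \<Rightarrow> 'a"
  assumes compact: "compact_space X" and Hausdorff: "Hausdorff_space X"
    and open_dom: "openin X D" and closed_dom: "closedin X D"
    and cont: "continuous_map (subtopology X D) X \<alpha>"
    and open_range: "openin X (\<alpha> ` D)"
begin

abbreviation "\<delta> \<equiv> comp_endo D \<alpha>"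

abbreviation "\<Delta> \<equiv> dom_iter X D \<alpha>"

lemma dom_subset: "D \<subseteq> topspace X"
  using openin_subset[OF open_dom] .

lemma map_in_topspace: "x \<in> D \<Longrightarrow> \<alpha> x \<in> topspace X"
  using cont dom_subset by (auto simp: continuous_map_def Pi_iff)

text \<open>As a continuous image of a compact set the open range is also closed, so a coefficient
  can be cut along it without losing continuity.\<close>

lemma closed_range: "closedin X (\<alpha> ` D)"
proof -
  have "compactin (subtopology X D) D"
    using closedin_compact_space[OF compact closed_dom] by (simp add: compactin_subtopology)
  then show ?thesis
    using image_compactin[OF _ cont] compactin_imp_closedin[OF Hausdorff] by blast
qed

lemma dom_iter_subset_topspace: "\<Delta> n \<subseteq> topspace X"
  using dom_subset by (cases n) auto

lemma dom_iter_Suc_subset: "\<Delta> (Suc n) \<subseteq> \<Delta> n"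
proof (induction n)
  case 0
  then show ?case using dom_subset by auto
next
  case (Suc n)
  then show ?case by (auto simp del: dom_iter.simps(1))
qed

lemma dom_iter_1: "\<Delta> (Suc 0) = D"
  using map_in_topspace by auto

lemma endo_cfun:
  assumes "f \<in> cfun X"
  shows "\<delta> f \<in> cfun X"
proof -
  have "continuous_map (subtopology X D) euclidean (f \<circ> \<alpha>)"
    using cont cfun_continuous_map[OF assms] by (rule continuous_map_compose)
  then show ?thesis
    using cfun_piecewise[OF open_dom closed_dom, of "f \<circ> \<alpha>"] unfolding comp_endo_def o_def by blast
qed

lemma endo_iter_cfun: "f \<in> cfun X \<Longrightarrow> (\<delta> ^^ n) f \<in> cfun X"
  by (induction n) (auto intro: endo_cfun)

lemma endo_cfun_on:
  assumes "f \<in> cfun_on (\<Delta> n) X"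
  shows "\<delta> f \<in> cfun_on (\<Delta> (Suc n)) X"
  using assms by (auto simp: cfun_on_def endo_cfun) (auto simp: comp_endo_def)

text \<open>These iterates arise when the projection for D is moved past n factors U*. As D is
  \<open>\<Delta> 1\<close>, not \<open>\<Delta> 0\<close>, the index is
  \<open>Suc n\<close>.\<close>

lemma endo_iter_of_bool_dom: "(\<delta> ^^ n) (\<lambda>x. of_bool (x \<in> D)) = (\<lambda>x. of_bool (x \<in> \<Delta> (Suc n)))"
proof (induction n)
  case 0
  then show ?case using dom_iter_1 by simp
next
  case (Suc n)
  have "(\<delta> ^^ Suc n) (\<lambda>x. of_bool (x \<in> D)) = \<delta> (\<lambda>x. of_bool (x \<in> \<Delta> (Suc n)))"
    using Suc by simp
  also have "\<dots> = (\<lambda>x. of_bool (x \<in> \<Delta> (Suc (Suc n))))"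
    by (auto simp: comp_endo_def)
  finally show ?case .
qed

lemma cfun_of_bool_dom_iter: "(\<lambda>x. of_bool (x \<in> \<Delta> n)) \<in> cfun X"
proof (cases n)
  case 0
  then show ?thesis
    using cfun_of_bool[of X "topspace X"] by simp
next
  case (Suc m)
  then show ?thesis
    using endo_iter_cfun[OF cfun_of_bool[OF open_dom closed_dom], of m] endo_iter_of_bool_dom[of m]
    by simp
qed

lemma cfun_of_bool_range: "(\<lambda>x. of_bool (x \<in> \<alpha> ` D)) \<in> cfun X"
  by (rule cfun_of_bool[OF open_range closed_range])

end

section \<open>Commutation relations of a covariant representation\<close>

locale covariant_rep = clopen_partial_map X D \<alpha>
  for X :: "'a topology" and D :: "'a set" and \<alpha> :: "'a \<Rightarrow> 'a" +
  fixes \<pi> :: "('a \<Rightarrow> complex) \<Rightarrow> 'h::chilbert_space \<Rightarrow>\<^sub>L 'h" and U :: "'h \<Rightarrow>\<^sub>L 'h"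
  assumes cov: "cov_faith_rep X D (\<alpha> ` D) (comp_endo D \<alpha>) \<pi> U"
begin

lemma star_rep: "star_rep X \<pi>" and inj: "inj_on \<pi> (cfun X)" and partial_isometry: "partial_isometry U"
  using cov by (auto simp: cov_faith_rep_def faithful_rep_def)

lemma U_ops: "U \<in> bounded_ops"
  using partial_isometry by (simp add: partial_isometry_def)

lemma
  assumes "f \<in> cfun X"
  shows rep_ops: "\<pi> f \<in> bounded_ops"
    and rep_scale: "\<pi> (\<lambda>x. c * f x) = cscale_op c (\<pi> f)"
    and rep_cnj: "\<pi> (\<lambda>x. cnj (f x)) = adj (\<pi> f)"
  using star_rep assms by (auto simp: star_rep_def)

lemma
  assumes "f \<in> cfun X" "g \<in> cfun X"
  shows rep_add: "\<pi> (\<lambda>x. f x + g x) = \<pi> f + \<pi> g"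
    and rep_mult: "\<pi> (\<lambda>x. f x * g x) = \<pi> f o\<^sub>L \<pi> g"
  using star_rep assms by (auto simp: star_rep_def)

lemma rep_mult_apply: "f \<in> cfun X \<Longrightarrow> g \<in> cfun X \<Longrightarrow> \<pi> f (\<pi> g x) = \<pi> (\<lambda>x. f x * g x) x"
  by (simp add: rep_mult)

lemma
  shows adj_compose_isometry: "adj U o\<^sub>L U = \<pi> (\<lambda>x. of_bool (x \<in> \<alpha> ` D))" (is "_ = ?P")
    and isometry_compose_proj: "U o\<^sub>L \<pi> (\<lambda>x. of_bool (x \<in> \<alpha> ` D)) = U"
proof -
  note E = cfun_of_bool_range
  have "(\<lambda>x. cnj (of_bool (x \<in> \<alpha> ` D))) = (\<lambda>x. of_bool (x \<in> \<alpha> ` D))"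
    "(\<lambda>x. of_bool (x \<in> \<alpha> ` D) * of_bool (x \<in> \<alpha> ` D)) = (\<lambda>x. of_bool (x \<in> \<alpha> ` D) :: complex)"
    by (auto simp: fun_eq_iff of_bool_def)
  then have "adj ?P = ?P" "?P o\<^sub>L ?P = ?P"
    using rep_cnj[OF E] rep_mult[OF E E] by simp_all
  moreover have "initial_space U = range ?P"
    using cov star_rep_range_cfun_on[OF star_rep E] by (simp add: cov_faith_rep_def)
  ultimately show "adj U o\<^sub>L U = ?P" "U o\<^sub>L ?P = U"
    using partial_isometry_adj_compose[OF partial_isometry rep_ops[OF E]] by blast+
qed

lemma adj_isometry_apply: "adj U (U x) = \<pi> (\<lambda>x. of_bool (x \<in> \<alpha> ` D)) x"
  by (simp flip: adj_compose_isometry)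

lemma isometry_proj_apply: "U (\<pi> (\<lambda>x. of_bool (x \<in> \<alpha> ` D)) x) = U x"
  using isometry_compose_proj by (metis blinfun_apply_blinfun_compose)

lemma covariance: "f \<in> cfun X \<Longrightarrow> U o\<^sub>L \<pi> f o\<^sub>L adj U = \<pi> (\<delta> f)"
  using cov by (simp add: cov_faith_rep_def)

lemma covariance_apply: "f \<in> cfun X \<Longrightarrow> U (\<pi> f (adj U x)) = \<pi> (\<delta> f) x"
  by (simp flip: covariance)

text \<open>Covariance in commuted form: U absorbs the projection U*U, which commutes with
  \<open>\<pi> f\<close>, and then U \<open>\<pi> f\<close> U* appears.\<close>

lemma isometry_rep_apply:
  assumes "f \<in> cfun X"
  shows "U (\<pi> f x) = \<pi> (\<delta> f) (U x)"
proof -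
  have "U (\<pi> f x) = U (\<pi> (\<lambda>x. of_bool (x \<in> \<alpha> ` D)) (\<pi> f x))"
    by (simp add: isometry_proj_apply)
  also have "\<dots> = U (\<pi> f (\<pi> (\<lambda>x. of_bool (x \<in> \<alpha> ` D)) x))"
    using assms cfun_of_bool_range by (simp add: rep_mult_apply mult.commute)
  also have "\<dots> = \<pi> (\<delta> f) (U x)"
    using assms by (simp add: covariance_apply flip: adj_isometry_apply)
  finally show ?thesis .
qed

text \<open>The adjoint of \<open>isometry_rep_apply\<close> for the conjugate function.\<close>

lemma rep_adj_isometry_apply:
  assumes "f \<in> cfun X"
  shows "\<pi> f (adj U x) = adj U (\<pi> (\<delta> f) x)"
proof (rule cinner_eq_all_imp_eq)
  fix y
  have "\<delta> (\<lambda>x. cnj (f x)) = (\<lambda>x. cnj (\<delta> f x))"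
    by (auto simp: comp_endo_def)
  then have *: "U (adj (\<pi> f) y) = adj (\<pi> (\<delta> f)) (U y)"
    using isometry_rep_apply[OF cfun_cnj[OF assms], of y] assms
    by (simp add: rep_cnj endo_cfun)
  have "cinner y (\<pi> f (adj U x)) = cinner (U (adj (\<pi> f) y)) x"
    by (simp only: cinner_adj_left[OF rep_ops[OF assms]] cinner_adj_right[OF U_ops])
  also have "\<dots> = cinner y (adj U (\<pi> (\<delta> f) x))"
    unfolding * by (simp only: cinner_adj_left[OF rep_ops[OF endo_cfun[OF assms]]] cinner_adj_right[OF U_ops])
  finally show "cinner y (\<pi> f (adj U x)) = cinner y (adj U (\<pi> (\<delta> f) x))" .
qed

text \<open>U U* is U P U* with P = U*U, so covariance evaluates it; the indicator of the range
  pulls back along \<alpha> to that of D.\<close>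

lemma isometry_adj_apply: "U (adj U x) = \<pi> (\<lambda>x. of_bool (x \<in> D)) x"
proof -
  have "U (adj U x) = U (\<pi> (\<lambda>x. of_bool (x \<in> \<alpha> ` D)) (adj U x))"
    by (simp add: isometry_proj_apply)
  also have "\<dots> = \<pi> (\<delta> (\<lambda>x. of_bool (x \<in> \<alpha> ` D))) x"
    by (rule covariance_apply[OF cfun_of_bool_range])
  also have "\<delta> (\<lambda>x. of_bool (x \<in> \<alpha> ` D)) = (\<lambda>x. of_bool (x \<in> D))"
    by (auto simp: comp_endo_def)
  finally show ?thesis .
qed

text \<open>For a supported in \<open>\<Delta> n\<close>, the operator that is to represent the
  function x \<mapsto> a(x_n) on the extension.\<close>

definition compress :: "nat \<Rightarrow> ('a \<Rightarrow> complex) \<Rightarrow> 'h \<Rightarrow>\<^sub>L 'h" where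
  "compress n a = op_pow (adj U) n o\<^sub>L \<pi> a o\<^sub>L op_pow U n"

lemma compress_0 [simp]: "compress 0 a = \<pi> a"
  by (rule blinfun_eqI) (simp add: compress_def)

lemma compress_Suc: "compress (Suc n) a = adj U o\<^sub>L compress n a o\<^sub>L U"
  by (rule blinfun_eqI) (simp add: compress_def op_pow_Suc_apply'[of U] op_pow_Suc_apply[of "adj U"])

lemma compress_ops: "a \<in> cfun X \<Longrightarrow> compress n a \<in> bounded_ops"
  by (induction n) (simp_all add: compress_Suc rep_ops bounded_ops_compose adj_bounded_ops U_ops)

lemma compress_add:
  assumes "a \<in> cfun X" "b \<in> cfun X"
  shows "compress n (\<lambda>x. a x + b x) = compress n a + compress n b"
  by (rule blinfun_eqI) (simp add: compress_def rep_add assms blinfun.add_left blinfun.add_right)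

lemma compress_scale:
  assumes "a \<in> cfun X"
  shows "compress n (\<lambda>x. c * a x) = cscale_op c (compress n a)"
proof (induction n)
  case (Suc n)
  then show ?case
    by (intro blinfun_eqI)
      (simp add: compress_Suc cscale_op_apply bounded_ops_scaleC[OF adj_bounded_ops[OF U_ops]])
qed (simp add: rep_scale assms)

lemma compress_cnj:
  assumes "a \<in> cfun X"
  shows "compress n (\<lambda>x. cnj (a x)) = adj (compress n a)"
proof (induction n)
  case (Suc n)
  have "adj (adj U o\<^sub>L compress n a o\<^sub>L U) = adj U o\<^sub>L (adj (compress n a) o\<^sub>L U)"
    by (simp add: adj_compose adj_adj compress_ops assms adj_bounded_ops U_ops bounded_ops_compose)
  then show ?case
    unfolding compress_Suc Suc by (auto intro: blinfun_eqI)
qed (simp add: rep_cnj assms)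

lemma compress_zero: "compress n (\<lambda>_. 0) = 0"
  using compress_scale[OF cfun_zero, of n 0] by simp

text \<open>Each factor U* that \<open>\<pi> g\<close> passes costs one application of \<delta>,
  until it meets \<open>\<pi> b\<close>.\<close>

lemma rep_compress:
  assumes "g \<in> cfun X" "b \<in> cfun X"
  shows "\<pi> g (compress n b x) = compress n (\<lambda>x. (\<delta> ^^ n) g x * b x) x"
  using assms(1)
proof (induction n arbitrary: g x)
  case 0
  then show ?case using assms(2) by (simp add: rep_mult_apply)
next
  case (Suc n)
  have "(\<delta> ^^ n) (\<delta> g) = (\<delta> ^^ Suc n) g"
    by (simp only: funpow_Suc_right o_apply)
  then show ?case
    using Suc.IH[OF endo_cfun[OF Suc.prems]] Suc.prems
    by (simp add: compress_Suc rep_adj_isometry_apply)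
qed

lemma compress_rep:
  assumes "g \<in> cfun X" "b \<in> cfun X"
  shows "compress n b (\<pi> g x) = compress n (\<lambda>x. b x * (\<delta> ^^ n) g x) x"
  using assms(1)
proof (induction n arbitrary: g x)
  case 0
  then show ?case using assms(2) by (simp add: rep_mult_apply)
next
  case (Suc n)
  have "(\<delta> ^^ n) (\<delta> g) = (\<delta> ^^ Suc n) g"
    by (simp only: funpow_Suc_right o_apply)
  then show ?case
    using Suc.IH[OF endo_cfun[OF Suc.prems]] Suc.prems
    by (simp add: compress_Suc isometry_rep_apply)
qed

text \<open>The indicator of D, moved through n powers, becomes that of
  \<open>\<Delta> (Suc n)\<close>, which b absorbs. This removes the factors U U* that appear when
  products and conjugates of compressions are peeled.\<close>

lemma
  assumes "b \<in> cfun_on (\<Delta> (Suc n)) X"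
  shows proj_compress: "\<pi> (\<lambda>x. of_bool (x \<in> D)) (compress n b x) = compress n b x"
    and compress_proj: "compress n b (\<pi> (\<lambda>x. of_bool (x \<in> D)) x) = compress n b x"
proof -
  have b: "b \<in> cfun X"
    using assms by (rule cfun_onD1)
  have *: "(\<lambda>x. of_bool (x \<in> \<Delta> (Suc n)) * b x) = b"
    using cfun_onD2[OF assms] by (auto simp: fun_eq_iff simp del: dom_iter.simps)
  show "\<pi> (\<lambda>x. of_bool (x \<in> D)) (compress n b x) = compress n b x"
    "compress n b (\<pi> (\<lambda>x. of_bool (x \<in> D)) x) = compress n b x"
    using rep_compress[OF cfun_of_bool[OF open_dom closed_dom] b, of n x]
      compress_rep[OF cfun_of_bool[OF open_dom closed_dom] b, of n x]
    unfolding endo_iter_of_bool_dom mult.commute[of "b _"] * by simp_all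
qed

lemma isometry_compress_Suc:
  assumes "b \<in> cfun_on (\<Delta> (Suc n)) X"
  shows "U o\<^sub>L compress (Suc n) b o\<^sub>L adj U = compress n b"
  by (rule blinfun_eqI)
    (simp add: compress_Suc isometry_adj_apply proj_compress[OF assms] compress_proj[OF assms])

lemma cfun_on_dom_iter_Suc: "b \<in> cfun_on (\<Delta> (Suc n)) X \<Longrightarrow> b \<in> cfun_on (\<Delta> n) X"
  using cfun_on_mono[OF dom_iter_Suc_subset] by blast

text \<open>Peeling off the outer U* and U leaves U U* between the factors, and
  \<open>proj_compress\<close> for the right factor removes it; hence the support condition is
  imposed on b alone.\<close>

lemma compress_mult:
  assumes "a \<in> cfun X" "b \<in> cfun_on (\<Delta> n) X"
  shows "compress n a (compress n b x) = compress n (\<lambda>x. a x * b x) x"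
  using assms(2)
proof (induction n arbitrary: x)
  case 0
  then show ?case using assms(1) by (simp add: rep_mult_apply cfun_on_def)
next
  case (Suc n)
  then show ?case
    using cfun_on_dom_iter_Suc[OF Suc.prems]
    by (simp add: compress_Suc isometry_adj_apply proj_compress del: dom_iter.simps)
qed

text \<open>Peeling reduces to n = 0, where \<open>\<pi> a\<close> U* = U*
  \<open>\<pi> (\<delta> a)\<close> and \<open>\<delta> a\<close> is 0 because a vanishes on the
  range.\<close>

lemma compress_orthogonal_left:
  assumes "a \<in> cfun X" "\<And>x. x \<in> \<alpha> ` D \<Longrightarrow> a x = 0" "n < m" "b \<in> cfun_on (\<Delta> m) X"
  shows "compress n a (compress m b x) = 0"
  using assms(3,4)
proof (induction n arbitrary: m x)
  case 0
  then obtain k where m: "m = Suc k" by (cases m) auto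
  have "\<delta> a = (\<lambda>_. 0)"
    using assms(2) by (auto simp: comp_endo_def)
  then show ?case
    using assms(1) compress_zero[of 0] by (simp add: m compress_Suc rep_adj_isometry_apply)
next
  case (Suc n)
  then obtain k where m: "m = Suc k" by (cases m) auto
  have "compress n a (compress k b (U x)) = 0"
    using Suc cfun_on_dom_iter_Suc unfolding m by (meson Suc_less_SucD)
  then show ?case
    using Suc.prems by (simp add: m compress_Suc isometry_adj_apply proj_compress del: dom_iter.simps)
qed

text \<open>Taking adjoints reverses the product and conjugates the coefficients, which keeps their
  zeros.\<close>

lemma compress_orthogonal_right:
  assumes "a \<in> cfun X" "\<And>x. x \<in> \<alpha> ` D \<Longrightarrow> a x = 0" "n < m" "b \<in> cfun_on (\<Delta> m) X"
  shows "compress m b (compress n a x) = 0"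
proof (rule cinner_eq_all_imp_eq)
  fix y
  have b: "b \<in> cfun X" "(\<lambda>x. cnj (b x)) \<in> cfun_on (\<Delta> m) X"
    using assms(4) by (auto simp: cfun_on_def cfun_cnj)
  have a: "(\<lambda>x. cnj (a x)) \<in> cfun X" "\<And>x. x \<in> \<alpha> ` D \<Longrightarrow> cnj (a x) = 0"
    using assms by (auto simp: cfun_cnj)
  have "cinner y (compress m b (compress n a x))
      = cinner (adj (compress n a) (adj (compress m b) y)) x"
    using assms(1) b(1) by (simp add: cinner_adj_left compress_ops)
  also have "\<dots> = 0"
    using compress_orthogonal_left[OF a \<open>n < m\<close> b(2), of y] assms(1) b(1)
    by (simp add: compress_cnj)
  finally show "cinner y (compress m b (compress n a x)) = cinner y 0" by simp
qed

text \<open>If a is supported in the range, then U*U absorbs into \<open>\<pi> a\<close>, and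
  commuting U past \<open>\<pi> a\<close> produces \<delta>. This is the operator side of moving a
  coefficient one level up; \<open>ext_coord_shift\<close> is the function side.\<close>

lemma compress_shift:
  assumes "a \<in> cfun_on (\<alpha> ` D) X"
  shows "compress n a = compress (Suc n) (\<delta> a)"
proof (induction n)
  case 0
  have a: "a \<in> cfun X" using assms by (rule cfun_onD1)
  have "(\<lambda>x. of_bool (x \<in> \<alpha> ` D) * a x) = a"
    using assms by (auto simp: cfun_on_def fun_eq_iff)
  then have "\<pi> a x = adj U (\<pi> (\<delta> a) (U x))" for x
    using rep_mult_apply[OF cfun_of_bool_range a, of x] a
    by (simp add: isometry_rep_apply flip: adj_isometry_apply)
  then show ?case
    by (intro blinfun_eqI) (simp add: compress_Suc)
next
  case (Suc n)
  then show ?case by (metis compress_Suc)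
qed

text \<open>The generators of the C*-algebra allow every a in C(X), brackets only coefficients
  supported in \<open>\<Delta> n\<close>. Writing U = U U* U inserts the indicator of D, which
  reaches a as the indicator of \<open>\<Delta> n\<close>.\<close>

lemma compress_restrict:
  assumes "a \<in> cfun X"
  shows "compress n (\<lambda>x. of_bool (x \<in> \<Delta> n) * a x) = compress n a"
proof (cases n)
  case 0
  have "(\<lambda>x. of_bool (x \<in> \<Delta> 0) * a x) = a"
    using cfun_eq_0[OF assms] by (auto simp: fun_eq_iff)
  then show ?thesis by (simp only: 0)
next
  case (Suc m)
  have "compress m a (U x) = compress m (\<lambda>x. of_bool (x \<in> \<Delta> n) * a x) (U x)" for x
  proof -
    have "\<pi> (\<lambda>x. of_bool (x \<in> D)) (U x) = U x"
      by (simp add: adj_isometry_apply isometry_proj_apply flip: isometry_adj_apply)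
    then show ?thesis
      using compress_rep[OF cfun_of_bool[OF open_dom closed_dom] assms, of m "U x"]
      unfolding endo_iter_of_bool_dom Suc by (simp add: mult.commute del: dom_iter.simps)
  qed
  then show ?thesis
    by (intro blinfun_eqI) (simp add: Suc compress_Suc del: dom_iter.simps)
qed

text \<open>Conjugating by U undoes the compression one level at a time, until faithfulness of \<pi>
  applies.\<close>

lemma compress_inject:
  "a \<in> cfun_on (\<Delta> n) X \<Longrightarrow> compress n a = 0 \<Longrightarrow> a = (\<lambda>_. 0)"
proof (induction n)
  case 0
  then have "\<pi> a = \<pi> (\<lambda>_. 0)"
    using compress_zero[of 0] by simp
  then show ?case
    using inj_onD[OF inj] 0 cfun_zero cfun_onD1 by blast
next
  case (Suc n)
  have "compress n a = 0"
    using isometry_compress_Suc[OF Suc.prems(1)] Suc.prems(2) by (auto intro: blinfun_eqI)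
  then show ?case
    using Suc.IH cfun_on_dom_iter_Suc[OF Suc.prems(1)] by blast
qed

end

subsection \<open>The space of the reversible extension\<close>

lemma topspace_adjoin_zero: "topspace (adjoin_zero X) = insert None (Some ` topspace X)"
proof (rule subset_antisym)
  show "topspace (adjoin_zero X) \<subseteq> insert None (Some ` topspace X)"
    using openin_topspace[of "adjoin_zero X"] unfolding openin_adjoin_zero by blast
  have "{x. Some x \<in> insert None (Some ` topspace X)} = topspace X"
    by auto
  then have "openin (adjoin_zero X) (insert None (Some ` topspace X))"
    by (simp add: openin_adjoin_zero)
  then show "insert None (Some ` topspace X) \<subseteq> topspace (adjoin_zero X)"
    by (rule openin_subset)
qed

lemma continuous_map_Some: "continuous_map X (adjoin_zero X) Some"
  unfolding continuous_map_def
proof (intro conjI allI impI)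
  fix W assume "openin (adjoin_zero X) W"
  then have W: "openin X {x. Some x \<in> W}"
    by (simp add: openin_adjoin_zero)
  then have "{x. Some x \<in> W} = {x \<in> topspace X. Some x \<in> W}"
    using openin_subset by blast
  then show "openin X {x \<in> topspace X. Some x \<in> W}"
    using W by simp
qed (auto simp: topspace_adjoin_zero)

lemma continuous_map_from_adjoin_zero:
  assumes "continuous_map X Z (\<lambda>x. f (Some x))" and "f None \<in> topspace Z"
  shows "continuous_map (adjoin_zero X) Z f"
  unfolding continuous_map_def
proof (intro conjI allI impI)
  show "f \<in> topspace (adjoin_zero X) \<rightarrow> topspace Z"
    using assms by (auto simp: topspace_adjoin_zero continuous_map_def Pi_iff)
  fix W assume "openin Z W"
  then have "openin X {x \<in> topspace X. f (Some x) \<in> W}"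
    using assms(1) by (simp add: continuous_map_def)
  moreover have "{x. Some x \<in> {x \<in> topspace (adjoin_zero X). f x \<in> W}} = {x \<in> topspace X. f (Some x) \<in> W}"
    by (auto simp: topspace_adjoin_zero)
  ultimately show "openin (adjoin_zero X) {x \<in> topspace (adjoin_zero X). f x \<in> W}"
    by (auto simp: openin_adjoin_zero topspace_adjoin_zero)
qed

lemma compact_space_adjoin_zero:
  assumes "compact_space X"
  shows "compact_space (adjoin_zero X)"
proof -
  have "compactin (adjoin_zero X) (Some ` topspace X)"
    using assms image_compactin[OF _ continuous_map_Some] by (simp add: compact_space_def)
  moreover have "compactin (adjoin_zero X) {None}"
    by (simp add: topspace_adjoin_zero)
  ultimately show ?thesis
    using compactin_Un by (fastforce simp: compact_space_def topspace_adjoin_zero)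
qed

lemma openin_adjoin_zero_image: "openin X S \<Longrightarrow> openin (adjoin_zero X) (Some ` S)"
proof -
  have *: "{x. Some x \<in> Some ` S} = S" by auto
  show "openin X S \<Longrightarrow> openin (adjoin_zero X) (Some ` S)"
    unfolding openin_adjoin_zero * using openin_subset by blast
qed

lemma closedin_adjoin_zero_image:
  assumes "closedin X S"
  shows "closedin (adjoin_zero X) (Some ` S)"
proof -
  have "openin X (topspace X - S)"
    using assms by (simp add: closedin_def)
  moreover have "{x. Some x \<in> insert None (Some ` (topspace X - S))} = topspace X - S"
    by auto
  ultimately have "openin (adjoin_zero X) (insert None (Some ` (topspace X - S)))"
    by (auto simp: openin_adjoin_zero)
  moreover have "topspace (adjoin_zero X) - Some ` S = insert None (Some ` (topspace X - S))"
    by (auto simp: topspace_adjoin_zero)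
  ultimately show ?thesis
    using closedin_subset[OF assms] by (auto simp: closedin_def topspace_adjoin_zero)
qed

lemma openin_adjoin_zero_None: "openin (adjoin_zero X) {None}"
  by (simp add: openin_adjoin_zero)

lemma Hausdorff_space_adjoin_zero:
  assumes "Hausdorff_space X"
  shows "Hausdorff_space (adjoin_zero X)"
  unfolding Hausdorff_space_def
proof (intro allI impI)
  fix x y assume "x \<in> topspace (adjoin_zero X) \<and> y \<in> topspace (adjoin_zero X) \<and> x \<noteq> y"
  then consider
      a where "x = None" "y = Some a" "a \<in> topspace X"
    | a where "x = Some a" "y = None" "a \<in> topspace X"
    | a b where "x = Some a" "y = Some b" "a \<in> topspace X" "b \<in> topspace X" "a \<noteq> b"
    by (auto simp: topspace_adjoin_zero)
  then show "\<exists>V W. openin (adjoin_zero X) V \<and> openin (adjoin_zero X) W \<and> x \<in> V \<and> y \<in> W \<and> disjnt V W"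
  proof cases
    case 1
    then show ?thesis
      by (intro exI[of _ "{None}"] exI[of _ "Some ` topspace X"])
        (auto simp: openin_adjoin_zero_None openin_adjoin_zero_image disjnt_def)
  next
    case 2
    then show ?thesis
      by (intro exI[of _ "Some ` topspace X"] exI[of _ "{None}"])
        (auto simp: openin_adjoin_zero_None openin_adjoin_zero_image disjnt_def)
  next
    case 3
    then obtain V W where "openin X V" "openin X W" "a \<in> V" "b \<in> W" "disjnt V W"
      using assms unfolding Hausdorff_space_def by blast
    then show ?thesis
      using 3 by (intro exI[of _ "Some ` V"] exI[of _ "Some ` W"])
        (auto simp: openin_adjoin_zero_image disjnt_def)
  qed
qed

section \<open>Orbits as points of the extension, compactness\<close>

context clopen_partial_map
begin

abbreviation "Xe \<equiv> ext_space X D \<alpha>"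

text \<open>The local description of the points of the extension: each coordinate determines the
  preceding one, and the sequence may stop only outside the range.\<close>

definition orbit_seq :: "(nat \<Rightarrow> 'a option) \<Rightarrow> bool" where
  "orbit_seq x \<longleftrightarrow> (\<exists>y\<in>topspace X. x 0 = Some y) \<and>
    (\<forall>n z. x (Suc n) = Some z \<longrightarrow> z \<in> D \<and> x n = Some (\<alpha> z)) \<and>
    (\<forall>n y. x (Suc n) = None \<longrightarrow> x n = Some y \<longrightarrow> y \<notin> \<alpha> ` D)"

lemma orbit_seqD1: "orbit_seq x \<Longrightarrow> \<exists>y\<in>topspace X. x 0 = Some y"
  and orbit_seqD2: "orbit_seq x \<Longrightarrow> x (Suc n) = Some z \<Longrightarrow> z \<in> D \<and> x n = Some (\<alpha> z)"
  and orbit_seqD3: "orbit_seq x \<Longrightarrow> x (Suc n) = None \<Longrightarrow> x n = Some y \<Longrightarrow> y \<notin> \<alpha> ` D"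
  unfolding orbit_seq_def by blast+

lemma orbit_seq_dom_iter:
  assumes x: "orbit_seq x"
  shows "x n = Some y \<Longrightarrow> y \<in> \<Delta> n"
proof (induction n arbitrary: y)
  case 0
  then show ?case using orbit_seqD1[OF x] by auto
next
  case (Suc n)
  then show ?case using orbit_seqD2[OF x, of n y] by auto
qed

lemma orbit_seq_None_mono:
  assumes x: "orbit_seq x" and "x n = None" and "n \<le> m"
  shows "x m = None"
  using assms(3,2)
proof (induction rule: dec_induct)
  case (step k)
  then show ?case
    using orbit_seqD2[OF x, of k] by (cases "x (Suc k)") auto
qed

text \<open>Applying \<alpha> n times to y leads to x_0, so one more application is possible exactly
  when x_0 lies in D. This compares the domain of \<open>ext_endo\<close> with the supports of
  coefficients.\<close>

lemma orbit_seq_in_dom: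
  assumes x: "orbit_seq x"
  shows "x n = Some y \<Longrightarrow> y \<in> \<Delta> (Suc n) \<longleftrightarrow> ext_proj x \<in> D"
proof (induction n arbitrary: y)
  case 0
  then show ?case
    using dom_iter_1 by (simp add: ext_proj_def del: dom_iter.simps)
next
  case (Suc n)
  then show ?case
    using orbit_seqD2[OF x Suc.prems] Suc.IH[of "\<alpha> y"] by simp
qed

lemma orbit_seq_iff: "x \<in> (\<Union>N. ext_fin X D \<alpha> N) \<union> ext_inf X D \<alpha> \<longleftrightarrow> orbit_seq x"
proof
  assume "x \<in> (\<Union>N. ext_fin X D \<alpha> N) \<union> ext_inf X D \<alpha>"
  then show "orbit_seq x"
  proof
    assume "x \<in> (\<Union>N. ext_fin X D \<alpha> N)"
    then obtain N p where x: "x = (\<lambda>n. if n \<le> N then Some (p n) else None)"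
      and p: "\<And>n. n \<le> N \<Longrightarrow> p n \<in> \<Delta> n" "p N \<notin> \<alpha> ` D" "\<And>n. 1 \<le> n \<Longrightarrow> n \<le> N \<Longrightarrow> \<alpha> (p n) = p (n - 1)"
      unfolding ext_fin_def by auto
    have "p (Suc n) \<in> D \<and> p n = \<alpha> (p (Suc n))" if "Suc n \<le> N" for n
      using p(1)[of "Suc n"] p(3)[of "Suc n"] that by auto
    moreover have "y \<notin> \<alpha> ` D" if "x (Suc n) = None" "x n = Some y" for n y
    proof -
      have "n = N" "y = p n"
        using that by (auto simp: x split: if_splits)
      then show ?thesis using p(2) by simp
    qed
    ultimately show ?thesis
      unfolding orbit_seq_def using p(1)[of 0] by (simp add: x split: if_splits)
  next
    assume "x \<in> ext_inf X D \<alpha>"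
    then obtain p where x: "x = (\<lambda>n. Some (p n))"
      and p: "\<And>n. p n \<in> \<Delta> n" "\<And>n. n \<ge> 1 \<Longrightarrow> \<alpha> (p n) = p (n - 1)"
      unfolding ext_inf_def by auto
    show ?thesis
      unfolding orbit_seq_def x using p(1)[of 0] p(1)[of "Suc _"] p(2)[of "Suc _"] by auto
  qed
next
  assume x: "orbit_seq x"
  define p where "p n = the (x n)" for n
  have p: "p n \<in> \<Delta> n" if "x n \<noteq> None" for n
    using orbit_seq_dom_iter[OF x] that by (auto simp: p_def)
  have p_step: "\<alpha> (p n) = p (n - 1)" if "x n \<noteq> None" "n \<ge> 1" for n
    using orbit_seqD2[OF x, of "n - 1"] that by (auto simp: p_def)
  show "x \<in> (\<Union>N. ext_fin X D \<alpha> N) \<union> ext_inf X D \<alpha>"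
  proof (cases "\<exists>n. x n = None")
    case False
    then have "x = (\<lambda>n. Some (p n))"
      by (auto simp: p_def)
    then have "x \<in> ext_inf X D \<alpha>"
      unfolding ext_inf_def using p p_step False by blast
    then show ?thesis by blast
  next
    case True
    define M where "M = (LEAST n. x n = None)"
    have M: "x M = None"
      unfolding M_def using True by (rule LeastI_ex)
    have less_M: "x n \<noteq> None" if "n < M" for n
      using that not_less_Least unfolding M_def by blast
    \<comment> \<open>Coordinate 0 is never \<open>None\<close>, so the first \<open>None\<close>
      has a predecessor N, the index of the last point of the orbit.\<close>
    obtain N where N: "M = Suc N"
      using M orbit_seqD1[OF x] by (cases M) auto
    have "x = (\<lambda>n. if n \<le> N then Some (p n) else None)"
    proof
      fix n
      show "x n = (if n \<le> N then Some (p n) else None)"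
        using less_M[of n] orbit_seq_None_mono[OF x M, of n] by (auto simp: N p_def)
    qed
    moreover have "p N \<notin> \<alpha> ` D"
      using orbit_seqD3[OF x, of N "p N"] M less_M[of N] by (auto simp: N p_def)
    moreover have "\<forall>n\<le>N. p n \<in> \<Delta> n" "\<forall>n. 1 \<le> n \<and> n \<le> N \<longrightarrow> \<alpha> (p n) = p (n - 1)"
      using p p_step less_M by (auto simp: N)
    ultimately have "x \<in> ext_fin X D \<alpha> N"
      unfolding ext_fin_def by blast
    then show ?thesis by blast
  qed
qed

lemma topspace_ext: "x \<in> topspace Xe \<longleftrightarrow> orbit_seq x"
proof -
  have "x n \<in> insert None (Some ` topspace X)" if "orbit_seq x" for n
    using orbit_seq_dom_iter[OF that, of n] dom_iter_subset_topspace by (cases "x n") auto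
  then show ?thesis
    unfolding ext_space_def topspace_subtopology Int_iff orbit_seq_iff
    by (auto simp: topspace_adjoin_zero)
qed

lemma continuous_map_ext_coordinate: "continuous_map Xe (adjoin_zero X) (\<lambda>x. x n)"
  unfolding ext_space_def
  by (intro continuous_map_from_subtopology continuous_map_product_projection UNIV_I)

text \<open>\<open>orbit_seq\<close> restricts x_0 and pairs of consecutive coordinates only. Each
  restriction is closed in the product, which is compact by Tychonoff.\<close>

lemma compact_space_ext: "compact_space Xe"
proof -
  let ?A = "adjoin_zero X"
  let ?T = "product_topology (\<lambda>_::nat. ?A) UNIV"
  have proj: "continuous_map ?T ?A (\<lambda>x. x n)" for n
    by (intro continuous_map_product_projection UNIV_I)
  \<comment> \<open>\<open>\<beta>\<close> extends \<alpha> by \<open>None\<close>, continuously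
    because D is clopen. Then x_n = \<open>\<beta>\<close>(x_(n+1)) is an equation between
    continuous maps into a Hausdorff space, hence closed.\<close>
  define \<beta> where "\<beta> = case_option None (\<lambda>y. if y \<in> D then Some (\<alpha> y) else None)"
  have "continuous_map X ?A (\<lambda>y. if y \<in> D then Some (\<alpha> y) else None)"
  proof (rule continuous_map_cases_alt)
    have "{x \<in> topspace X. x \<in> D} = D" "{x \<in> topspace X. x \<notin> D} = topspace X - D"
      using dom_subset by auto
    moreover have "closedin X (topspace X - D)"
      using open_dom by (rule closedin_diff[OF closedin_topspace])
    ultimately have cl: "X closure_of {x \<in> topspace X. x \<in> D} = D"
      "X closure_of {x \<in> topspace X. x \<notin> D} = topspace X - D"
      using closed_dom by (simp_all add: closure_of_closedin)
    show "continuous_map (subtopology X (X closure_of {x \<in> topspace X. x \<in> D})) ?A (\<lambda>y. Some (\<alpha> y))"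
      unfolding cl using continuous_map_compose[OF cont continuous_map_Some] by (simp add: o_def)
    show "continuous_map (subtopology X (X closure_of {x \<in> topspace X. x \<notin> D})) ?A (\<lambda>y. None)"
      by (simp add: topspace_adjoin_zero)
    show "Some (\<alpha> x) = None"
      if "x \<in> X frontier_of {x \<in> topspace X. x \<in> D}" for x
    proof -
      have "{x \<in> topspace X. x \<in> D} = D"
        using dom_subset by auto
      then show ?thesis
        using that open_dom closed_dom
        by (simp add: frontier_of_def closure_of_closedin interior_of_openin)
    qed
  qed
  then have "continuous_map ?A ?A \<beta>"
    by (intro continuous_map_from_adjoin_zero) (simp_all add: \<beta>_def topspace_adjoin_zero)
  then have \<beta>: "continuous_map ?T ?A (\<lambda>x. \<beta> (x n))" for n
    using continuous_map_compose[OF proj] by (simp add: o_def)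
  have clopen: "closedin ?T {x \<in> topspace ?T. x n \<in> S}" if "closedin ?A S" for n S
    by (rule closedin_continuous_map_preimage[OF proj that])
  have None: "closedin ?A {None}"
    using closedin_Hausdorff_singleton[OF Hausdorff_space_adjoin_zero[OF Hausdorff]]
    by (simp add: topspace_adjoin_zero)
  have eq: "closedin ?T {x \<in> topspace ?T. x n = \<beta> (x (Suc n))}" for n
    by (rule closedin_continuous_maps_eq[OF Hausdorff_space_adjoin_zero[OF Hausdorff] proj \<beta>])
  have "closedin X (topspace X - \<alpha> ` D)"
    using open_range by (rule closedin_diff[OF closedin_topspace])
  then have nE: "closedin ?A (insert None (Some ` (topspace X - \<alpha> ` D)))"
    using closedin_Un[OF None closedin_adjoin_zero_image] by simp
  \<comment> \<open>The two cases of \<open>orbit_seq\<close> at n, according to whether coordinate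
    n + 1 is a point or \<open>None\<close>; openness of the range makes the second one
    closed.\<close>
  define K where "K n = {x \<in> topspace ?T. x (Suc n) \<in> Some ` D} \<inter> {x \<in> topspace ?T. x n = \<beta> (x (Suc n))}
    \<union> {x \<in> topspace ?T. x (Suc n) \<in> {None}} \<inter> {x \<in> topspace ?T. x n \<in> insert None (Some ` (topspace X - \<alpha> ` D))}" for n
  have "closedin ?T (K n)" for n
    unfolding K_def
    by (intro closedin_Un closedin_Int clopen eq None nE closedin_adjoin_zero_image closed_dom)
  then have "closedin ?T (\<Inter>n. K n)"
    by (intro closedin_Inter) auto
  moreover have "closedin ?T {x \<in> topspace ?T. x 0 \<in> Some ` topspace X}"
    by (intro clopen closedin_adjoin_zero_image closedin_topspace)
  ultimately have closed: "closedin ?T ({x \<in> topspace ?T. x 0 \<in> Some ` topspace X} \<inter> (\<Inter>n. K n))"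
    by (intro closedin_Int)
  have in_T: "x \<in> topspace ?T" if "orbit_seq x" for x
    using that unfolding topspace_ext[symmetric] ext_space_def by simp
  have K_iff: "x \<in> K n \<longleftrightarrow> x \<in> topspace ?T \<and> (\<forall>z. x (Suc n) = Some z \<longrightarrow> z \<in> D \<and> x n = Some (\<alpha> z)) \<and>
    (\<forall>y. x (Suc n) = None \<longrightarrow> x n = Some y \<longrightarrow> y \<notin> \<alpha> ` D)" for x n
  proof (cases "x \<in> topspace ?T")
    case True
    then have "x n \<in> insert None (Some ` topspace X)"
      by (auto simp: topspace_adjoin_zero)
    then show ?thesis
      using True unfolding K_def by (cases "x (Suc n)"; cases "x n") (auto simp: \<beta>_def)
  qed (simp add: K_def)
  have "x \<in> {x \<in> topspace ?T. x 0 \<in> Some ` topspace X} \<inter> (\<Inter>n. K n) \<longleftrightarrow> orbit_seq x" for x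
  proof
    assume "x \<in> {x \<in> topspace ?T. x 0 \<in> Some ` topspace X} \<inter> (\<Inter>n. K n)"
    then have "\<exists>y\<in>topspace X. x 0 = Some y" "\<And>n. x \<in> K n"
      by auto
    then show "orbit_seq x"
      unfolding orbit_seq_def K_iff by blast
  next
    assume x: "orbit_seq x"
    have "x \<in> K n" for n
      unfolding K_iff using in_T[OF x] orbit_seqD2[OF x] orbit_seqD3[OF x] by blast
    then show "x \<in> {x \<in> topspace ?T. x 0 \<in> Some ` topspace X} \<inter> (\<Inter>n. K n)"
      using in_T[OF x] orbit_seqD1[OF x] by blast
  qed
  then have "{x \<in> topspace ?T. x 0 \<in> Some ` topspace X} \<inter> (\<Inter>n. K n) = Collect orbit_seq"
    by blast
  then have "closedin ?T (Collect orbit_seq)"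
    using closed by simp
  moreover have "compact_space ?T"
    by (simp add: compact_space_product_topology compact_space_adjoin_zero compact)
  moreover have "Xe = subtopology ?T (Collect orbit_seq)"
    unfolding ext_space_def using orbit_seq_iff by (intro arg_cong[of _ _ "subtopology ?T"]) auto
  ultimately show ?thesis
    by (simp add: closedin_compact_space compact_space_subtopology)
qed

lemma orbit_seq_prepend:
  assumes x: "orbit_seq x" and "ext_proj x \<in> D"
  shows "orbit_seq (ext_map \<alpha> x)"
proof -
  obtain y where y: "y \<in> topspace X" "x 0 = Some y"
    using orbit_seqD1[OF x] by blast
  then have y': "ext_proj x = y" "y \<in> D"
    using assms(2) by (simp_all add: ext_proj_def)
  show ?thesis
    unfolding orbit_seq_def
  proof (intro conjI allI impI)
    show "\<exists>y\<in>topspace X. ext_map \<alpha> x 0 = Some y"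
      using map_in_topspace y' by (simp add: ext_map_def)
    show "z \<in> D" "ext_map \<alpha> x n = Some (\<alpha> z)" if "ext_map \<alpha> x (Suc n) = Some z" for n z
      using that orbit_seqD2[OF x, of "n - 1" z] y y' by (cases n; simp add: ext_map_def)+
    show "v \<notin> \<alpha> ` D" if "ext_map \<alpha> x (Suc n) = None" "ext_map \<alpha> x n = Some v" for n v
      using that orbit_seqD3[OF x, of "n - 1" v] y by (cases n; simp add: ext_map_def)
  qed
qed

lemma orbit_seq_through_0:
  assumes "y \<in> topspace X"
  shows "\<exists>x. orbit_seq x \<and> x 0 = Some y \<and> (y \<notin> \<alpha> ` D \<longrightarrow> x (Suc 0) = None)"
proof -
  \<comment> \<open>Successively chosen preimages of y. Beyond the first of them outside the range
    the values are arbitrary, and \<open>x\<close> replaces them by \<open>None\<close>.\<close>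
  define q where "q j = (inv_into D \<alpha> ^^ j) y" for j
  define x where "x j = (if \<forall>i<j. q i \<in> \<alpha> ` D then Some (q j) else None)" for j
  have q: "q (Suc j) \<in> D \<and> \<alpha> (q (Suc j)) = q j" if "q j \<in> \<alpha> ` D" for j
    using inv_into_into[OF that] f_inv_into_f[OF that] by (simp add: q_def)
  have "z \<in> D \<and> x n = Some (\<alpha> z)" if "x (Suc n) = Some z" for n z
  proof -
    have *: "\<forall>i<Suc n. q i \<in> \<alpha> ` D" "z = q (Suc n)"
      using that by (simp_all add: x_def split: if_splits)
    then show ?thesis
      using q[of n] by (simp add: x_def)
  qed
  moreover have "v \<notin> \<alpha> ` D" if "x (Suc n) = None" "x n = Some v" for n v
    using that by (auto simp: x_def less_Suc_eq split: if_splits)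
  moreover have "x 0 = Some y"
    by (simp add: x_def q_def)
  moreover have "x (Suc 0) = None" if "y \<notin> \<alpha> ` D"
  proof -
    have "q 0 \<notin> \<alpha> ` D"
      using that by (simp add: q_def)
    then show ?thesis
      unfolding x_def using zero_less_Suc by metis
  qed
  ultimately show ?thesis
    unfolding orbit_seq_def using assms by blast
qed

text \<open>A backward orbit of y is chosen once; prepending forward images then moves y to
  coordinate k. Hence coordinate k takes every value in \<open>\<Delta> k\<close>, and no
  coefficient is invisible in a bracket.\<close>

lemma orbit_seq_through:
  "y \<in> \<Delta> k \<Longrightarrow> \<exists>x. orbit_seq x \<and> x k = Some y \<and> (y \<notin> \<alpha> ` D \<longrightarrow> x (Suc k) = None)"
proof (induction k)
  case 0
  then show ?case using orbit_seq_through_0 by simp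
next
  case (Suc k)
  then obtain x where x: "orbit_seq x" "x k = Some y" "y \<notin> \<alpha> ` D \<longrightarrow> x (Suc k) = None"
    using dom_iter_Suc_subset by blast
  then have "orbit_seq (ext_map \<alpha> x)"
    using orbit_seq_in_dom[OF x(1,2)] Suc.prems by (intro orbit_seq_prepend) auto
  then show ?case
    using x by (intro exI[of _ "ext_map \<alpha> x"]) (simp add: ext_map_def)
qed

end

subsection \<open>Brackets\<close>

context clopen_partial_map
begin

abbreviation "C n \<equiv> cfun_on (\<Delta> n) X"

text \<open>The bracket with the single entry c in place n. It is defined for any c, so that it
  makes sense before c is cut down to \<open>\<Delta> n\<close>.\<close>

definition coord :: "nat \<Rightarrow> ('a \<Rightarrow> complex) \<Rightarrow> (nat \<Rightarrow> 'a option) \<Rightarrow> complex" where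
  "coord n c x = (if orbit_seq x then case_option 0 c (x n) else 0)"

lemma coord_simps [simp]:
  "\<not> orbit_seq x \<Longrightarrow> coord n c x = 0"
  "x n = None \<Longrightarrow> coord n c x = 0"
  "orbit_seq x \<Longrightarrow> x n = Some y \<Longrightarrow> coord n c x = c y"
  by (simp_all add: coord_def)

lemma coord_0_eq: "orbit_seq x \<Longrightarrow> coord 0 c x = c (ext_proj x)"
  using orbit_seqD1[of x] by (auto simp: ext_proj_def)

lemma ext_bracket_eq: "ext_bracket X D \<alpha> N a = (\<lambda>x. \<Sum>n\<le>N. coord n (a n) x)"
  by (rule ext) (simp add: ext_bracket_def coord_def topspace_ext)

lemma coord_add: "coord n (\<lambda>y. c y + d y) x = coord n c x + coord n d x"
  by (simp add: coord_def split: option.split)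

lemma coord_mult: "coord n (\<lambda>y. c y * d y) x = coord n c x * coord n d x"
  by (simp add: coord_def split: option.split)

lemma coord_compose: "\<phi> 0 = 0 \<Longrightarrow> coord n (\<lambda>y. \<phi> (c y)) x = \<phi> (coord n c x)"
  by (simp add: coord_def split: option.split)

lemma coord_zero [simp]: "coord n (\<lambda>_. 0) x = 0"
  by (simp add: coord_def split: option.split)

lemma coord_cfun:
  assumes "c \<in> cfun X"
  shows "coord n c \<in> cfun Xe"
proof (rule cfunI)
  have "continuous_map (adjoin_zero X) euclidean (case_option 0 c)"
    using cfun_continuous_map[OF assms] by (intro continuous_map_from_adjoin_zero) simp_all
  from continuous_map_compose[OF continuous_map_ext_coordinate this, of n]
  show "continuous_map Xe euclidean (coord n c)"
    by (rule continuous_map_eq) (simp add: coord_def topspace_ext)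
  show "coord n c x = 0" if "x \<notin> topspace Xe" for x
    using that by (simp add: topspace_ext)
qed

lemma coord_eq_0_of_Suc:
  assumes "\<And>y. y \<in> \<alpha> ` D \<Longrightarrow> c y = 0" and "x (Suc n) \<noteq> None"
  shows "coord n c x = 0"
proof (cases "orbit_seq x")
  case True
  then obtain z where "z \<in> D" "x n = Some (\<alpha> z)"
    using assms(2) orbit_seqD2[of x n] by auto
  then show ?thesis
    using assms(1) True by simp
qed simp

section \<open>Reduced brackets\<close>

definition reduced :: "nat \<Rightarrow> (nat \<Rightarrow> 'a \<Rightarrow> complex) \<Rightarrow> bool" where
  "reduced N a \<longleftrightarrow> (\<forall>n\<le>N. a n \<in> C n) \<and> (\<forall>n<N. \<forall>y\<in>\<alpha> ` D. a n y = 0)"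

lemma reducedD:
  assumes "reduced N a"
  shows "n \<le> N \<Longrightarrow> a n \<in> C n" and "n < N \<Longrightarrow> y \<in> \<alpha> ` D \<Longrightarrow> a n y = 0"
  using assms by (auto simp: reduced_def)

lemma reduced_compose:
  "reduced N a \<Longrightarrow> continuous_on UNIV \<phi> \<Longrightarrow> \<phi> 0 = 0 \<Longrightarrow> reduced N (\<lambda>n y. \<phi> (a n y))"
  by (auto simp: reduced_def intro: cfun_on_compose)

lemma reduced_add: "reduced N a \<Longrightarrow> reduced N b \<Longrightarrow> reduced N (\<lambda>n y. a n y + b n y)"
  by (auto simp: reduced_def cfun_on_def intro: cfun_add)

lemma reduced_mult: "reduced N a \<Longrightarrow> reduced N b \<Longrightarrow> reduced N (\<lambda>n y. a n y * b n y)"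
  by (auto simp: reduced_def cfun_on_def intro: cfun_mult)

text \<open>For n < m: if coordinate n + 1 of x is \<open>None\<close>, so is coordinate m;
  otherwise coordinate n lies in the range, where the coefficient vanishes.\<close>

lemma reduced_coord_disjoint:
  assumes "reduced N a" "reduced N b" "n \<le> N" "m \<le> N" "n \<noteq> m"
  shows "coord n (a n) x = 0 \<or> coord m (b m) x = 0"
proof (cases "orbit_seq x")
  case True
  have *: "coord n (a n) x = 0 \<or> coord m (b m) x = 0"
    if "reduced N a" "n < m" "m \<le> N" for n m and a b :: "nat \<Rightarrow> 'a \<Rightarrow> complex"
  proof (cases "x (Suc n) = None")
    case True
    then show ?thesis
      using orbit_seq_None_mono[OF \<open>orbit_seq x\<close>, of "Suc n" m] that by simp
  next
    case False
    then show ?thesis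
      using coord_eq_0_of_Suc[of "a n"] reducedD(2)[OF that(1), of n] that by simp
  qed
  show ?thesis
    using *[of a n m b] *[of b m n a] assms by (cases "n < m") auto
qed simp

lemma reduced_ext_bracket_mult:
  assumes "reduced N a" "reduced N b"
  shows "ext_bracket X D \<alpha> N a x * ext_bracket X D \<alpha> N b x = ext_bracket X D \<alpha> N (\<lambda>n y. a n y * b n y) x"
proof -
  have "ext_bracket X D \<alpha> N a x * ext_bracket X D \<alpha> N b x = (\<Sum>n\<le>N. \<Sum>m\<le>N. coord n (a n) x * coord m (b m) x)"
    by (simp add: ext_bracket_eq sum_product)
  also have "\<dots> = (\<Sum>n\<le>N. \<Sum>m\<le>N. if m = n then coord n (a n) x * coord n (b n) x else 0)"
    using reduced_coord_disjoint[OF assms] by (intro sum.cong refl) force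
  also have "\<dots> = ext_bracket X D \<alpha> N (\<lambda>n y. a n y * b n y) x"
    by (simp add: ext_bracket_eq coord_mult)
  finally show ?thesis .
qed

text \<open>With at most one nonzero term, \<open>\<phi>\<close> passes through the sum although it
  is not additive; \<open>\<phi> 0 = 0\<close> takes care of the remaining terms.\<close>

lemma reduced_ext_bracket_compose:
  fixes \<phi> :: "complex \<Rightarrow> complex"
  assumes "reduced N a" and \<phi>: "\<phi> 0 = 0"
  shows "\<phi> (ext_bracket X D \<alpha> N a x) = ext_bracket X D \<alpha> N (\<lambda>n y. \<phi> (a n y)) x"
proof (cases "\<exists>k\<le>N. coord k (a k) x \<noteq> 0")
  case True
  then obtain k where k: "k \<le> N" "coord k (a k) x \<noteq> 0"
    by blast
  have *: "coord n (a n) x = (if n = k then coord k (a k) x else 0)" if "n \<le> N" for n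
    using reduced_coord_disjoint[OF assms(1,1) that k(1)] k(2) by auto
  have "(\<Sum>n\<le>N. coord n (a n) x) = (\<Sum>n\<le>N. if n = k then coord k (a k) x else 0)"
    by (intro sum.cong refl *) simp
  moreover have "(\<Sum>n\<le>N. \<phi> (coord n (a n) x)) = (\<Sum>n\<le>N. if n = k then \<phi> (coord k (a k) x) else 0)"
    using * \<phi> by (intro sum.cong refl) (metis atMost_iff)
  ultimately have "(\<Sum>n\<le>N. coord n (a n) x) = coord k (a k) x"
    "(\<Sum>n\<le>N. \<phi> (coord n (a n) x)) = \<phi> (coord k (a k) x)"
    using k(1) by simp_all
  then show ?thesis
    by (simp add: ext_bracket_eq coord_compose[of \<phi>, OF \<phi>])
next
  case False
  then show ?thesis
    using \<phi> by (simp add: ext_bracket_eq coord_compose[of \<phi>, OF \<phi>])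
qed

text \<open>A point where \<open>a k\<close> is nonzero is coordinate k of some orbit, and there the
  other terms vanish by disjointness. Without reduction the coefficients are in general not
  determined by the function.\<close>

lemma reduced_ext_bracket_eq_0:
  assumes a: "reduced N a" and zero: "\<And>x. ext_bracket X D \<alpha> N a x = 0" and k: "k \<le> N"
  shows "a k = (\<lambda>_. 0)"
proof
  fix y
  show "a k y = 0"
  proof (rule ccontr)
    assume y: "a k y \<noteq> 0"
    then have "y \<in> \<Delta> k"
      using cfun_onD2[OF reducedD(1)[OF a k]] by blast
    then obtain x where x: "orbit_seq x" "x k = Some y"
      using orbit_seq_through by blast
    then have *: "coord k (a k) x \<noteq> 0"
      using y by simp
    have "coord n (a n) x = (if n = k then coord k (a k) x else 0)" if "n \<le> N" for n
      using reduced_coord_disjoint[OF a a that k] * by auto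
    then have "(\<Sum>n\<le>N. coord n (a n) x) = (\<Sum>n\<le>N. if n = k then coord k (a k) x else 0)"
      by (intro sum.cong refl) simp
    then have "ext_bracket X D \<alpha> N a x = coord k (a k) x"
      using k by (simp add: ext_bracket_eq)
    then show False
      using zero * by simp
  qed
qed

text \<open>If coordinate n is the last point of x, it lies off the range and only the first summand
  counts; if a point z follows, it equals \<alpha>(z) and only the second counts.\<close>

lemma ext_coord_shift:
  assumes c: "c \<in> cfun X"
  shows "coord n c x = coord n (\<lambda>y. if y \<in> topspace X - \<alpha> ` D then c y else 0) x
    + coord (Suc n) (\<delta> (\<lambda>y. if y \<in> \<alpha> ` D then c y else 0)) x"
proof (cases "orbit_seq x \<and> x n \<noteq> None")
  case True
  then obtain y where x: "orbit_seq x" and y: "x n = Some y"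
    by auto
  then have yX: "y \<in> topspace X"
    using orbit_seq_dom_iter[OF x y] dom_iter_subset_topspace by blast
  show ?thesis
  proof (cases "x (Suc n)")
    case None
    then show ?thesis
      using orbit_seqD3[OF x None y] x y yX by simp
  next
    case (Some z)
    then show ?thesis
      using orbit_seqD2[OF x Some] x y by (simp add: comp_endo_def)
  qed
next
  case False
  show ?thesis
  proof (cases "orbit_seq x")
    case True
    then have "x n = None" "x (Suc n) = None"
      using False orbit_seq_None_mono[of x n "Suc n"] by auto
    then show ?thesis by simp
  qed simp
qed

section \<open>The two endomorphisms on single terms\<close>

lemma inj_ext_map: "inj (ext_map \<alpha>)"
proof (rule injI, rule ext)
  fix x y n assume "ext_map \<alpha> x = ext_map \<alpha> y"
  then have "ext_map \<alpha> x (Suc n) = ext_map \<alpha> y (Suc n)"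
    by simp
  then show "x n = y n"
    by (simp add: ext_map_def)
qed

lemma mem_ext_preimage: "x \<in> ext_preimage X D \<alpha> S \<longleftrightarrow> orbit_seq x \<and> ext_proj x \<in> S"
  by (simp add: ext_preimage_def topspace_ext)

lemma ext_endo_coord_0:
  assumes "c \<in> cfun X"
  shows "ext_endo X D \<alpha> (coord 0 c) = coord 0 (\<delta> c)"
proof
  fix x
  show "ext_endo X D \<alpha> (coord 0 c) x = coord 0 (\<delta> c) x"
  proof (cases "orbit_seq x")
    case True
    have "coord 0 c (ext_map \<alpha> x) = c (\<alpha> (ext_proj x))" if "ext_proj x \<in> D"
      using orbit_seq_prepend[OF True that] by (simp add: ext_map_def)
    then show ?thesis
      using True by (simp add: ext_endo_def comp_endo_def mem_ext_preimage coord_0_eq)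
  qed (simp add: ext_endo_def comp_endo_def mem_ext_preimage)
qed

text \<open>\<open>ext_map\<close> moves coordinate n to n + 1. Where x_0 is outside D the left side
  is 0 by definition, and the right side because coordinate n is then outside
  \<open>\<Delta> (Suc n)\<close>, the support of c.\<close>

lemma ext_endo_coord_Suc:
  assumes c: "c \<in> C (Suc n)"
  shows "ext_endo X D \<alpha> (coord (Suc n) c) = coord n c"
proof
  fix x
  show "ext_endo X D \<alpha> (coord (Suc n) c) x = coord n c x"
  proof (cases "orbit_seq x")
    case x: True
    show ?thesis
    proof (cases "ext_proj x \<in> D")
      case True
      then show ?thesis
        using orbit_seq_prepend[OF x True] x
        by (simp add: ext_endo_def comp_endo_def mem_ext_preimage) (simp add: coord_def ext_map_def)
    next
      case False
      then have "coord n c x = 0"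
        using orbit_seq_in_dom[OF x, of n] cfun_onD2[OF c] x
        by (cases "x n") (simp_all del: dom_iter.simps)
      then show ?thesis
        using False by (simp add: ext_endo_def comp_endo_def mem_ext_preimage)
    qed
  qed (simp add: ext_endo_def comp_endo_def mem_ext_preimage)
qed

text \<open>The inverse map deletes coordinate 0, so coordinate n of the result is coordinate n + 1
  of x. The indicator makes the coefficient admissible and changes no value, since that coordinate
  lies in \<open>\<Delta> (Suc n)\<close> anyway.\<close>

lemma ext_endo_inv_coord:
  "ext_endo_inv X D \<alpha> (coord n c) = coord (Suc n) (\<lambda>y. of_bool (y \<in> \<Delta> (Suc n)) * c y)"
proof
  fix x
  let ?r = "coord (Suc n) (\<lambda>y. of_bool (y \<in> \<Delta> (Suc n)) * c y) x"
  have r: "?r = (if orbit_seq x then case_option 0 c (x (Suc n)) else 0)"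
    using orbit_seq_dom_iter[of x "Suc n"]
    by (cases "x (Suc n)") (auto simp: coord_def simp del: dom_iter.simps)
  show "ext_endo_inv X D \<alpha> (coord n c) x = ?r"
  proof (cases "orbit_seq x \<and> ext_proj x \<in> \<alpha> ` D")
    case True
    then have x: "orbit_seq x" and E: "ext_proj x \<in> \<alpha> ` D"
      by auto
    obtain y where y: "x 0 = Some y"
      using orbit_seqD1[OF x] by blast
    then have "x (Suc 0) \<noteq> None"
      using orbit_seqD3[OF x, of 0 y] E by (auto simp: ext_proj_def)
    then obtain z where z: "x (Suc 0) = Some z" "z \<in> D" "y = \<alpha> z"
      using orbit_seqD2[OF x, of 0] y by auto
    define t where "t n = x (Suc n)" for n
    have t: "orbit_seq t"
      unfolding orbit_seq_def t_def
      using z orbit_seqD2[OF x] orbit_seqD3[OF x] dom_subset by blast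
    have "ext_map \<alpha> t = x"
    proof
      show "ext_map \<alpha> t k = x k" for k
        using y z by (cases k) (simp_all add: ext_map_def t_def ext_proj_def)
    qed
    moreover have "t \<in> ext_preimage X D \<alpha> D"
      using t z by (simp add: mem_ext_preimage ext_proj_def t_def)
    ultimately have "inv_into (ext_preimage X D \<alpha> D) (ext_map \<alpha>) x = t"
      using inv_into_f_f[OF inj_on_subset[OF inj_ext_map subset_UNIV]] by metis
    then show ?thesis
      unfolding r using True t by (simp add: ext_endo_inv_def comp_endo_def mem_ext_preimage)
        (simp add: coord_def t_def)
  next
    case False
    \<comment> \<open>Off the preimage of the range the orbit stops at once, so the right side
      vanishes like the left.\<close>
    have "x (Suc n) = None" if x: "orbit_seq x"
    proof -
      have "x (Suc 0) = None"
        using orbit_seqD2[OF x, of 0] False x by (cases "x (Suc 0)") (auto simp: ext_proj_def)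
      then show ?thesis
        using orbit_seq_None_mono[OF x, of "Suc 0" "Suc n"] by simp
    qed
    then show ?thesis
      unfolding r using False by (auto simp: ext_endo_inv_def comp_endo_def mem_ext_preimage)
  qed
qed

end

section \<open>The relation between brackets and operators\<close>

context covariant_rep
begin

definition bracket_graph :: "((nat \<Rightarrow> 'a option) \<Rightarrow> complex) \<Rightarrow> ('h \<Rightarrow>\<^sub>L 'h) \<Rightarrow> bool" where
  "bracket_graph f T \<longleftrightarrow>
    (\<exists>N a. (\<forall>n\<le>N. a n \<in> C n) \<and> f = ext_bracket X D \<alpha> N a \<and> T = (\<Sum>n\<le>N. compress n (a n)))"

lemma reduce_bracket:
  assumes "\<And>n. n \<le> N \<Longrightarrow> a n \<in> C n"
  shows "\<exists>b. reduced N b \<and> ext_bracket X D \<alpha> N b = ext_bracket X D \<alpha> N a \<and>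
    (\<Sum>n\<le>N. compress n (b n)) = (\<Sum>n\<le>N. compress n (a n))"
  using assms
proof (induction N)
  case 0
  then show ?case by (intro exI[of _ a]) (simp add: reduced_def)
next
  case (Suc N)
  then obtain b where b: "reduced N b" "ext_bracket X D \<alpha> N b = ext_bracket X D \<alpha> N a"
    "(\<Sum>n\<le>N. compress n (b n)) = (\<Sum>n\<le>N. compress n (a n))"
    by fastforce
  have bN: "b N \<in> C N"
    using reducedD(1)[OF b(1)] by simp
  have bX: "b N \<in> cfun X"
    using bN by (rule cfun_onD1)
  \<comment> \<open>The last coefficient of the shorter reduced bracket may be nonzero on the range,
    but at length \<open>Suc N\<close> it is no longer the last. Its part v on the range moves up as
    \<open>\<delta> v\<close>, which changes neither the function, by
    \<open>ext_coord_shift\<close>, nor the operator, by \<open>compress_shift\<close>.\<close>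
  define u where "u = (\<lambda>y. if y \<in> topspace X - \<alpha> ` D then b N y else 0)"
  define v where "v = (\<lambda>y. if y \<in> \<alpha> ` D then b N y else 0)"
  have uX: "u \<in> cfun X"
    unfolding u_def
    by (intro cfun_restrict[OF bX] openin_diff closedin_diff openin_topspace closedin_topspace
        open_range closed_range)
  have vX: "v \<in> cfun X"
    unfolding v_def by (rule cfun_restrict[OF bX open_range closed_range])
  have u: "u \<in> C N" and v: "v \<in> C N" and vE: "v \<in> cfun_on (\<alpha> ` D) X"
    using uX vX bN by (auto simp: cfun_on_def u_def v_def)
  have \<delta>v: "\<delta> v \<in> C (Suc N)"
    by (rule endo_cfun_on[OF v])
  have a: "a (Suc N) \<in> C (Suc N)"
    by (rule Suc.prems) simp
  have aX: "a (Suc N) \<in> cfun X" "\<delta> v \<in> cfun X"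
    using cfun_onD1[OF a] cfun_onD1[OF \<delta>v] .
  define b' where "b' = b(N := u, Suc N := \<lambda>y. a (Suc N) y + \<delta> v y)"
  have b': "b' N = u" "b' (Suc N) = (\<lambda>y. a (Suc N) y + \<delta> v y)" "\<And>n. n < N \<Longrightarrow> b' n = b n"
    by (simp_all add: b'_def)
  have "b' (Suc N) \<in> C (Suc N)"
    using a \<delta>v aX by (simp add: b' cfun_on_def cfun_add del: dom_iter.simps)
  then have "b' n \<in> C n" if "n \<le> Suc N" for n
    using that u reducedD(1)[OF b(1), of n] b'
    by (cases "n < N"; cases "n = N") (auto simp: le_Suc_eq simp del: dom_iter.simps)
  moreover have "b' n y = 0" if "n < Suc N" "y \<in> \<alpha> ` D" for n y
    using that reducedD(2)[OF b(1), of n y] b' by (cases "n = N") (auto simp: u_def)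
  ultimately have "reduced (Suc N) b'"
    by (simp add: reduced_def del: dom_iter.simps)
  moreover have "ext_bracket X D \<alpha> (Suc N) b' x = ext_bracket X D \<alpha> (Suc N) a x" for x
  proof -
    have "coord N u x + coord (Suc N) (\<delta> v) x = coord N (b N) x"
      unfolding u_def v_def by (rule ext_coord_shift[OF bX, symmetric])
    then have "(\<Sum>n\<le>Suc N. coord n (b' n) x) = (\<Sum>n<N. coord n (b n) x) + coord N (b N) x + coord (Suc N) (a (Suc N)) x"
      by (simp add: b' coord_add flip: lessThan_Suc_atMost)
    also have "\<dots> = (\<Sum>n\<le>N. coord n (b n) x) + coord (Suc N) (a (Suc N)) x"
      by (simp flip: lessThan_Suc_atMost)
    also have "\<dots> = (\<Sum>n\<le>Suc N. coord n (a n) x)"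
      using fun_cong[OF b(2), of x] by (simp add: ext_bracket_eq)
    finally show ?thesis
      by (simp only: ext_bracket_eq)
  qed
  moreover have "(\<Sum>n\<le>Suc N. compress n (b' n)) = (\<Sum>n\<le>Suc N. compress n (a n))"
  proof -
    have "b N = (\<lambda>y. u y + v y)"
      using cfun_eq_0[OF bX] by (auto simp: u_def v_def fun_eq_iff)
    then have "compress N u + compress (Suc N) (\<delta> v) = compress N (b N)"
      using compress_add[OF uX vX] compress_shift[OF vE, of N] by simp
    then have "(\<Sum>n\<le>Suc N. compress n (b' n)) = (\<Sum>n<N. compress n (b n)) + compress N (b N) + compress (Suc N) (a (Suc N))"
      by (simp add: b' compress_add[OF aX] flip: lessThan_Suc_atMost)
    also have "\<dots> = (\<Sum>n\<le>N. compress n (b n)) + compress (Suc N) (a (Suc N))"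
      by (simp flip: lessThan_Suc_atMost)
    finally show ?thesis
      using b(3) by simp
  qed
  ultimately show ?case
    by blast
qed

text \<open>Padding with zero coefficients before reducing allows any greater length, so that two
  brackets get reduced forms of equal length.\<close>

lemma bracket_graph_reduced:
  assumes "\<And>n. n \<le> N \<Longrightarrow> a n \<in> C n" and "N \<le> M"
  shows "\<exists>b. reduced M b \<and> ext_bracket X D \<alpha> M b = ext_bracket X D \<alpha> N a \<and>
    (\<Sum>n\<le>M. compress n (b n)) = (\<Sum>n\<le>N. compress n (a n))"
proof -
  define a' where "a' n = (if n \<le> N then a n else (\<lambda>_. 0))" for n
  have "a' n \<in> C n" for n
    using assms(1) cfun_zero by (auto simp: a'_def cfun_on_def)
  then obtain b where b: "reduced M b" "ext_bracket X D \<alpha> M b = ext_bracket X D \<alpha> M a'"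
    "(\<Sum>n\<le>M. compress n (b n)) = (\<Sum>n\<le>M. compress n (a' n))"
    using reduce_bracket[of M a'] by blast
  have "(\<Sum>n\<le>M. compress n (a' n)) = (\<Sum>n\<le>N. compress n (a n))"
    using assms(2) by (intro sum.mono_neutral_cong_right) (auto simp: a'_def compress_zero)
  moreover have "(\<Sum>n\<le>M. coord n (a' n) x) = (\<Sum>n\<le>N. coord n (a n) x)" for x
    using assms(2) by (intro sum.mono_neutral_cong_right) (auto simp: a'_def)
  ultimately show ?thesis
    using b by (intro exI[of _ b]) (simp add: ext_bracket_eq)
qed

lemma bracket_graphI:
  "reduced N a \<Longrightarrow> f = ext_bracket X D \<alpha> N a \<Longrightarrow> T = (\<Sum>n\<le>N. compress n (a n)) \<Longrightarrow> bracket_graph f T"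
  unfolding bracket_graph_def reduced_def by blast

lemma bracket_graphE2:
  assumes "bracket_graph f S" and "bracket_graph g T"
  obtains N a b where "reduced N a" "f = ext_bracket X D \<alpha> N a" "S = (\<Sum>n\<le>N. compress n (a n))"
    "reduced N b" "g = ext_bracket X D \<alpha> N b" "T = (\<Sum>n\<le>N. compress n (b n))"
proof -
  obtain N a M b where a: "\<And>n. n \<le> N \<Longrightarrow> a n \<in> C n" "f = ext_bracket X D \<alpha> N a" "S = (\<Sum>n\<le>N. compress n (a n))"
    and b: "\<And>n. n \<le> M \<Longrightarrow> b n \<in> C n" "g = ext_bracket X D \<alpha> M b" "T = (\<Sum>n\<le>M. compress n (b n))"
    using assms unfolding bracket_graph_def by blast
  obtain a' where a': "reduced (max N M) a'" "ext_bracket X D \<alpha> (max N M) a' = f"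
    "(\<Sum>n\<le>max N M. compress n (a' n)) = S"
    using bracket_graph_reduced[OF a(1) max.cobounded1[of N M]] unfolding a(2)[symmetric] a(3)[symmetric]
    by blast
  obtain b' where b': "reduced (max N M) b'" "ext_bracket X D \<alpha> (max N M) b' = g"
    "(\<Sum>n\<le>max N M. compress n (b' n)) = T"
    using bracket_graph_reduced[OF b(1) max.cobounded2[of M N]] unfolding b(2)[symmetric] b(3)[symmetric]
    by blast
  show thesis
    by (rule that[OF a'(1) a'(2,3)[symmetric] b'(1) b'(2,3)[symmetric]])
qed

lemma bracket_graphE:
  assumes "bracket_graph f S"
  obtains N a where "reduced N a" "f = ext_bracket X D \<alpha> N a" "S = (\<Sum>n\<le>N. compress n (a n))"
  using bracket_graphE2[OF assms assms] by metis

lemma reduced_compress_orthogonal: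
  assumes "reduced N a" "reduced N b" "n \<le> N" "m \<le> N" "n \<noteq> m"
  shows "compress n (a n) (compress m (b m) x) = 0"
proof (cases "n < m")
  case True
  then show ?thesis
    using assms reducedD[OF assms(1), of n] reducedD(1)[OF assms(2), of m]
    by (intro compress_orthogonal_left) (auto simp: cfun_onD1)
next
  case False
  then show ?thesis
    using assms reducedD[OF assms(2), of m] reducedD(1)[OF assms(1), of n]
    by (intro compress_orthogonal_right) (auto simp: cfun_onD1)
qed

lemma reduced_compress_mult:
  assumes "reduced N a" "reduced N b"
  shows "(\<Sum>n\<le>N. compress n (a n)) o\<^sub>L (\<Sum>n\<le>N. compress n (b n))
    = (\<Sum>n\<le>N. compress n (\<lambda>y. a n y * b n y))"
proof (rule blinfun_eqI)
  fix x
  have "((\<Sum>n\<le>N. compress n (a n)) o\<^sub>L (\<Sum>n\<le>N. compress n (b n))) x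
    = (\<Sum>n\<le>N. \<Sum>m\<le>N. compress n (a n) (compress m (b m) x))"
    by (simp add: blinfun.sum_left blinfun.sum_right) (rule sum.swap)
  also have "\<dots> = (\<Sum>n\<le>N. \<Sum>m\<le>N. if m = n then compress n (\<lambda>y. a n y * b n y) x else 0)"
    using reduced_compress_orthogonal[OF assms]
      compress_mult[OF cfun_onD1[OF reducedD(1)[OF assms(1)]] reducedD(1)[OF assms(2)]]
    by (intro sum.cong refl) auto
  also have "\<dots> = (\<Sum>n\<le>N. compress n (\<lambda>y. a n y * b n y)) x"
    by (simp add: blinfun.sum_left)
  finally show "((\<Sum>n\<le>N. compress n (a n)) o\<^sub>L (\<Sum>n\<le>N. compress n (b n))) x
    = (\<Sum>n\<le>N. compress n (\<lambda>y. a n y * b n y)) x" .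
qed

lemma bracket_graph_coord:
  assumes "c \<in> C n"
  shows "bracket_graph (coord n c) (compress n c)"
proof -
  define a where "a m = (if m = n then c else (\<lambda>_. 0))" for m
  have "a m \<in> C m" for m
    using assms cfun_zero by (auto simp: a_def cfun_on_def)
  moreover have "coord n c = ext_bracket X D \<alpha> n a"
  proof
    fix x
    have "(\<Sum>m\<le>n. coord m (a m) x) = (\<Sum>m\<le>n. if m = n then coord n c x else 0)"
      by (intro sum.cong refl) (simp add: a_def)
    then show "coord n c x = ext_bracket X D \<alpha> n a x"
      by (simp add: ext_bracket_eq)
  qed
  moreover have "(\<Sum>m\<le>n. compress m (a m)) = (\<Sum>m\<le>n. if m = n then compress n c else 0)"
    by (intro sum.cong refl) (simp add: a_def compress_zero)
  then have "compress n c = (\<Sum>m\<le>n. compress m (a m))"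
    by simp
  ultimately show ?thesis
    unfolding bracket_graph_def by blast
qed

lemma bracket_graph_add:
  assumes "bracket_graph f S" "bracket_graph g T"
  shows "bracket_graph (\<lambda>x. f x + g x) (S + T)"
proof -
  obtain N a b where *: "reduced N a" "f = ext_bracket X D \<alpha> N a" "S = (\<Sum>n\<le>N. compress n (a n))"
    "reduced N b" "g = ext_bracket X D \<alpha> N b" "T = (\<Sum>n\<le>N. compress n (b n))"
    by (rule bracket_graphE2[OF assms])
  have "compress n (\<lambda>y. a n y + b n y) = compress n (a n) + compress n (b n)" if "n \<le> N" for n
    using reducedD(1)[OF *(1) that] reducedD(1)[OF *(4) that] by (intro compress_add cfun_onD1)
  then show ?thesis
    using * by (intro bracket_graphI[OF reduced_add[OF *(1,4)]])
      (simp_all add: ext_bracket_eq coord_add sum.distrib)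
qed

lemma bracket_graph_zero: "bracket_graph (\<lambda>_. 0) 0"
proof -
  have "(\<lambda>_. 0) \<in> C 0"
    using cfun_zero by (simp add: cfun_on_def)
  moreover have "coord 0 (\<lambda>_. 0) = (\<lambda>_. 0)"
    by auto
  ultimately show ?thesis
    using bracket_graph_coord[of "\<lambda>_. 0" 0] compress_zero[of 0] by simp
qed

text \<open>Serves the additive statements, which can be checked on single terms; products and
  functional calculus go through the reduced form instead.\<close>

lemma bracket_graph_induct [consumes 1, case_names coord zero add]:
  assumes "bracket_graph f T"
    and coord: "\<And>n c. c \<in> C n \<Longrightarrow> P (coord n c) (compress n c)"
    and zero: "P (\<lambda>_. 0) 0"
    and add: "\<And>f S g T. P f S \<Longrightarrow> P g T \<Longrightarrow> P (\<lambda>x. f x + g x) (S + T)"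
  shows "P f T"
proof -
  obtain N a where a: "\<And>n. n \<le> N \<Longrightarrow> a n \<in> C n" and f: "f = ext_bracket X D \<alpha> N a"
    and T: "T = (\<Sum>n\<le>N. compress n (a n))"
    using assms(1) unfolding bracket_graph_def by blast
  have "P (\<lambda>x. \<Sum>n\<in>I. coord n (a n) x) (\<Sum>n\<in>I. compress n (a n))" if "finite I" "I \<subseteq> {..N}" for I
    using that
  proof (induction I rule: finite_induct)
    case empty
    then show ?case using zero by simp
  next
    case (insert n I)
    then have "P (coord n (a n)) (compress n (a n))"
      by (intro coord a) simp
    then have "P (\<lambda>x. coord n (a n) x + (\<Sum>n\<in>I. coord n (a n) x)) (compress n (a n) + (\<Sum>n\<in>I. compress n (a n)))"
      by (rule add) (use insert in simp)
    then show ?case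
      using insert.hyps by simp
  qed
  from this[of "{..N}"] show ?thesis
    by (simp add: f T ext_bracket_eq)
qed

end

subsection \<open>The representation of the coefficient algebra\<close>

context covariant_rep
begin

lemma bracket_graph_cfun: "bracket_graph f T \<Longrightarrow> f \<in> cfun Xe"
  by (induction rule: bracket_graph_induct) (auto intro: coord_cfun cfun_zero cfun_add dest: cfun_onD1)

lemma bracket_graph_ops: "bracket_graph f T \<Longrightarrow> T \<in> bounded_ops"
  by (induction rule: bracket_graph_induct) (auto intro: compress_ops bounded_ops_add dest: cfun_onD1)

text \<open>Scaling, conjugation and the functional calculus of the locale are all
  instances.\<close>

lemma bracket_graph_compose:
  assumes "reduced N a" and "continuous_on UNIV \<phi>" and "\<phi> 0 = 0"
  shows "bracket_graph (\<lambda>x. \<phi> (ext_bracket X D \<alpha> N a x)) (\<Sum>n\<le>N. compress n (\<lambda>y. \<phi> (a n y)))"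
  by (rule bracket_graphI[OF reduced_compose[OF assms]])
    (simp_all add: reduced_ext_bracket_compose[of N a \<phi>, OF assms(1,3)])

lemma bracket_graph_scale:
  assumes "bracket_graph f T"
  shows "bracket_graph (\<lambda>x. c * f x) (cscale_op c T)"
proof -
  obtain N a where a: "reduced N a" "f = ext_bracket X D \<alpha> N a" "T = (\<Sum>n\<le>N. compress n (a n))"
    by (rule bracket_graphE[OF assms])
  have "compress n (\<lambda>y. c * a n y) = cscale_op c (compress n (a n))" if "n \<le> N" for n
    using reducedD(1)[OF a(1) that] by (intro compress_scale cfun_onD1)
  then have "(\<Sum>n\<le>N. compress n (\<lambda>y. c * a n y)) = cscale_op c T"
    by (simp add: a(3) cscale_op_sum)
  moreover have "continuous_on UNIV (\<lambda>z. c * z)"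
    by (intro continuous_intros)
  ultimately show ?thesis
    using bracket_graph_compose[OF a(1), of "\<lambda>z. c * z"] a(2) by simp
qed

lemma bracket_graph_cnj:
  assumes "bracket_graph f T"
  shows "bracket_graph (\<lambda>x. cnj (f x)) (adj T)"
proof -
  obtain N a where a: "reduced N a" "f = ext_bracket X D \<alpha> N a" "T = (\<Sum>n\<le>N. compress n (a n))"
    by (rule bracket_graphE[OF assms])
  have aX: "a n \<in> cfun X" if "n \<le> N" for n
    using reducedD(1)[OF a(1) that] by (rule cfun_onD1)
  then have "(\<Sum>n\<le>N. compress n (\<lambda>y. cnj (a n y))) = (\<Sum>n\<le>N. adj (compress n (a n)))"
    by (intro sum.cong refl) (simp add: compress_cnj)
  also have "\<dots> = adj T"
    unfolding a(3) using aX by (intro adj_sum[symmetric] compress_ops) simp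
  finally show ?thesis
    using bracket_graph_compose[OF a(1), of cnj] a(2) by (simp add: continuous_on_cnj)
qed

lemma bracket_graph_mult:
  assumes "bracket_graph f S" "bracket_graph g T"
  shows "bracket_graph (\<lambda>x. f x * g x) (S o\<^sub>L T)"
proof -
  obtain N a b where *: "reduced N a" "f = ext_bracket X D \<alpha> N a" "S = (\<Sum>n\<le>N. compress n (a n))"
    "reduced N b" "g = ext_bracket X D \<alpha> N b" "T = (\<Sum>n\<le>N. compress n (b n))"
    by (rule bracket_graphE2[OF assms])
  show ?thesis
    unfolding *(2,3,5,6)
    by (rule bracket_graphI[OF reduced_mult[OF *(1,4)]])
      (simp_all add: reduced_ext_bracket_mult[OF *(1,4)] reduced_compress_mult[OF *(1,4)])
qed

text \<open>Multiplying the sum from the left by the compression of the conjugate of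
  \<open>a m\<close> kills every term but the m-th, by orthogonality. What remains is the
  compression of |a_m|^2, and \<open>compress_inject\<close> applies.\<close>

lemma bracket_graph_inject:
  assumes f: "bracket_graph f 0"
  shows "f x = 0"
proof -
  obtain N a where a: "reduced N a" "f = ext_bracket X D \<alpha> N a" "0 = (\<Sum>n\<le>N. compress n (a n))"
    by (rule bracket_graphE[OF f])
  have "a m = (\<lambda>_. 0)" if m: "m \<le> N" for m
  proof -
    note aC = reducedD(1)[OF a(1)]
    have cnj: "reduced N (\<lambda>n y. cnj (a n y))"
      by (rule reduced_compose[OF a(1)]) (auto intro: continuous_intros)
    have "compress m (\<lambda>y. cnj (a m y) * a m y) x = 0" for x
    proof -
      have "compress m (\<lambda>y. cnj (a m y)) (compress n (a n) x)
        = (if n = m then compress m (\<lambda>y. cnj (a m y) * a m y) x else 0)" if "n \<le> N" for n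
        using reduced_compress_orthogonal[OF cnj a(1) m that, of x]
          compress_mult[OF cfun_cnj[OF cfun_onD1[OF aC[OF m]]] aC[OF m], of x] by auto
      then have "(\<Sum>n\<le>N. compress m (\<lambda>y. cnj (a m y)) (compress n (a n) x))
        = (\<Sum>n\<le>N. if n = m then compress m (\<lambda>y. cnj (a m y) * a m y) x else 0)"
        by (intro sum.cong refl) simp
      also have "\<dots> = compress m (\<lambda>y. cnj (a m y) * a m y) x"
        using m by simp
      finally have "compress m (\<lambda>y. cnj (a m y) * a m y) x
        = compress m (\<lambda>y. cnj (a m y)) ((\<Sum>n\<le>N. compress n (a n)) x)"
        by (simp add: blinfun.sum_left blinfun.sum_right)
      then show ?thesis
        by (simp flip: a(3))
    qed
    then have "compress m (\<lambda>y. cnj (a m y) * a m y) = 0"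
      by (intro blinfun_eqI) simp
    moreover have "(\<lambda>y. cnj (a m y) * a m y) \<in> C m"
      using reducedD(1)[OF reduced_mult[OF cnj a(1)] m] .
    ultimately have "(\<lambda>y. cnj (a m y) * a m y) = (\<lambda>_. 0)"
      using compress_inject by blast
    then show ?thesis
      by (auto simp: fun_eq_iff)
  qed
  then show ?thesis
    by (simp add: a(2) ext_bracket_eq)
qed

text \<open>In reduced form at a common length the difference of two descriptions is a reduced
  bracket with value 0, so the coefficients themselves agree.\<close>

lemma bracket_graph_unique:
  assumes "bracket_graph f S" "bracket_graph f T"
  shows "S = T"
proof -
  obtain N a b where *: "reduced N a" "f = ext_bracket X D \<alpha> N a" "S = (\<Sum>n\<le>N. compress n (a n))"
    "reduced N b" "f = ext_bracket X D \<alpha> N b" "T = (\<Sum>n\<le>N. compress n (b n))"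
    by (rule bracket_graphE2[OF assms])
  have minus: "reduced N (\<lambda>n y. - b n y)"
    by (rule reduced_compose[OF *(4)]) (auto intro: continuous_intros)
  have "ext_bracket X D \<alpha> N (\<lambda>n y. a n y + - b n y) x = 0" for x
  proof -
    have "ext_bracket X D \<alpha> N (\<lambda>n y. - b n y) x = - ext_bracket X D \<alpha> N b x"
      using reduced_ext_bracket_compose[OF *(4), of uminus] by simp
    moreover have "ext_bracket X D \<alpha> N (\<lambda>n y. a n y + - b n y) x
      = ext_bracket X D \<alpha> N a x + ext_bracket X D \<alpha> N (\<lambda>n y. - b n y) x"
      by (simp only: ext_bracket_eq coord_add sum.distrib)
    ultimately show ?thesis
      by (simp flip: *(2,5))
  qed
  then have "(\<lambda>y. a n y + - b n y) = (\<lambda>_. 0)" if "n \<le> N" for n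
    using reduced_ext_bracket_eq_0[OF reduced_add[OF *(1) minus] _ that] by blast
  then have "a n = b n" if "n \<le> N" for n
    using that by (force simp: fun_eq_iff)
  then show ?thesis
    using *(3,6) by simp
qed

lemma bracket_graph_embed:
  assumes "a \<in> cfun X"
  shows "bracket_graph (ext_embed X D \<alpha> a) (\<pi> a)"
proof -
  have "a \<in> C 0"
    using assms cfun_eq_0[OF assms] by (simp add: cfun_on_def)
  moreover have "ext_embed X D \<alpha> a = coord 0 a"
    by (rule ext) (simp add: ext_embed_def topspace_ext coord_0_eq)
  ultimately show ?thesis
    using bracket_graph_coord[of a 0] by simp
qed

text \<open>Two orbits differ in some coordinate n. If one of the entries is \<open>None\<close>,
  the indicator of \<open>\<Delta> n\<close> separates them; if both are points, a Urysohn function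
  does.\<close>

lemma bracket_graph_separating:
  assumes "orbit_seq x" "orbit_seq y" "x \<noteq> y"
  shows "\<exists>f T. bracket_graph f T \<and> f x \<noteq> f y"
proof -
  obtain n where n: "x n \<noteq> y n"
    using assms(3) by blast
  have ind: "(\<lambda>z. of_bool (z \<in> \<Delta> n)) \<in> C n"
    using cfun_of_bool_dom_iter[of n] by (simp add: cfun_on_def)
  have "\<exists>c\<in>C n. coord n c x \<noteq> coord n c y"
  proof (cases "x n"; cases "y n")
    fix p q assume pq: "x n = Some p" "y n = Some q"
    then have \<Delta>: "p \<in> \<Delta> n" "q \<in> \<Delta> n"
      using orbit_seq_dom_iter assms by blast+
    then have "closedin X {p}" "closedin X {q}" "disjnt {p} {q}"
      using dom_iter_subset_topspace n pq closedin_Hausdorff_singleton[OF Hausdorff] by auto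
    moreover have "normal_space X"
      using compact_Hausdorff_or_regular_imp_normal_space compact Hausdorff by blast
    ultimately obtain u where u: "continuous_map X euclideanreal u" "u ` {p} \<subseteq> {0}" "u ` {q} \<subseteq> {1}"
      using Urysohn_lemma_alt[of X "{p}" "{q}" 0 1] by blast
    define c where "c z = complex_of_real (u z)" for z
    have c: "continuous_map X euclidean c"
      unfolding c_def by (intro continuous_map_compose_euclidean[OF u(1)] continuous_intros)
    \<comment> \<open>The cut-off makes the function an admissible coefficient and keeps its values
      at p and q, which lie in \<open>\<Delta> n\<close>.\<close>
    have "continuous_map X euclidean (\<lambda>z. of_bool (z \<in> \<Delta> n) * c z)"
      by (rule continuous_map_mult_complex[OF cfun_continuous_map[OF cfun_onD1[OF ind]] c])
    then have "(\<lambda>z. of_bool (z \<in> \<Delta> n) * c z) \<in> C n"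
      using dom_iter_subset_topspace[of n] by (auto simp: cfun_on_def cfun_def)
    moreover have "coord n (\<lambda>z. of_bool (z \<in> \<Delta> n) * c z) x \<noteq> coord n (\<lambda>z. of_bool (z \<in> \<Delta> n) * c z) y"
      using pq \<Delta> assms u by (simp add: c_def)
    ultimately show ?thesis by blast
  next
    fix p assume "x n = None" "y n = Some p"
    then show ?thesis
      using ind assms orbit_seq_dom_iter[of y n p] by (intro bexI[OF _ ind]) simp
  next
    fix p assume "x n = Some p" "y n = None"
    then show ?thesis
      using ind assms orbit_seq_dom_iter[of x n p] by (intro bexI[OF _ ind]) simp
  qed (use n in simp)
  then show ?thesis
    using bracket_graph_coord by blast
qed

sublocale ext: star_hom_graph Xe bracket_graph
proof
  show "compact_space Xe"
    by (rule compact_space_ext)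
  show "\<exists>P. bracket_graph (\<lambda>x. if x \<in> topspace Xe then 1 else 0) P"
  proof -
    have "ext_proj x \<in> topspace X" if "orbit_seq x" for x
      using orbit_seqD1[OF that] by (auto simp: ext_proj_def)
    then have "ext_embed X D \<alpha> (\<lambda>y. of_bool (y \<in> topspace X)) = (\<lambda>x. if x \<in> topspace Xe then 1 else 0)"
      by (auto simp: ext_embed_def topspace_ext fun_eq_iff)
    then show ?thesis
      using bracket_graph_embed[OF cfun_of_bool[of X "topspace X"]] by auto
  qed
  show "\<exists>S. bracket_graph (\<lambda>x. \<phi> (f x)) S"
    if f: "bracket_graph f T" and "continuous_on UNIV \<phi>" "\<phi> 0 = 0" for f T \<phi>
  proof -
    obtain N a where "reduced N a" "f = ext_bracket X D \<alpha> N a"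
      by (rule bracket_graphE[OF f])
    then show ?thesis
      using bracket_graph_compose[OF _ that(2,3), of N a] by blast
  qed
  show "\<exists>f T. bracket_graph f T \<and> f x \<noteq> f y"
    if "x \<in> topspace Xe" "y \<in> topspace Xe" "x \<noteq> y" for x y
    using bracket_graph_separating that topspace_ext by blast
qed (blast intro: bracket_graph_cfun bracket_graph_ops bracket_graph_add bracket_graph_mult
  bracket_graph_scale bracket_graph_cnj bracket_graph_unique bracket_graph_inject)+

section \<open>Covariance and the image of the representation\<close>

lemma bracket_graph_endo:
  "bracket_graph f T \<Longrightarrow> bracket_graph (ext_endo X D \<alpha> f) (U o\<^sub>L T o\<^sub>L adj U)"
proof (induction rule: bracket_graph_induct)
  case (coord n c)
  note c = cfun_onD1[OF coord]
  show ?case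
  proof (cases n)
    case 0
    have "\<delta> c \<in> C 0"
      using endo_cfun[OF c] cfun_eq_0[OF endo_cfun[OF c]] by (simp add: cfun_on_def)
    then show ?thesis
      using bracket_graph_coord[of "\<delta> c" 0] by (simp add: 0 ext_endo_coord_0[OF c] covariance[OF c])
  next
    case (Suc m)
    have "c \<in> C (Suc m)"
      using coord by (simp only: Suc)
    then show ?thesis
      using bracket_graph_coord[OF cfun_on_dom_iter_Suc]
      by (simp add: Suc ext_endo_coord_Suc isometry_compress_Suc del: dom_iter.simps)
  qed
next
  case zero
  have "ext_endo X D \<alpha> (\<lambda>_. 0) = (\<lambda>_. 0)"
    by (auto simp: ext_endo_def comp_endo_def)
  moreover have "U o\<^sub>L 0 o\<^sub>L adj U = 0"
    by (rule blinfun_eqI) simp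
  ultimately show ?case
    using bracket_graph_zero by simp
next
  case (add f S g T)
  have "ext_endo X D \<alpha> (\<lambda>x. f x + g x) = (\<lambda>x. ext_endo X D \<alpha> f x + ext_endo X D \<alpha> g x)"
    by (auto simp: ext_endo_def comp_endo_def)
  moreover have "U o\<^sub>L (S + T) o\<^sub>L adj U = (U o\<^sub>L S o\<^sub>L adj U) + (U o\<^sub>L T o\<^sub>L adj U)"
    by (rule blinfun_eqI) (simp add: blinfun.add_left blinfun.add_right)
  ultimately show ?case
    using bracket_graph_add[OF add] by simp
qed

text \<open>Places the generators with arbitrary a in C(X) into the graph, hence into the image of
  the extension; it also supplies the raised level for \<open>ext_endo_inv\<close>.\<close>

lemma bracket_graph_compress:
  assumes "a \<in> cfun X"
  shows "bracket_graph (coord n (\<lambda>y. of_bool (y \<in> \<Delta> n) * a y)) (compress n a)"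
proof -
  have "(\<lambda>y. of_bool (y \<in> \<Delta> n) * a y) \<in> C n"
    using cfun_mult[OF cfun_of_bool_dom_iter assms, of n] by (simp add: cfun_on_def)
  then show ?thesis
    using bracket_graph_coord compress_restrict[OF assms, of n] by metis
qed

lemma bracket_graph_endo_inv:
  "bracket_graph f T \<Longrightarrow> bracket_graph (ext_endo_inv X D \<alpha> f) (adj U o\<^sub>L T o\<^sub>L U)"
proof (induction rule: bracket_graph_induct)
  case (coord n c)
  show ?case
    using bracket_graph_compress[OF cfun_onD1[OF coord], of "Suc n"]
    by (simp only: ext_endo_inv_coord compress_Suc)
next
  case zero
  have "ext_endo_inv X D \<alpha> (\<lambda>_. 0) = (\<lambda>_. 0)"
    by (auto simp: ext_endo_inv_def comp_endo_def)
  moreover have "adj U o\<^sub>L 0 o\<^sub>L U = 0"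
    by (rule blinfun_eqI) simp
  ultimately show ?case
    using bracket_graph_zero by simp
next
  case (add f S g T)
  have "ext_endo_inv X D \<alpha> (\<lambda>x. f x + g x) = (\<lambda>x. ext_endo_inv X D \<alpha> f x + ext_endo_inv X D \<alpha> g x)"
    by (auto simp: ext_endo_inv_def comp_endo_def)
  moreover have "adj U o\<^sub>L (S + T) o\<^sub>L U = (adj U o\<^sub>L S o\<^sub>L U) + (adj U o\<^sub>L T o\<^sub>L U)"
    by (rule blinfun_eqI) (simp add: blinfun.add_left blinfun.add_right)
  ultimately show ?case
    using bracket_graph_add[OF add] by simp
qed

text \<open>Composition with a map, continued by 0 off A, does not increase uniform
  distances.\<close>

lemma uniform_limit_comp_endo:
  fixes F :: "nat \<Rightarrow> 'z \<Rightarrow> complex"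
  assumes "uniform_limit UNIV F f sequentially"
  shows "uniform_limit UNIV (\<lambda>n. comp_endo A \<phi> (F n)) (comp_endo A \<phi> f) sequentially"
proof (rule uniform_limitI)
  fix e :: real assume e: "e > 0"
  show "\<forall>\<^sub>F n in sequentially. \<forall>x\<in>UNIV. dist (comp_endo A \<phi> (F n) x) (comp_endo A \<phi> f x) < e"
    using uniform_limitD[OF assms e] by (rule eventually_mono) (use e in \<open>simp add: comp_endo_def\<close>)
qed

lemma
  assumes "b \<in> cfun Xe"
  shows closure_rep_endo: "ext.closure_rep (ext_endo X D \<alpha> b) = U o\<^sub>L ext.closure_rep b o\<^sub>L adj U"
    and closure_rep_endo_inv: "ext.closure_rep (ext_endo_inv X D \<alpha> b) = adj U o\<^sub>L ext.closure_rep b o\<^sub>L U"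
proof -
  have lim: "(\<lambda>n. V o\<^sub>L S n o\<^sub>L W) \<longlonglongrightarrow> (V o\<^sub>L T o\<^sub>L W)"
    if "S \<longlonglongrightarrow> T" for S T and V W :: "'h \<Rightarrow>\<^sub>L 'h"
    using that by (intro tendsto_intros)
  have ulim: "uniform_limit UNIV (\<lambda>n. ext_endo X D \<alpha> (F n)) (ext_endo X D \<alpha> b) sequentially"
    "uniform_limit UNIV (\<lambda>n. ext_endo_inv X D \<alpha> (F n)) (ext_endo_inv X D \<alpha> b) sequentially"
    if "uniform_limit UNIV F b sequentially" for F
    unfolding ext_endo_def ext_endo_inv_def using that by (rule uniform_limit_comp_endo)+
  note b = ext.closure_graph_rep[OF assms]
  have "ext.closure_graph (ext_endo X D \<alpha> b) (U o\<^sub>L ext.closure_rep b o\<^sub>L adj U)"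
    by (rule ext.closure_graph_map[OF b, of "ext_endo X D \<alpha>" "\<lambda>T. U o\<^sub>L T o\<^sub>L adj U"])
      (erule bracket_graph_endo ulim lim)+
  then show "ext.closure_rep (ext_endo X D \<alpha> b) = U o\<^sub>L ext.closure_rep b o\<^sub>L adj U"
    by (rule ext.closure_rep_eq)
  have "ext.closure_graph (ext_endo_inv X D \<alpha> b) (adj U o\<^sub>L ext.closure_rep b o\<^sub>L U)"
    by (rule ext.closure_graph_map[OF b, of "ext_endo_inv X D \<alpha>" "\<lambda>T. adj U o\<^sub>L T o\<^sub>L U"])
      (erule bracket_graph_endo_inv ulim lim)+
  then show "ext.closure_rep (ext_endo_inv X D \<alpha> b) = adj U o\<^sub>L ext.closure_rep b o\<^sub>L U"
    by (rule ext.closure_rep_eq)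
qed

lemma star_rep_closure_rep: "star_rep Xe ext.closure_rep"
  and inj_closure_rep: "inj_on ext.closure_rep (cfun Xe)"
  using ext.faithful_rep_closure_rep by (simp_all add: faithful_rep_def)

lemma closure_rep_embed: "a \<in> cfun X \<Longrightarrow> ext.closure_rep (ext_embed X D \<alpha> a) = \<pi> a"
  by (intro ext.closure_rep_of_graph bracket_graph_embed)

text \<open>Bracket operators lie in every C*-subalgebra containing the generators, and so do their
  limits, which form the image. Conversely the image is itself a C*-subalgebra, since it is closed
  and the image of a star-homomorphism.\<close>

lemma closure_rep_image_eq_generated:
  "ext.closure_rep ` cfun Xe
    = cstar_generated (\<Union>n. {op_pow (adj U) n o\<^sub>L \<pi> a o\<^sub>L op_pow U n |a. a \<in> cfun X})"
  (is "?I = cstar_generated ?G")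
proof (rule subset_antisym)
  have G: "?G = (\<Union>n. {compress n a |a. a \<in> cfun X})"
    by (simp add: compress_def)
  have "?I \<subseteq> B" if B: "cstar_subalgebra B" "?G \<subseteq> B" for B
  proof -
    have "T \<in> B" if "bracket_graph f T" for f T
      using that
    proof (induction rule: bracket_graph_induct)
      case (coord n c)
      then show ?case
        using B(2) cfun_onD1 unfolding G by blast
    qed (use B(1) in \<open>auto simp: cstar_subalgebra_def\<close>)
    moreover have "closed B"
      using B(1) by (simp add: cstar_subalgebra_def)
    ultimately show ?thesis
      unfolding ext.closure_rep_image by (intro closure_minimal) auto
  qed
  then show "?I \<subseteq> cstar_generated ?G"
    unfolding cstar_generated_def by blast
  have "compress n a \<in> ?I" if "a \<in> cfun X" for n a
    by (rule image_eqI[OF ext.closure_rep_of_graph[symmetric] bracket_graph_cfun])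
      (rule bracket_graph_compress[OF that])+
  then have "?G \<subseteq> ?I"
    unfolding G by blast
  moreover have "cstar_subalgebra ?I"
    unfolding cstar_subalgebra_def
  proof (intro conjI ballI allI)
    note rep = star_rep_closure_rep[unfolded star_rep_def]
    show "?I \<subseteq> bounded_ops"
      using rep by blast
    show "closed ?I"
      by (simp add: ext.closure_rep_image)
    show "0 \<in> ?I"
      by (rule image_eqI[OF _ cfun_zero]) (simp add: ext.closure_rep_of_graph[OF bracket_graph_zero])
    fix S assume "S \<in> ?I"
    then obtain f where f: "f \<in> cfun Xe" "S = ext.closure_rep f"
      by blast
    show "adj S \<in> ?I"
      by (rule image_eqI[OF _ cfun_cnj[OF f(1)]]) (use rep f in simp)
    show "cscale_op c S \<in> ?I" for c
      by (rule image_eqI[OF _ cfun_scale[OF f(1)]]) (use rep f in simp)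
    fix T assume "T \<in> ?I"
    then obtain g where g: "g \<in> cfun Xe" "T = ext.closure_rep g"
      by blast
    show "S + T \<in> ?I"
      by (rule image_eqI[OF _ cfun_add[OF f(1) g(1)]]) (use rep f g in simp)
    show "S o\<^sub>L T \<in> ?I"
      by (rule image_eqI[OF _ cfun_mult[OF f(1) g(1)]]) (use rep f g in simp)
  qed
  ultimately show "cstar_generated ?G \<subseteq> ?I"
    unfolding cstar_generated_def by blast
qed

text \<open>Both sides are the range of one projection, because the embedding of C(X) sends the
  indicator of S to that of its preimage. Thus the initial and final spaces of U carry over to the
  extension.\<close>

lemma closure_rep_range_cfun_on:
  assumes "openin X S" "closedin X S"
  shows "{ext.closure_rep f h |f h. f \<in> cfun_on (ext_preimage X D \<alpha> S) Xe}
    = {\<pi> f h |f h. f \<in> cfun_on S X}"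
proof -
  note S = cfun_of_bool[OF assms]
  have eq: "ext_embed X D \<alpha> (\<lambda>y. of_bool (y \<in> S)) = (\<lambda>x. of_bool (x \<in> ext_preimage X D \<alpha> S))"
    by (auto simp: ext_embed_def ext_preimage_def fun_eq_iff)
  then have "(\<lambda>x. of_bool (x \<in> ext_preimage X D \<alpha> S)) \<in> cfun Xe"
    using bracket_graph_cfun[OF bracket_graph_embed[OF S]] by simp
  then show ?thesis
    using star_rep_range_cfun_on[OF star_rep_closure_rep] star_rep_range_cfun_on[OF star_rep S]
      closure_rep_embed[OF S] eq by simp
qed

lemma cov_faith_rep_closure_rep:
  "cov_faith_rep Xe (ext_preimage X D \<alpha> D) (ext_preimage X D \<alpha> (\<alpha> ` D)) (ext_endo X D \<alpha>) ext.closure_rep U"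
  using cov ext.faithful_rep_closure_rep closure_rep_endo
    closure_rep_range_cfun_on[OF open_dom closed_dom] closure_rep_range_cfun_on[OF open_range closed_range]
  by (simp add: cov_faith_rep_def)

end

theorem theorem3p10:
  fixes X :: "'a topology" and \<Delta>1 :: "'a set" and \<alpha> :: "'a \<Rightarrow> 'a"
    and \<pi> :: "('a \<Rightarrow> complex) \<Rightarrow> 'h::chilbert_space \<Rightarrow>\<^sub>L 'h" and U :: "'h \<Rightarrow>\<^sub>L 'h"
  assumes "compact_space X" and "Hausdorff_space X"
    and "openin X \<Delta>1" and "closedin X \<Delta>1"
    and "continuous_map (subtopology X \<Delta>1) X \<alpha>"
    and "openin X (\<alpha> ` \<Delta>1)"
    and "cov_faith_rep X \<Delta>1 (\<alpha> ` \<Delta>1) (comp_endo \<Delta>1 \<alpha>) \<pi> U"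
  shows "\<exists>\<pi>' :: ((nat \<Rightarrow> 'a option) \<Rightarrow> complex) \<Rightarrow> 'h \<Rightarrow>\<^sub>L 'h.
    (\<forall>a\<in>cfun X. \<pi>' (ext_embed X \<Delta>1 \<alpha> a) = \<pi> a) \<and>
    star_rep (ext_space X \<Delta>1 \<alpha>) \<pi>' \<and>
    bij_betw \<pi>' (cfun (ext_space X \<Delta>1 \<alpha>))
      (cstar_generated (\<Union>n. {op_pow (adj U) n o\<^sub>L \<pi> a o\<^sub>L op_pow U n |a. a \<in> cfun X})) \<and>
    (\<forall>N a. (\<forall>n\<le>N. a n \<in> cfun_on (dom_iter X \<Delta>1 \<alpha> n) X) \<longrightarrow>
       \<pi>' (ext_bracket X \<Delta>1 \<alpha> N a) =
         (\<Sum>n\<le>N. op_pow (adj U) n o\<^sub>L \<pi> (a n) o\<^sub>L op_pow U n)) \<and>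
    cov_faith_rep (ext_space X \<Delta>1 \<alpha>)
      (ext_preimage X \<Delta>1 \<alpha> \<Delta>1) (ext_preimage X \<Delta>1 \<alpha> (\<alpha> ` \<Delta>1))
      (ext_endo X \<Delta>1 \<alpha>) \<pi>' U \<and>
    (\<forall>b\<in>cfun (ext_space X \<Delta>1 \<alpha>).
       \<pi>' (ext_endo X \<Delta>1 \<alpha> b) = U o\<^sub>L \<pi>' b o\<^sub>L adj U \<and>
       \<pi>' (ext_endo_inv X \<Delta>1 \<alpha> b) = adj U o\<^sub>L \<pi>' b o\<^sub>L U)"
proof -
  interpret covariant_rep X \<Delta>1 \<alpha> \<pi> U
    using assms by unfold_locales
  have "ext.closure_rep (ext_bracket X \<Delta>1 \<alpha> N a) = (\<Sum>n\<le>N. op_pow (adj U) n o\<^sub>L \<pi> (a n) o\<^sub>L op_pow U n)"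
    if "\<forall>n\<le>N. a n \<in> cfun_on (dom_iter X \<Delta>1 \<alpha> n) X" for N a
    unfolding compress_def[symmetric]
    by (rule ext.closure_rep_of_graph) (use that in \<open>auto simp only: bracket_graph_def\<close>)
  then show ?thesis
    using closure_rep_embed star_rep_closure_rep inj_closure_rep closure_rep_image_eq_generated
      cov_faith_rep_closure_rep closure_rep_endo closure_rep_endo_inv
    by (intro exI[of _ ext.closure_rep]) (simp add: bij_betw_def)
qed

end
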